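(* Let $\{(A_\gamma,\mathfrak{m}_\gamma):\gamma\in\Gamma\}$ be a pure direct system of Noetherian regular local rings whose transition maps $A_\gamma\to A_\delta$ are local homomorphisms of rings for all $(\gamma,\delta)\in\Gamma\times\Gamma$ with $\gamma\le\delta$. If $A:=\varinjlim_{\gamma\in\Gamma}A_\gamma$ is Noetherian, then there exists $\lambda\in\Gamma$ such that the direct system $\{A_\gamma:\lambda\le\gamma,\ \gamma\in\Gamma\}$ is flat.
   Context: All rings are commutative. All direct systems are assumed to be filtered (indexed by a directed set). A ring homomorphism $R\to S$ is pure if $M\to M\otimes_R S$ is injective for every $R$-module $M$. A direct system of rings is pure (resp. flat) if $A_\gamma\to A_\delta$ is pure (resp. flat) for all indices $\gamma\le\delta$. $\mathfrak{m}_\gamma$ is the maximal ideal of $A_\gamma$. *)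

theory Defs
  imports "HOL-Algebra.Algebra" "HOL-Library.Extended_Nat"
begin

section \<open>Regular local rings\<close>

definition local_ring :: "('a, 'r) ring_scheme \<Rightarrow> 'a set \<Rightarrow> bool" where
  "local_ring R m \<longleftrightarrow>
     cring R \<and> maximalideal m R \<and> (\<forall>n. maximalideal n R \<longrightarrow> n = m)"

definition local_hom ::
  "('a, 'r) ring_scheme \<Rightarrow> 'a set \<Rightarrow> ('b, 's) ring_scheme \<Rightarrow> 'b set \<Rightarrow> ('a \<Rightarrow> 'b) \<Rightarrow> bool" where
  "local_hom R m S n f \<longleftrightarrow> f \<in> ring_hom R S \<and> f ` m \<subseteq> n"

text \<open>Supremum of the lengths of the chains \<open>P 0 \<subset> \<dots> \<subset> P n\<close> of prime ideals; the zero ring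
  gets dimension \<open>0\<close>, a value which is irrelevant for local rings.\<close>

definition krull_dim :: "('a, 'r) ring_scheme \<Rightarrow> enat" where
  "krull_dim R =
     Sup {enat n | n. \<exists>P. (\<forall>i\<le>n. primeideal (P i) R) \<and> (\<forall>i<n. P i \<subset> P (Suc i))}"

definition min_generators :: "('a, 'r) ring_scheme \<Rightarrow> 'a set \<Rightarrow> enat" where
  "min_generators R I =
     Inf {enat (card U) | U. finite U \<and> U \<subseteq> carrier R \<and> Idl\<^bsub>R\<^esub> U = I}"

definition regular_local_ring :: "('a, 'r) ring_scheme \<Rightarrow> 'a set \<Rightarrow> bool" where
  "regular_local_ring R m \<longleftrightarrow>
     noetherian_ring R \<and> local_ring R m \<and> krull_dim R = min_generators R m"


section \<open>Tensor products of modules\<close>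

text \<open>The tensor product is the free abelian group on the pairs modulo the bilinearity and balancing
  relations. Following \<^const>\<open>free_Abelian_group\<close> and \<^const>\<open>FactGroup\<close>, its group operation is
  the multiplication of a \<^typ>\<open>'a monoid\<close>.\<close>

abbreviation pairs_group ::
  "('a, 'm, 'y) module_scheme \<Rightarrow> ('a, 'n, 'z) module_scheme \<Rightarrow> ('m \<times> 'n \<Rightarrow>\<^sub>0 int) monoid" where
  "pairs_group M N \<equiv> free_Abelian_group (carrier M \<times> carrier N)"

definition tensor_relators ::
  "('a, 'r) ring_scheme \<Rightarrow> ('a, 'm, 'y) module_scheme \<Rightarrow> ('a, 'n, 'z) module_scheme
     \<Rightarrow> ('m \<times> 'n \<Rightarrow>\<^sub>0 int) set" where
  "tensor_relators R M N =
     {frag_of (x \<oplus>\<^bsub>M\<^esub> y, z) - frag_of (x, z) - frag_of (y, z) | x y z.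
        x \<in> carrier M \<and> y \<in> carrier M \<and> z \<in> carrier N} \<union>
     {frag_of (x, y \<oplus>\<^bsub>N\<^esub> z) - frag_of (x, y) - frag_of (x, z) | x y z.
        x \<in> carrier M \<and> y \<in> carrier N \<and> z \<in> carrier N} \<union>
     {frag_of (a \<odot>\<^bsub>M\<^esub> x, y) - frag_of (x, a \<odot>\<^bsub>N\<^esub> y) | a x y.
        a \<in> carrier R \<and> x \<in> carrier M \<and> y \<in> carrier N}"

definition tensor_kernel ::
  "('a, 'r) ring_scheme \<Rightarrow> ('a, 'm, 'y) module_scheme \<Rightarrow> ('a, 'n, 'z) module_scheme
     \<Rightarrow> ('m \<times> 'n \<Rightarrow>\<^sub>0 int) set" where
  "tensor_kernel R M N = generate (pairs_group M N) (tensor_relators R M N)"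

definition tensor_product ::
  "('a, 'r) ring_scheme \<Rightarrow> ('a, 'm, 'y) module_scheme \<Rightarrow> ('a, 'n, 'z) module_scheme
     \<Rightarrow> ('m \<times> 'n \<Rightarrow>\<^sub>0 int) set monoid" where
  "tensor_product R M N = pairs_group M N Mod tensor_kernel R M N"

definition tensor ::
  "('a, 'r) ring_scheme \<Rightarrow> ('a, 'm, 'y) module_scheme \<Rightarrow> ('a, 'n, 'z) module_scheme
     \<Rightarrow> 'm \<Rightarrow> 'n \<Rightarrow> ('m \<times> 'n \<Rightarrow>\<^sub>0 int) set" where
  "tensor R M N x y = tensor_kernel R M N #>\<^bsub>pairs_group M N\<^esub> frag_of (x, y)"

definition linear_map ::
  "('a, 'r) ring_scheme \<Rightarrow> ('a, 'm, 'y) module_scheme \<Rightarrow> ('a, 'n, 'z) module_scheme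
     \<Rightarrow> ('m \<Rightarrow> 'n) \<Rightarrow> bool" where
  "linear_map R M N g \<longleftrightarrow>
     g \<in> carrier M \<rightarrow> carrier N \<and>
     (\<forall>x\<in>carrier M. \<forall>y\<in>carrier M. g (x \<oplus>\<^bsub>M\<^esub> y) = g x \<oplus>\<^bsub>N\<^esub> g y) \<and>
     (\<forall>a\<in>carrier R. \<forall>x\<in>carrier M. g (a \<odot>\<^bsub>M\<^esub> x) = a \<odot>\<^bsub>N\<^esub> g x)"

abbreviation frag_map_fst :: "('m \<Rightarrow> 'k) \<Rightarrow> ('m \<times> 'n \<Rightarrow>\<^sub>0 int) \<Rightarrow> ('k \<times> 'n \<Rightarrow>\<^sub>0 int)" where
  "frag_map_fst g \<equiv> frag_extend (\<lambda>(x, y). frag_of (g x, y))"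

text \<open>The map \<open>g \<otimes> id\<close> from \<open>M \<otimes> N\<close> to \<open>M' \<otimes> N\<close>, on cosets.\<close>

definition tensor_map ::
  "('a, 'r) ring_scheme \<Rightarrow> ('a, 'm, 'x) module_scheme \<Rightarrow> ('a, 'k, 'y) module_scheme
     \<Rightarrow> ('a, 'n, 'z) module_scheme \<Rightarrow> ('m \<Rightarrow> 'k)
     \<Rightarrow> ('m \<times> 'n \<Rightarrow>\<^sub>0 int) set \<Rightarrow> ('k \<times> 'n \<Rightarrow>\<^sub>0 int) set" where
  "tensor_map R M M' N g U =
     the_elem ((\<lambda>c. tensor_kernel R M' N #>\<^bsub>pairs_group M' N\<^esub> frag_map_fst g c) ` U)"


section \<open>Pure and flat ring homomorphisms\<close>

definition restrict_scalars :: "('a \<Rightarrow> 'b) \<Rightarrow> ('b, 's) ring_scheme \<Rightarrow> ('a, 'b) module" where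
  "restrict_scalars f S =
     \<lparr>carrier = carrier S, monoid.mult = monoid.mult S, one = one S, ring.zero = ring.zero S, ring.add = ring.add S,
      smult = (\<lambda>a s. f a \<otimes>\<^bsub>S\<^esub> s)\<rparr>"

text \<open>
  A definition in HOL cannot quantify over modules of all carrier types. The modules in the
  following two definitions have as elements lists over the type of the ring. Up to isomorphism
  this covers all finitely generated modules, and it entails the property for modules over
  arbitrary carrier types; this is proved below in \<open>pure_hom_inj\<close> and \<open>flat_module_inj\<close>.
\<close>

definition pure_hom ::
  "('a, 'r) ring_scheme \<Rightarrow> ('b, 's) ring_scheme \<Rightarrow> ('a \<Rightarrow> 'b) \<Rightarrow> bool" where
  "pure_hom R S f \<longleftrightarrow> cring R \<and> cring S \<and> f \<in> ring_hom R S \<and>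
     (\<forall>M :: ('a, 'a list) module. module R M \<longrightarrow>
        inj_on (\<lambda>x. tensor R M (restrict_scalars f S) x \<one>\<^bsub>S\<^esub>) (carrier M))"

definition flat_module :: "('a, 'r) ring_scheme \<Rightarrow> ('a, 'n, 'z) module_scheme \<Rightarrow> bool" where
  "flat_module R N \<longleftrightarrow> module R N \<and>
     (\<forall>(M :: ('a, 'a list) module) (M' :: ('a, 'a list) module) g.
        module R M \<longrightarrow> module R M' \<longrightarrow> linear_map R M M' g \<longrightarrow> inj_on g (carrier M) \<longrightarrow>
        inj_on (tensor_map R M M' N g) (carrier (tensor_product R M N)))"

definition flat_hom ::
  "('a, 'r) ring_scheme \<Rightarrow> ('b, 's) ring_scheme \<Rightarrow> ('a \<Rightarrow> 'b) \<Rightarrow> bool" where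
  "flat_hom R S f \<longleftrightarrow> cring R \<and> cring S \<and> f \<in> ring_hom R S \<and>
     flat_module R (restrict_scalars f S)"


section \<open>Direct systems of rings\<close>

locale ring_direct_system =
  fixes \<Gamma> :: "'i set" and r :: "('i \<times> 'i) set"
    and A :: "'i \<Rightarrow> ('a, 'r) ring_scheme" and f :: "'i \<Rightarrow> 'i \<Rightarrow> 'a \<Rightarrow> 'a"
  assumes preorder: "preorder_on \<Gamma> r"
    and nonempty: "\<Gamma> \<noteq> {}"
    and directed: "\<lbrakk>i \<in> \<Gamma>; j \<in> \<Gamma>\<rbrakk> \<Longrightarrow> \<exists>k\<in>\<Gamma>. (i, k) \<in> r \<and> (j, k) \<in> r"
    and rings: "i \<in> \<Gamma> \<Longrightarrow> cring (A i)"
    and homs: "(i, j) \<in> r \<Longrightarrow> f i j \<in> ring_hom (A i) (A j)"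
    and trans_id: "\<lbrakk>i \<in> \<Gamma>; x \<in> carrier (A i)\<rbrakk> \<Longrightarrow> f i i x = x"
    and trans_comp: "\<lbrakk>(i, j) \<in> r; (j, k) \<in> r; x \<in> carrier (A i)\<rbrakk> \<Longrightarrow> f j k (f i j x) = f i k x"

definition pure_direct_system ::
  "'i set \<Rightarrow> ('i \<times> 'i) set \<Rightarrow> ('i \<Rightarrow> ('a, 'r) ring_scheme) \<Rightarrow> ('i \<Rightarrow> 'i \<Rightarrow> 'a \<Rightarrow> 'a) \<Rightarrow> bool" where
  "pure_direct_system \<Gamma> r A f \<longleftrightarrow>
     ring_direct_system \<Gamma> r A f \<and> (\<forall>(i, j)\<in>r. pure_hom (A i) (A j) (f i j))"

definition flat_direct_system ::
  "'i set \<Rightarrow> ('i \<times> 'i) set \<Rightarrow> ('i \<Rightarrow> ('a, 'r) ring_scheme) \<Rightarrow> ('i \<Rightarrow> 'i \<Rightarrow> 'a \<Rightarrow> 'a) \<Rightarrow> bool" where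
  "flat_direct_system \<Gamma> r A f \<longleftrightarrow>
     ring_direct_system \<Gamma> r A f \<and> (\<forall>(i, j)\<in>r. flat_hom (A i) (A j) (f i j))"

text \<open>The direct limit is the disjoint union of the rings modulo eventual equality. Each operation
  below is a union over all representatives, all of which contribute the same class.\<close>

definition eventually_equal ::
  "'i set \<Rightarrow> ('i \<times> 'i) set \<Rightarrow> ('i \<Rightarrow> ('a, 'r) ring_scheme) \<Rightarrow> ('i \<Rightarrow> 'i \<Rightarrow> 'a \<Rightarrow> 'a)
     \<Rightarrow> (('i \<times> 'a) \<times> ('i \<times> 'a)) set" where
  "eventually_equal \<Gamma> r A f =
     {((i, x), (j, y)). i \<in> \<Gamma> \<and> j \<in> \<Gamma> \<and> x \<in> carrier (A i) \<and> y \<in> carrier (A j) \<and>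
        (\<exists>k\<in>\<Gamma>. (i, k) \<in> r \<and> (j, k) \<in> r \<and> f i k x = f j k y)}"

definition limit_class ::
  "'i set \<Rightarrow> ('i \<times> 'i) set \<Rightarrow> ('i \<Rightarrow> ('a, 'r) ring_scheme) \<Rightarrow> ('i \<Rightarrow> 'i \<Rightarrow> 'a \<Rightarrow> 'a)
     \<Rightarrow> 'i \<Rightarrow> 'a \<Rightarrow> ('i \<times> 'a) set" where
  "limit_class \<Gamma> r A f i x = eventually_equal \<Gamma> r A f `` {(i, x)}"

definition limit_op ::
  "'i set \<Rightarrow> ('i \<times> 'i) set \<Rightarrow> ('i \<Rightarrow> ('a, 'r) ring_scheme) \<Rightarrow> ('i \<Rightarrow> 'i \<Rightarrow> 'a \<Rightarrow> 'a)
     \<Rightarrow> ('i \<Rightarrow> 'a \<Rightarrow> 'a \<Rightarrow> 'a) \<Rightarrow> ('i \<times> 'a) set \<Rightarrow> ('i \<times> 'a) set \<Rightarrow> ('i \<times> 'a) set" where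
  "limit_op \<Gamma> r A f opr U V =
     (\<Union>(i, x)\<in>U. \<Union>(j, y)\<in>V. \<Union>k\<in>{k \<in> \<Gamma>. (i, k) \<in> r \<and> (j, k) \<in> r}.
        limit_class \<Gamma> r A f k (opr k (f i k x) (f j k y)))"

definition direct_limit ::
  "'i set \<Rightarrow> ('i \<times> 'i) set \<Rightarrow> ('i \<Rightarrow> ('a, 'r) ring_scheme) \<Rightarrow> ('i \<Rightarrow> 'i \<Rightarrow> 'a \<Rightarrow> 'a)
     \<Rightarrow> ('i \<times> 'a) set ring" where
  "direct_limit \<Gamma> r A f =
     \<lparr>carrier = (SIGMA i:\<Gamma>. carrier (A i)) // eventually_equal \<Gamma> r A f,
      monoid.mult = limit_op \<Gamma> r A f (\<lambda>k. monoid.mult (A k)),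
      one = (\<Union>i\<in>\<Gamma>. limit_class \<Gamma> r A f i \<one>\<^bsub>A i\<^esub>),
      ring.zero = (\<Union>i\<in>\<Gamma>. limit_class \<Gamma> r A f i \<zero>\<^bsub>A i\<^esub>),
      ring.add = limit_op \<Gamma> r A f (\<lambda>k. ring.add (A k))\<rparr>"


section \<open>Independence of the carrier type\<close>

lemma tensor_relators_carrier:
  fixes M :: "('a, 'c, 'y) module_scheme" and N :: "('a, 'e, 'z) module_scheme"
  assumes "module R M" "module R N"
  shows "tensor_relators R M N \<subseteq> carrier (pairs_group M N)"
proof -
  interpret M: module R M by fact
  interpret N: module R N by fact
  have "Poly_Mapping.keys (frag_of a - frag_of b - frag_of c) \<subseteq> S"
    if "a \<in> S" "b \<in> S" "c \<in> S" for a b c and S :: "('c \<times> 'e) set"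
    using keys_diff[of "frag_of a - frag_of b" "frag_of c"] keys_diff[of "frag_of a" "frag_of b"] that
    by auto
  then have 3: "frag_of a - frag_of b - frag_of c \<in> carrier (free_Abelian_group S)"
    if "a \<in> S" "b \<in> S" "c \<in> S" for a b c and S :: "('c \<times> 'e) set"
    using that by simp
  have "Poly_Mapping.keys (frag_of a - frag_of b) \<subseteq> S"
    if "a \<in> S" "b \<in> S" for a b and S :: "('c \<times> 'e) set"
    using keys_diff[of "frag_of a" "frag_of b"] that by auto
  then have 2: "frag_of a - frag_of b \<in> carrier (free_Abelian_group S)"
    if "a \<in> S" "b \<in> S" for a b and S :: "('c \<times> 'e) set"
    using that by simp
  show ?thesis
    unfolding tensor_relators_def Un_subset_iff
    by (intro conjI subsetI; elim CollectE exE conjE; hypsubst; intro 2 3) auto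
qed

lemma tensor_kernel_subgroup:
  assumes "module R M" "module R N"
  shows "subgroup (tensor_kernel R M N) (pairs_group M N)"
  unfolding tensor_kernel_def
  by (rule group.generate_is_subgroup[OF group_free_Abelian_group tensor_relators_carrier[OF assms]])

lemma tensor_kernel_props:
  assumes "module R M" "module R N"
  shows "c \<in> tensor_kernel R M N \<Longrightarrow> Poly_Mapping.keys c \<subseteq> carrier M \<times> carrier N"
    and "0 \<in> tensor_kernel R M N"
    and "\<lbrakk>c \<in> tensor_kernel R M N; d \<in> tensor_kernel R M N\<rbrakk> \<Longrightarrow> c + d \<in> tensor_kernel R M N"
    and "c \<in> tensor_kernel R M N \<Longrightarrow> - c \<in> tensor_kernel R M N"
proof -
  note S = tensor_kernel_subgroup[OF assms]
  show K: "Poly_Mapping.keys c \<subseteq> carrier M \<times> carrier N" if "c \<in> tensor_kernel R M N" for c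
    using subgroup.mem_carrier[OF S that] by simp
  show "0 \<in> tensor_kernel R M N"
    using subgroup.one_closed[OF S] by simp
  show "c + d \<in> tensor_kernel R M N" if "c \<in> tensor_kernel R M N" "d \<in> tensor_kernel R M N"
    using subgroup.m_closed[OF S that] by simp
  show "- c \<in> tensor_kernel R M N" if "c \<in> tensor_kernel R M N"
    using subgroup.m_inv_closed[OF S that] K[OF that] by simp
qed

lemma tensor_coset_eq_iff:
  assumes "module R M" "module R N"
  shows "tensor_kernel R M N #>\<^bsub>pairs_group M N\<^esub> c = tensor_kernel R M N #>\<^bsub>pairs_group M N\<^esub> d
           \<longleftrightarrow> c - d \<in> tensor_kernel R M N" (is "?L = ?R \<longleftrightarrow> _")
proof
  note T = tensor_kernel_props[OF assms]
  assume "?L = ?R"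
  moreover have "c \<in> ?L"
    using T(2) by (force simp: r_coset_def)
  ultimately have "c \<in> ?R"
    by simp
  then show "c - d \<in> tensor_kernel R M N"
    by (auto simp: r_coset_def)
next
  note T = tensor_kernel_props[OF assms]
  assume *: "c - d \<in> tensor_kernel R M N"
  have "u + c \<in> ?R" if "u \<in> tensor_kernel R M N" for u
    using T(3)[OF that *] by (auto simp: r_coset_def intro!: bexI[of _ "u + (c - d)"])
  moreover have "u + d \<in> ?L" if "u \<in> tensor_kernel R M N" for u
    using T(3)[OF that T(4)[OF *]] by (auto simp: r_coset_def intro!: bexI[of _ "u + - (c - d)"])
  ultimately show "?L = ?R"
    by (auto simp: r_coset_def)
qed

lemma tensor_kernel_functorial:
  assumes M: "module R M" and M': "module R M'" and N: "module R N"
    and g: "linear_map R M M' g" and c: "c \<in> tensor_kernel R M N"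
  shows "frag_map_fst g c \<in> tensor_kernel R M' N"
proof -
  interpret M: module R M by fact
  note T = tensor_kernel_props[OF M' N]
  have incl: "t \<in> tensor_kernel R M' N" if "t \<in> tensor_relators R M' N" for t
    unfolding tensor_kernel_def using that by (rule generate.incl)
  have gc: "g x \<in> carrier M'" if "x \<in> carrier M" for x
    using g that by (auto simp: linear_map_def)
  have rel: "frag_map_fst g t \<in> tensor_relators R M' N" if "t \<in> tensor_relators R M N" for t
  proof -
    from that consider
      (1) x y z where "t = frag_of (x \<oplus>\<^bsub>M\<^esub> y, z) - frag_of (x, z) - frag_of (y, z)"
            "x \<in> carrier M" "y \<in> carrier M" "z \<in> carrier N"
    | (2) x y z where "t = frag_of (x, y \<oplus>\<^bsub>N\<^esub> z) - frag_of (x, y) - frag_of (x, z)"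
            "x \<in> carrier M" "y \<in> carrier N" "z \<in> carrier N"
    | (3) a x y where "t = frag_of (a \<odot>\<^bsub>M\<^esub> x, y) - frag_of (x, a \<odot>\<^bsub>N\<^esub> y)"
            "a \<in> carrier R" "x \<in> carrier M" "y \<in> carrier N"
      unfolding tensor_relators_def by blast
    then show ?thesis
    proof cases
      case 1
      then have "frag_map_fst g t = frag_of (g x \<oplus>\<^bsub>M'\<^esub> g y, z) - frag_of (g x, z) - frag_of (g y, z)"
        using g by (simp add: frag_extend_diff linear_map_def)
      then show ?thesis
        unfolding tensor_relators_def using 1 gc by blast
    next
      case 2
      then have "frag_map_fst g t = frag_of (g x, y \<oplus>\<^bsub>N\<^esub> z) - frag_of (g x, y) - frag_of (g x, z)"
        by (simp add: frag_extend_diff)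
      then show ?thesis
        unfolding tensor_relators_def using 2 gc by blast
    next
      case 3
      then have "frag_map_fst g t = frag_of (a \<odot>\<^bsub>M'\<^esub> g x, y) - frag_of (g x, a \<odot>\<^bsub>N\<^esub> y)"
        using g by (simp add: frag_extend_diff linear_map_def)
      then show ?thesis
        unfolding tensor_relators_def using 3 gc by blast
    qed
  qed
  show ?thesis
    using c unfolding tensor_kernel_def[of R M N]
  proof (induction rule: generate.induct)
    case one
    then show ?case using T(2) by simp
  next
    case (incl h)
    then show ?case using rel \<open>\<And>t. t \<in> tensor_relators R M' N \<Longrightarrow> t \<in> tensor_kernel R M' N\<close> by blast
  next
    case (inv h)
    then have "inv\<^bsub>pairs_group M N\<^esub> h = - h"
      using subsetD[OF tensor_relators_carrier[OF M N] inv] by simp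
    then show ?case using T(4)[OF incl[OF rel[OF inv]]] by (simp add: frag_extend_minus)
  next
    case (eng h1 h2)
    then show ?case using T(3) by (simp add: frag_extend_add)
  qed
qed

lemma tensor_map_coset:
  assumes M: "module R M" and M': "module R M'" and N: "module R N" and g: "linear_map R M M' g"
  shows "tensor_map R M M' N g (tensor_kernel R M N #>\<^bsub>pairs_group M N\<^esub> c) =
           tensor_kernel R M' N #>\<^bsub>pairs_group M' N\<^esub> frag_map_fst g c"
proof -
  have "tensor_kernel R M' N #>\<^bsub>pairs_group M' N\<^esub> frag_map_fst g (t + c) =
          tensor_kernel R M' N #>\<^bsub>pairs_group M' N\<^esub> frag_map_fst g c" if "t \<in> tensor_kernel R M N" for t
    using tensor_kernel_functorial[OF assms that]
    by (simp add: tensor_coset_eq_iff[OF M' N] frag_extend_add)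
  moreover have "0 \<in> tensor_kernel R M N"
    by (rule tensor_kernel_props[OF M N])
  ultimately have "(\<lambda>c. tensor_kernel R M' N #>\<^bsub>pairs_group M' N\<^esub> frag_map_fst g c) `
      (tensor_kernel R M N #>\<^bsub>pairs_group M N\<^esub> c)
     = {tensor_kernel R M' N #>\<^bsub>pairs_group M' N\<^esub> frag_map_fst g c}"
    by (auto simp: r_coset_def image_UN)
  then show ?thesis
    by (simp add: tensor_map_def)
qed

lemma tensor_map_inj_iff:
  assumes M: "module R M" and M': "module R M'" and N: "module R N" and g: "linear_map R M M' g"
  shows "inj_on (tensor_map R M M' N g) (carrier (tensor_product R M N)) \<longleftrightarrow>
    (\<forall>c. Poly_Mapping.keys c \<subseteq> carrier M \<times> carrier N \<longrightarrow>
       frag_map_fst g c \<in> tensor_kernel R M' N \<longrightarrow> c \<in> tensor_kernel R M N)" (is "?L \<longleftrightarrow> ?R")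
proof -
  let ?co = "\<lambda>c. tensor_kernel R M N #>\<^bsub>pairs_group M N\<^esub> c"
  have car: "carrier (tensor_product R M N) = ?co ` {c. Poly_Mapping.keys c \<subseteq> carrier M \<times> carrier N}"
    unfolding tensor_product_def carrier_FactGroup
    by (rule arg_cong[where f = "image _"]) (auto simp: carrier_free_Abelian_group_iff)
  have L: "?L \<longleftrightarrow> (\<forall>c d. Poly_Mapping.keys c \<subseteq> carrier M \<times> carrier N \<longrightarrow>
       Poly_Mapping.keys d \<subseteq> carrier M \<times> carrier N \<longrightarrow>
       frag_map_fst g (c - d) \<in> tensor_kernel R M' N \<longrightarrow> c - d \<in> tensor_kernel R M N)"
    unfolding car inj_on_def
    by (simp add: tensor_map_coset[OF assms] tensor_coset_eq_iff[OF M N] tensor_coset_eq_iff[OF M' N]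
        frag_extend_diff imp_conjL)
  show ?thesis
    unfolding L
  proof safe
    fix c
    assume *: "\<forall>c d. Poly_Mapping.keys c \<subseteq> carrier M \<times> carrier N \<longrightarrow>
       Poly_Mapping.keys d \<subseteq> carrier M \<times> carrier N \<longrightarrow>
       frag_map_fst g (c - d) \<in> tensor_kernel R M' N \<longrightarrow> c - d \<in> tensor_kernel R M N"
      and "Poly_Mapping.keys c \<subseteq> carrier M \<times> carrier N" "frag_map_fst g c \<in> tensor_kernel R M' N"
    then show "c \<in> tensor_kernel R M N"
      using *[rule_format, of c 0] by simp
  next
    fix c d
    assume "\<forall>c. Poly_Mapping.keys c \<subseteq> carrier M \<times> carrier N \<longrightarrow>
       frag_map_fst g c \<in> tensor_kernel R M' N \<longrightarrow> c \<in> tensor_kernel R M N"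
      and "Poly_Mapping.keys c \<subseteq> carrier M \<times> carrier N" "Poly_Mapping.keys d \<subseteq> carrier M \<times> carrier N"
      and "frag_map_fst g (c - d) \<in> tensor_kernel R M' N"
    then show "c - d \<in> tensor_kernel R M N"
      using keys_diff[of c d] by blast
  qed
qed

lemma tensor_kernel_finite:
  assumes M: "module R M" and N: "module R N" and c: "c \<in> tensor_kernel R M N"
  shows "\<exists>B. finite B \<and> B \<subseteq> carrier M \<and>
    (\<forall>H. submodule H R M \<longrightarrow> B \<subseteq> H \<longrightarrow> c \<in> tensor_kernel R (M\<lparr>carrier := H\<rparr>) N)"
proof -
  interpret M: module R M by fact
  have T: "0 \<in> tensor_kernel R (M\<lparr>carrier := H\<rparr>) N"
    "\<And>c d. \<lbrakk>c \<in> tensor_kernel R (M\<lparr>carrier := H\<rparr>) N; d \<in> tensor_kernel R (M\<lparr>carrier := H\<rparr>) N\<rbrakk>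
       \<Longrightarrow> c + d \<in> tensor_kernel R (M\<lparr>carrier := H\<rparr>) N"
    "\<And>c. c \<in> tensor_kernel R (M\<lparr>carrier := H\<rparr>) N \<Longrightarrow> - c \<in> tensor_kernel R (M\<lparr>carrier := H\<rparr>) N"
    if "submodule H R M" for H
    using tensor_kernel_props(2-4)[OF submodule.submodule_is_module[OF that M] N] by blast+
  have rel: "\<exists>B. finite B \<and> B \<subseteq> carrier M \<and>
      (\<forall>H. submodule H R M \<longrightarrow> B \<subseteq> H \<longrightarrow> t \<in> tensor_kernel R (M\<lparr>carrier := H\<rparr>) N)"
    if "t \<in> tensor_relators R M N" for t
  proof -
    have incl: "t \<in> tensor_kernel R (M\<lparr>carrier := H\<rparr>) N"
      if "t \<in> tensor_relators R (M\<lparr>carrier := H\<rparr>) N" for H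
      unfolding tensor_kernel_def using that by (rule generate.incl)
    from that consider
      (1) x y z where "t = frag_of (x \<oplus>\<^bsub>M\<^esub> y, z) - frag_of (x, z) - frag_of (y, z)"
            "x \<in> carrier M" "y \<in> carrier M" "z \<in> carrier N"
    | (2) x y z where "t = frag_of (x, y \<oplus>\<^bsub>N\<^esub> z) - frag_of (x, y) - frag_of (x, z)"
            "x \<in> carrier M" "y \<in> carrier N" "z \<in> carrier N"
    | (3) a x y where "t = frag_of (a \<odot>\<^bsub>M\<^esub> x, y) - frag_of (x, a \<odot>\<^bsub>N\<^esub> y)"
            "a \<in> carrier R" "x \<in> carrier M" "y \<in> carrier N"
      unfolding tensor_relators_def by blast
    then show ?thesis
    proof cases
      case 1
      then have "t \<in> tensor_relators R (M\<lparr>carrier := H\<rparr>) N" if "x \<in> H" "y \<in> H" for H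
        unfolding tensor_relators_def using that by auto
      with 1 incl show ?thesis by (intro exI[of _ "{x, y}"]) auto
    next
      case 2
      then have "t \<in> tensor_relators R (M\<lparr>carrier := H\<rparr>) N" if "x \<in> H" for H
        unfolding tensor_relators_def using that by auto
      with 2 incl show ?thesis by (intro exI[of _ "{x}"]) auto
    next
      case 3
      then have "t \<in> tensor_relators R (M\<lparr>carrier := H\<rparr>) N" if "x \<in> H" for H
        unfolding tensor_relators_def using that by auto
      with 3 incl show ?thesis by (intro exI[of _ "{x}"]) auto
    qed
  qed
  show ?thesis
    using c unfolding tensor_kernel_def[of R M N]
  proof (induction rule: generate.induct)
    case one
    then show ?case using T(1) by auto
  next
    case (incl h)
    then show ?case by (rule rel)
  next
    case (inv h)
    then have "inv\<^bsub>pairs_group M N\<^esub> h = - h"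
      using subsetD[OF tensor_relators_carrier[OF M N] inv] by simp
    then show ?case using rel[OF inv] T(3) by auto
  next
    case (eng h1 h2)
    then obtain B1 B2 where
      "finite B1" "B1 \<subseteq> carrier M" "finite B2" "B2 \<subseteq> carrier M"
      "\<forall>H. submodule H R M \<longrightarrow> B1 \<subseteq> H \<longrightarrow> h1 \<in> tensor_kernel R (M\<lparr>carrier := H\<rparr>) N"
      "\<forall>H. submodule H R M \<longrightarrow> B2 \<subseteq> H \<longrightarrow> h2 \<in> tensor_kernel R (M\<lparr>carrier := H\<rparr>) N"
      by blast
    then show ?case
      using T(2) by (intro exI[of _ "B1 \<union> B2"]) auto
  qed
qed

lemma finitely_generated_lists:
  fixes R :: "('a, 'r) ring_scheme" and M :: "('a, 'm, 'z) module_scheme"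
  assumes "module R M" "finite B" "B \<subseteq> carrier M"
  shows "\<exists>H (h :: 'm \<Rightarrow> 'a list). submodule H R M \<and> B \<subseteq> H \<and> inj_on h H"
  using assms(2,3)
proof (induction B)
  case empty
  interpret module R M by fact
  have "submodule {\<zero>\<^bsub>M\<^esub>} R M"
    by (rule submoduleI) auto
  then show ?case
    by (intro exI[of _ "{\<zero>\<^bsub>M\<^esub>}"]) auto
next
  case (insert x B)
  interpret module R M by fact
  from insert obtain H and h :: "'m \<Rightarrow> 'a list" where
    H: "submodule H R M" "B \<subseteq> H" and h: "inj_on h H"
    by auto
  have x: "x \<in> carrier M" using insert by simp
  note E = submoduleE[OF H(1)]
  have Hc: "y \<in> carrier M" if "y \<in> H" for y using E(1) that by blast
  have H0: "\<zero>\<^bsub>M\<^esub> \<in> H"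
    using subgroup.one_closed[OF submodule.axioms(1)[OF H(1)]] by simp
  define H' where "H' = {a \<odot>\<^bsub>M\<^esub> x \<oplus>\<^bsub>M\<^esub> y | a y. a \<in> carrier R \<and> y \<in> H}"
  have H'I: "a \<odot>\<^bsub>M\<^esub> x \<oplus>\<^bsub>M\<^esub> y \<in> H'" if "a \<in> carrier R" "y \<in> H" for a y
    using that unfolding H'_def by blast
  have "submodule H' R M"
  proof (rule submoduleI)
    show "H' \<subseteq> carrier M"
      using x Hc unfolding H'_def by auto
    show "\<zero>\<^bsub>M\<^esub> \<in> H'"
      using H'I[OF R.zero_closed H0] x by simp
    show "\<ominus>\<^bsub>M\<^esub> u \<in> H'" if "u \<in> H'" for u
    proof -
      from that obtain a y where u: "u = a \<odot>\<^bsub>M\<^esub> x \<oplus>\<^bsub>M\<^esub> y" "a \<in> carrier R" "y \<in> H"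
        unfolding H'_def by blast
      then have "\<ominus>\<^bsub>M\<^esub> u = (\<ominus>\<^bsub>R\<^esub> a) \<odot>\<^bsub>M\<^esub> x \<oplus>\<^bsub>M\<^esub> (\<ominus>\<^bsub>M\<^esub> y)"
        using x Hc by (simp add: smult_l_minus M.minus_add)
      then show ?thesis using H'I[of "\<ominus>\<^bsub>R\<^esub> a" "\<ominus>\<^bsub>M\<^esub> y"] u E by simp
    qed
    show "u \<oplus>\<^bsub>M\<^esub> v \<in> H'" if "u \<in> H'" "v \<in> H'" for u v
    proof -
      from that obtain a y b z where u: "u = a \<odot>\<^bsub>M\<^esub> x \<oplus>\<^bsub>M\<^esub> y" "a \<in> carrier R" "y \<in> H"
        "v = b \<odot>\<^bsub>M\<^esub> x \<oplus>\<^bsub>M\<^esub> z" "b \<in> carrier R" "z \<in> H"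
        unfolding H'_def by blast
      then have "u \<oplus>\<^bsub>M\<^esub> v = (a \<oplus>\<^bsub>R\<^esub> b) \<odot>\<^bsub>M\<^esub> x \<oplus>\<^bsub>M\<^esub> (y \<oplus>\<^bsub>M\<^esub> z)"
        using x Hc by (simp add: smult_l_distr M.a_ac)
      then show ?thesis using H'I[of "a \<oplus>\<^bsub>R\<^esub> b" "y \<oplus>\<^bsub>M\<^esub> z"] u E by simp
    qed
    show "b \<odot>\<^bsub>M\<^esub> u \<in> H'" if "b \<in> carrier R" "u \<in> H'" for b u
    proof -
      from that obtain a y where u: "u = a \<odot>\<^bsub>M\<^esub> x \<oplus>\<^bsub>M\<^esub> y" "a \<in> carrier R" "y \<in> H"
        unfolding H'_def by blast
      then have "b \<odot>\<^bsub>M\<^esub> u = (b \<otimes>\<^bsub>R\<^esub> a) \<odot>\<^bsub>M\<^esub> x \<oplus>\<^bsub>M\<^esub> (b \<odot>\<^bsub>M\<^esub> y)"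
        using x Hc that by (simp add: smult_r_distr smult_assoc1)
      then show ?thesis using H'I[of "b \<otimes>\<^bsub>R\<^esub> a" "b \<odot>\<^bsub>M\<^esub> y"] u E that by simp
    qed
  qed
  moreover have "insert x B \<subseteq> H'"
  proof -
    have "x \<in> H'" using H'I[OF R.one_closed H0] x by simp
    moreover have "y \<in> H'" if "y \<in> H" for y
      using H'I[OF R.zero_closed that] x Hc[OF that] by simp
    ultimately show ?thesis using H(2) by blast
  qed
  moreover have "\<exists>h' :: 'm \<Rightarrow> 'a list. inj_on h' H'"
  proof -
    have "\<forall>u\<in>H'. \<exists>p. u = fst p \<odot>\<^bsub>M\<^esub> x \<oplus>\<^bsub>M\<^esub> snd p \<and> snd p \<in> H"
      unfolding H'_def by auto
    then obtain p where p: "\<forall>u\<in>H'. u = fst (p u) \<odot>\<^bsub>M\<^esub> x \<oplus>\<^bsub>M\<^esub> snd (p u) \<and> snd (p u) \<in> H"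
      by metis
    have "inj_on (\<lambda>u. fst (p u) # h (snd (p u))) H'"
    proof (rule inj_onI)
      fix u v
      assume uv: "u \<in> H'" "v \<in> H'" "fst (p u) # h (snd (p u)) = fst (p v) # h (snd (p v))"
      then have "fst (p u) = fst (p v)" "snd (p u) = snd (p v)"
        using p inj_onD[OF h] by auto
      then show "u = v" using p uv by metis
    qed
    then show ?thesis by blast
  qed
  ultimately show ?case by blast
qed

definition transport_module ::
  "('m \<Rightarrow> 'k) \<Rightarrow> ('a, 'm, 'z) module_scheme \<Rightarrow> ('a, 'k) module" where
  "transport_module h M =
     (let g = inv_into (carrier M) h in
      \<lparr>carrier = h ` carrier M, monoid.mult = (\<lambda>x y. undefined), one = undefined,
       ring.zero = h \<zero>\<^bsub>M\<^esub>, ring.add = (\<lambda>x y. h (g x \<oplus>\<^bsub>M\<^esub> g y)),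
       smult = (\<lambda>a x. h (a \<odot>\<^bsub>M\<^esub> g x))\<rparr>)"

lemma transport_module:
  assumes M: "module R M" and h: "inj_on h (carrier M)"
  shows "module R (transport_module h M)"
    and "linear_map R M (transport_module h M) h"
    and "linear_map R (transport_module h M) M (inv_into (carrier M) h)"
    and "carrier (transport_module h M) = h ` carrier M"
proof -
  interpret module R M by fact
  let ?N = "transport_module h M"
  have simps: "carrier ?N = h ` carrier M" "\<zero>\<^bsub>?N\<^esub> = h \<zero>\<^bsub>M\<^esub>"
    "\<And>x y. x \<in> carrier M \<Longrightarrow> y \<in> carrier M \<Longrightarrow> h x \<oplus>\<^bsub>?N\<^esub> h y = h (x \<oplus>\<^bsub>M\<^esub> y)"
    "\<And>a x. x \<in> carrier M \<Longrightarrow> a \<odot>\<^bsub>?N\<^esub> h x = h (a \<odot>\<^bsub>M\<^esub> x)"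
    using h by (auto simp: transport_module_def Let_def)
  have "abelian_group ?N"
  proof (rule abelian_groupI)
    fix x assume "x \<in> carrier ?N"
    then obtain u where "u \<in> carrier M" "x = h u" by (auto simp: simps)
    then show "\<exists>y\<in>carrier ?N. y \<oplus>\<^bsub>?N\<^esub> x = \<zero>\<^bsub>?N\<^esub>"
      by (intro bexI[of _ "h (\<ominus>\<^bsub>M\<^esub> u)"]) (auto simp: simps M.l_neg)
  qed (auto simp: simps M.a_ac)
  then show "module R ?N"
    by (intro moduleI R.is_cring) (auto simp: simps smult_l_distr smult_r_distr smult_assoc1)
  show "linear_map R M ?N h"
    by (auto simp: linear_map_def simps)
  show "linear_map R ?N M (inv_into (carrier M) h)"
    using h by (auto simp: linear_map_def simps)
  show "carrier ?N = h ` carrier M"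
    by (rule simps)
qed

lemma frag_map_fst_compose:
  fixes c :: "'m \<times> 'n \<Rightarrow>\<^sub>0 int" and h :: "'m \<Rightarrow> 'k" and g :: "'k \<Rightarrow> 'l"
  shows "frag_map_fst g (frag_map_fst h c) = frag_map_fst (g \<circ> h) c"
proof -
  have "(\<lambda>(x, y::'n). frag_of (h x, y)) = frag_of \<circ> map_prod h (\<lambda>y::'n. y)"
    and "(\<lambda>(x, y::'n). frag_of ((g \<circ> h) x, y)) = (\<lambda>(x, y). frag_of (g x, y)) \<circ> map_prod h (\<lambda>y::'n. y)"
    by auto
  then show ?thesis
    by (simp only: frag_extend_compose)
qed

lemma frag_map_fst_ident:
  assumes "Poly_Mapping.keys c \<subseteq> S \<times> T" "\<And>x. x \<in> S \<Longrightarrow> g x = x"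
  shows "frag_map_fst g c = c"
proof -
  have "frag_map_fst g c = frag_extend frag_of c"
    using assms by (intro frag_extend_eq) auto
  then show ?thesis using frag_expansion[of c] by simp
qed

lemma frag_map_fst_keys:
  assumes "Poly_Mapping.keys c \<subseteq> S \<times> T" "g ` S \<subseteq> S'"
  shows "Poly_Mapping.keys (frag_map_fst g c) \<subseteq> S' \<times> T"
  using assms keys_frag_extend[of "\<lambda>(x, y). frag_of (g x, y)" c] by (fastforce simp: case_prod_beta)

lemma restrict_scalars_module:
  assumes "cring R" "cring S" "f \<in> ring_hom R S"
  shows "module R (restrict_scalars f S)"
proof -
  interpret R: cring R by fact
  interpret S: cring S by fact
  note f = ring_hom_closed[OF assms(3)] ring_hom_mult[OF assms(3)] ring_hom_add[OF assms(3)]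
    ring_hom_one[OF assms(3)]
  have "abelian_group (restrict_scalars f S)"
  proof (rule abelian_groupI)
    fix x assume "x \<in> carrier (restrict_scalars f S)"
    then show "\<exists>y\<in>carrier (restrict_scalars f S).
        y \<oplus>\<^bsub>restrict_scalars f S\<^esub> x = \<zero>\<^bsub>restrict_scalars f S\<^esub>"
      by (auto simp: restrict_scalars_def intro!: bexI[of _ "\<ominus>\<^bsub>S\<^esub> x"] S.l_neg)
  qed (auto simp: restrict_scalars_def S.a_ac)
  then show ?thesis
    by (intro moduleI assms(1))
      (auto simp: restrict_scalars_def f S.l_distr S.r_distr S.m_assoc)
qed

theorem pure_hom_inj:
  fixes R :: "('a, 'r) ring_scheme" and S :: "('b, 's) ring_scheme"
    and M :: "('a, 'm, 'z) module_scheme"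
  assumes pure: "pure_hom R S f" and M: "module R M"
  shows "inj_on (\<lambda>x. tensor R M (restrict_scalars f S) x \<one>\<^bsub>S\<^esub>) (carrier M)"
proof (rule inj_onI)
  let ?N = "restrict_scalars f S"
  have N: "module R ?N"
    using pure by (intro restrict_scalars_module) (auto simp: pure_hom_def)
  fix x y
  assume xy: "x \<in> carrier M" "y \<in> carrier M" and "tensor R M ?N x \<one>\<^bsub>S\<^esub> = tensor R M ?N y \<one>\<^bsub>S\<^esub>"
  then have "frag_of (x, \<one>\<^bsub>S\<^esub>) - frag_of (y, \<one>\<^bsub>S\<^esub>) \<in> tensor_kernel R M ?N" (is "?c \<in> _")
    by (simp add: tensor_def tensor_coset_eq_iff[OF M N])
  from tensor_kernel_finite[OF M N this] obtain B where B: "finite B" "B \<subseteq> carrier M"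
    "\<And>H. submodule H R M \<Longrightarrow> B \<subseteq> H \<Longrightarrow> ?c \<in> tensor_kernel R (M\<lparr>carrier := H\<rparr>) ?N"
    by blast
  from finitely_generated_lists[OF M, of "B \<union> {x, y}"] B xy
  obtain H and h :: "'m \<Rightarrow> 'a list" where H: "submodule H R M" "B \<union> {x, y} \<subseteq> H" "inj_on h H"
    by auto
  let ?H = "M\<lparr>carrier := H\<rparr>"
  have modH: "module R ?H"
    by (rule submodule.submodule_is_module[OF H(1) M])
  have h: "inj_on h (carrier ?H)" using H by simp
  note tr = transport_module[OF modH h]
  have "frag_map_fst h ?c \<in> tensor_kernel R (transport_module h ?H) ?N"
    using tensor_kernel_functorial[OF modH tr(1) N tr(2)] B(3) H by blast
  then have "tensor R (transport_module h ?H) ?N (h x) \<one>\<^bsub>S\<^esub> = tensor R (transport_module h ?H) ?N (h y) \<one>\<^bsub>S\<^esub>"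
    by (simp add: tensor_def tensor_coset_eq_iff[OF tr(1) N] frag_extend_diff)
  moreover have "inj_on (\<lambda>x. tensor R (transport_module h ?H) ?N x \<one>\<^bsub>S\<^esub>) (carrier (transport_module h ?H))"
    using pure tr(1) by (auto simp: pure_hom_def)
  moreover have "h x \<in> carrier (transport_module h ?H)" "h y \<in> carrier (transport_module h ?H)"
    using H by (auto simp: tr(4))
  ultimately have "h x = h y"
    by (auto dest: inj_onD)
  then show "x = y"
    using H by (auto dest: inj_onD)
qed

theorem flat_module_inj:
  fixes R :: "('a, 'r) ring_scheme" and N :: "('a, 'n, 'w) module_scheme"
    and M :: "('a, 'm, 'y) module_scheme" and M' :: "('a, 'k, 'z) module_scheme"
  assumes flat: "flat_module R N" and M: "module R M" and M': "module R M'"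
    and g: "linear_map R M M' g" and inj: "inj_on g (carrier M)"
  shows "inj_on (tensor_map R M M' N g) (carrier (tensor_product R M N))"
proof -
  have N: "module R N"
    using flat by (simp add: flat_module_def)
  interpret M: module R M by fact
  interpret M': module R M' by fact
  have "c \<in> tensor_kernel R M N"
    if c: "Poly_Mapping.keys c \<subseteq> carrier M \<times> carrier N" and gc: "frag_map_fst g c \<in> tensor_kernel R M' N" for c
  proof -
    from tensor_kernel_finite[OF M' N gc] obtain B where B: "finite B" "B \<subseteq> carrier M'"
      "\<And>H. submodule H R M' \<Longrightarrow> B \<subseteq> H \<Longrightarrow> frag_map_fst g c \<in> tensor_kernel R (M'\<lparr>carrier := H\<rparr>) N"
      by blast
    let ?C = "g ` fst ` Poly_Mapping.keys c"
    have "?C \<subseteq> carrier M'"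
      using c g by (fastforce simp: linear_map_def)
    with finitely_generated_lists[OF M', of "B \<union> ?C"] B
    obtain H' and h :: "'k \<Rightarrow> 'a list" where H': "submodule H' R M'" "B \<union> ?C \<subseteq> H'" "inj_on h H'"
      by auto
    let ?H' = "M'\<lparr>carrier := H'\<rparr>"
    define H where "H = {x \<in> carrier M. g x \<in> H'}"
    let ?H = "M\<lparr>carrier := H\<rparr>"
    have g_add: "g (x \<oplus>\<^bsub>M\<^esub> y) = g x \<oplus>\<^bsub>M'\<^esub> g y" if "x \<in> carrier M" "y \<in> carrier M" for x y
      using g that by (simp add: linear_map_def)
    have g_smult: "g (a \<odot>\<^bsub>M\<^esub> x) = a \<odot>\<^bsub>M'\<^esub> g x" if "a \<in> carrier R" "x \<in> carrier M" for a x
      using g that by (simp add: linear_map_def)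
    have g_car: "g x \<in> carrier M'" if "x \<in> carrier M" for x
      using g that by (auto simp: linear_map_def)
    have g_zero: "g \<zero>\<^bsub>M\<^esub> = \<zero>\<^bsub>M'\<^esub>"
      using g_smult[of "\<zero>\<^bsub>R\<^esub>" "\<zero>\<^bsub>M\<^esub>"] g_car by simp
    have minus: "\<ominus>\<^bsub>M\<^esub> x = (\<ominus>\<^bsub>R\<^esub> \<one>\<^bsub>R\<^esub>) \<odot>\<^bsub>M\<^esub> x" if "x \<in> carrier M" for x
      using that by (simp add: M.smult_l_minus)
    have H'0: "\<zero>\<^bsub>M'\<^esub> \<in> H'"
      using subgroup.one_closed[OF submodule.axioms(1)[OF H'(1)]] by simp
    have subH: "submodule H R M"
      by (rule M.submoduleI)
        (use M'.submoduleE[OF H'(1)] H'0 in \<open>auto simp: H_def g_add g_smult g_zero minus\<close>)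
    have modH: "module R ?H"
      by (rule submodule.submodule_is_module[OF subH M])
    have modH': "module R ?H'"
      by (rule submodule.submodule_is_module[OF H'(1) M'])
    have h: "inj_on h (carrier ?H')" using H'(3) by simp
    have hg: "inj_on (h \<circ> g) (carrier ?H)"
      using H'(3) inj by (auto simp: H_def inj_on_def)
    note t = transport_module[OF modH hg] and t' = transport_module[OF modH' h]
    let ?T = "transport_module (h \<circ> g) ?H" and ?T' = "transport_module h ?H'"
    let ?d = "frag_map_fst (h \<circ> g) c"
    have lin: "linear_map R ?T ?T' (\<lambda>x. x)"
    proof -
      have "x \<oplus>\<^bsub>?T\<^esub> y = x \<oplus>\<^bsub>?T'\<^esub> y" if "x \<in> carrier ?T" "y \<in> carrier ?T" for x y
      proof -
        from that obtain u v where "u \<in> H" "v \<in> H" "x = h (g u)" "y = h (g v)"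
          by (auto simp: t(4))
        then show ?thesis
          using t(2) t'(2) by (simp add: linear_map_def H_def g_add)
      qed
      moreover have "a \<odot>\<^bsub>?T\<^esub> x = a \<odot>\<^bsub>?T'\<^esub> x" if "a \<in> carrier R" "x \<in> carrier ?T" for a x
      proof -
        from that obtain u where "u \<in> H" "x = h (g u)"
          by (auto simp: t(4))
        then show ?thesis
          using t(2) t'(2) that by (simp add: linear_map_def H_def g_smult)
      qed
      ultimately show ?thesis
        unfolding linear_map_def by (simp add: t(4) t'(4)) (auto simp: H_def)
    qed
    have cH: "Poly_Mapping.keys c \<subseteq> carrier ?H \<times> carrier N"
      using c H'(2) by (force simp: H_def)
    have d: "Poly_Mapping.keys ?d \<subseteq> carrier ?T \<times> carrier N"
      by (rule frag_map_fst_keys[OF cH]) (simp add: t(4))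
    have "frag_map_fst h (frag_map_fst g c) \<in> tensor_kernel R ?T' N"
      using tensor_kernel_functorial[OF modH' t'(1) N t'(2) B(3)[OF H'(1)]] H'(2) by simp
    then have "frag_map_fst (\<lambda>x. x) ?d \<in> tensor_kernel R ?T' N"
      by (simp add: frag_map_fst_compose frag_map_fst_ident[OF d])
    moreover have "inj_on (tensor_map R ?T ?T' N (\<lambda>x. x)) (carrier (tensor_product R ?T N))"
      using flat lin t(1) t'(1) by (auto simp: flat_module_def)
    ultimately have "?d \<in> tensor_kernel R ?T N"
      using d by (simp add: tensor_map_inj_iff[OF t(1) t'(1) N lin])
    from tensor_kernel_functorial[OF t(1) modH N t(3) this]
    have "frag_map_fst (inv_into H (h \<circ> g) \<circ> (h \<circ> g)) c \<in> tensor_kernel R ?H N"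
      by (simp add: frag_map_fst_compose)
    moreover have "frag_map_fst (inv_into H (h \<circ> g) \<circ> (h \<circ> g)) c = c"
      by (rule frag_map_fst_ident[OF cH]) (use hg inv_into_f_f[of "h \<circ> g" H] in auto)
    ultimately have cK: "c \<in> tensor_kernel R ?H N"
      by simp
    have "linear_map R ?H M (\<lambda>x. x)"
      by (auto simp: linear_map_def H_def)
    from tensor_kernel_functorial[OF modH M N this cK]
    show "c \<in> tensor_kernel R M N"
      by (simp add: frag_map_fst_ident[OF c])
  qed
  then show ?thesis
    by (simp add: tensor_map_inj_iff[OF M M' N g])
qed


section \<open>The direct limit is a commutative ring\<close>

context ring_direct_system
begin

lemma index_mem: "(i, j) \<in> r \<Longrightarrow> i \<in> \<Gamma> \<and> j \<in> \<Gamma>"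
  and index_refl: "i \<in> \<Gamma> \<Longrightarrow> (i, i) \<in> r"
  and index_trans: "(i, j) \<in> r \<Longrightarrow> (j, k) \<in> r \<Longrightarrow> (i, k) \<in> r"
proof -
  have "r \<subseteq> \<Gamma> \<times> \<Gamma>" "refl_on \<Gamma> r" "trans r"
    using preorder by (auto simp: preorder_on_def)
  then show "(i, j) \<in> r \<Longrightarrow> i \<in> \<Gamma> \<and> j \<in> \<Gamma>" "i \<in> \<Gamma> \<Longrightarrow> (i, i) \<in> r"
    "(i, j) \<in> r \<Longrightarrow> (j, k) \<in> r \<Longrightarrow> (i, k) \<in> r"
    by (blast, blast dest: refl_onD, blast dest: transD)
qed

lemma trans_closed: "(i, j) \<in> r \<Longrightarrow> x \<in> carrier (A i) \<Longrightarrow> f i j x \<in> carrier (A j)"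
  using homs ring_hom_closed by metis

lemma equiv_eventually_equal:
  "equiv (SIGMA i:\<Gamma>. carrier (A i)) (eventually_equal \<Gamma> r A f)"
proof (rule equivI)
  show "eventually_equal \<Gamma> r A f \<subseteq> (SIGMA i:\<Gamma>. carrier (A i)) \<times> (SIGMA i:\<Gamma>. carrier (A i))"
    by (auto simp: eventually_equal_def)
  show "refl_on (SIGMA i:\<Gamma>. carrier (A i)) (eventually_equal \<Gamma> r A f)"
    using index_refl by (auto simp: eventually_equal_def refl_on_def)
  show "sym (eventually_equal \<Gamma> r A f)"
    by (rule symI) (force simp: eventually_equal_def)
  show "trans (eventually_equal \<Gamma> r A f)"
  proof (rule transI)
    fix p q s
    assume "(p, q) \<in> eventually_equal \<Gamma> r A f" "(q, s) \<in> eventually_equal \<Gamma> r A f"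
    then obtain i x j y l z k k' where *: "p = (i, x)" "q = (j, y)" "s = (l, z)"
      "i \<in> \<Gamma>" "j \<in> \<Gamma>" "l \<in> \<Gamma>" "x \<in> carrier (A i)" "y \<in> carrier (A j)" "z \<in> carrier (A l)"
      "k \<in> \<Gamma>" "(i, k) \<in> r" "(j, k) \<in> r" "f i k x = f j k y"
      "k' \<in> \<Gamma>" "(j, k') \<in> r" "(l, k') \<in> r" "f j k' y = f l k' z"
      by (auto simp: eventually_equal_def)
    obtain n where n: "n \<in> \<Gamma>" "(k, n) \<in> r" "(k', n) \<in> r"
      using directed[OF \<open>k \<in> \<Gamma>\<close> \<open>k' \<in> \<Gamma>\<close>] by auto
    have "f i n x = f k n (f i k x)" "f j n y = f k n (f j k y)"
      "f j n y = f k' n (f j k' y)" "f l n z = f k' n (f l k' z)"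
      using trans_comp *(7,8,9,11,12,15,16) n by presburger+
    then have "f i n x = f l n z"
      using * by simp
    moreover have "(i, n) \<in> r" "(l, n) \<in> r"
      using index_trans * n by blast+
    ultimately show "(p, s) \<in> eventually_equal \<Gamma> r A f"
      using * n by (auto simp: eventually_equal_def)
  qed
qed

abbreviation "cls \<equiv> limit_class \<Gamma> r A f"

lemma limit_class_eq_iff:
  assumes "i \<in> \<Gamma>" "j \<in> \<Gamma>" "x \<in> carrier (A i)" "y \<in> carrier (A j)"
  shows "cls i x = cls j y \<longleftrightarrow> (\<exists>k\<in>\<Gamma>. (i, k) \<in> r \<and> (j, k) \<in> r \<and> f i k x = f j k y)"
proof -
  have "cls i x = cls j y \<longleftrightarrow> ((i, x), (j, y)) \<in> eventually_equal \<Gamma> r A f"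
    unfolding limit_class_def
    by (rule eq_equiv_class_iff[OF equiv_eventually_equal]) (use assms in auto)
  then show ?thesis
    using assms by (simp add: eventually_equal_def)
qed

lemma limit_class_trans:
  assumes "(i, j) \<in> r" "x \<in> carrier (A i)"
  shows "cls j (f i j x) = cls i x"
  using assms index_mem[OF assms(1)] trans_closed trans_id index_refl
  by (subst limit_class_eq_iff) (auto intro!: bexI[of _ j])

lemma direct_limit_carrier:
  "carrier (direct_limit \<Gamma> r A f) = {cls i x | i x. i \<in> \<Gamma> \<and> x \<in> carrier (A i)}"
  by (auto simp: direct_limit_def quotient_def limit_class_def)

lemma limit_class_mem:
  "p \<in> cls i x \<longleftrightarrow> (\<exists>j y. p = (j, y) \<and> ((i, x), (j, y)) \<in> eventually_equal \<Gamma> r A f)"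
  by (cases p) (auto simp: limit_class_def)

lemma limit_op_eq:
  assumes hom: "\<And>i j x y. (i, j) \<in> r \<Longrightarrow> x \<in> carrier (A i) \<Longrightarrow> y \<in> carrier (A i) \<Longrightarrow>
      f i j (opr i x y) = opr j (f i j x) (f i j y)"
    and closed: "\<And>i x y. i \<in> \<Gamma> \<Longrightarrow> x \<in> carrier (A i) \<Longrightarrow> y \<in> carrier (A i) \<Longrightarrow> opr i x y \<in> carrier (A i)"
    and i: "i \<in> \<Gamma>" and x: "x \<in> carrier (A i)" and y: "y \<in> carrier (A i)"
  shows "limit_op \<Gamma> r A f opr (cls i x) (cls i y) = cls i (opr i x y)"
proof -
  have same: "cls k (opr k (f j k u) (f l k v)) = cls i (opr i x y)"
    if *: "(j, u) \<in> cls i x" "(l, v) \<in> cls i y" "(j, k) \<in> r" "(l, k) \<in> r" for j u l v k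
  proof -
    from * have mem: "j \<in> \<Gamma>" "l \<in> \<Gamma>" "k \<in> \<Gamma>" "u \<in> carrier (A j)" "v \<in> carrier (A l)"
      using index_mem by (auto simp: limit_class_mem eventually_equal_def)
    from * obtain a where a: "(i, a) \<in> r" "(j, a) \<in> r" "f i a x = f j a u"
      by (auto simp: limit_class_mem eventually_equal_def)
    from * obtain b where b: "(i, b) \<in> r" "(l, b) \<in> r" "f i b y = f l b v"
      by (auto simp: limit_class_mem eventually_equal_def)
    obtain c where c: "(a, c) \<in> r" "(b, c) \<in> r"
      using directed a b index_mem by meson
    then obtain n where n: "(c, n) \<in> r" "(k, n) \<in> r"
      using directed mem(3) index_mem by meson
    have an: "(a, n) \<in> r" and bn: "(b, n) \<in> r"
      using index_trans c n by blast+
    have r_in: "(i, n) \<in> r"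
      using index_trans a(1) an by blast
    have 1: "f i n x = f k n (f j k u)"
      using trans_comp[OF a(1) an x] trans_comp[OF a(2) an mem(4)] trans_comp[OF *(3) n(2) mem(4)] a(3)
      by simp
    have 2: "f i n y = f k n (f l k v)"
      using trans_comp[OF b(1) bn y] trans_comp[OF b(2) bn mem(5)] trans_comp[OF *(4) n(2) mem(5)] b(3)
      by simp
    have "cls k (opr k (f j k u) (f l k v)) = cls n (f k n (opr k (f j k u) (f l k v)))"
      using limit_class_trans n closed mem * trans_closed by metis
    also have "f k n (opr k (f j k u) (f l k v)) = f i n (opr i x y)"
      using hom[OF n(2)] hom[OF r_in x y] trans_closed * mem 1 2 by simp
    also have "cls n \<dots> = cls i (opr i x y)"
      using limit_class_trans[OF r_in] closed i x y by simp
    finally show ?thesis .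
  qed
  have self: "(i, x) \<in> cls i x" "(i, y) \<in> cls i y"
    using i x y index_refl by (auto simp: limit_class_mem eventually_equal_def)
  show ?thesis
  proof
    show "limit_op \<Gamma> r A f opr (cls i x) (cls i y) \<subseteq> cls i (opr i x y)"
      using same unfolding limit_op_def by blast
    have "cls i (opr i x y) = cls i (opr i (f i i x) (f i i y))"
      using i x y trans_id by simp
    then show "cls i (opr i x y) \<subseteq> limit_op \<Gamma> r A f opr (cls i x) (cls i y)"
      using self i index_refl unfolding limit_op_def by blast
  qed
qed

lemma direct_limit_ops:
  assumes i: "i \<in> \<Gamma>" and x: "x \<in> carrier (A i)" and y: "y \<in> carrier (A i)"
  shows "cls i x \<otimes>\<^bsub>direct_limit \<Gamma> r A f\<^esub> cls i y = cls i (x \<otimes>\<^bsub>A i\<^esub> y)"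
    and "cls i x \<oplus>\<^bsub>direct_limit \<Gamma> r A f\<^esub> cls i y = cls i (x \<oplus>\<^bsub>A i\<^esub> y)"
proof -
  show "cls i x \<otimes>\<^bsub>direct_limit \<Gamma> r A f\<^esub> cls i y = cls i (x \<otimes>\<^bsub>A i\<^esub> y)"
    unfolding direct_limit_def using assms
    by (simp, intro limit_op_eq)
      (auto simp: ring_hom_mult[OF homs] intro: monoid.m_closed[OF ring.is_monoid[OF cring.axioms(1)[OF rings]]])
  show "cls i x \<oplus>\<^bsub>direct_limit \<Gamma> r A f\<^esub> cls i y = cls i (x \<oplus>\<^bsub>A i\<^esub> y)"
    unfolding direct_limit_def using assms
    by (simp, intro limit_op_eq)
      (auto simp: ring_hom_add[OF homs] intro: ring.ring_simprules(1)[OF cring.axioms(1)[OF rings]])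
qed

lemma direct_limit_one_zero:
  assumes "i \<in> \<Gamma>"
  shows "\<one>\<^bsub>direct_limit \<Gamma> r A f\<^esub> = cls i \<one>\<^bsub>A i\<^esub>"
    and "\<zero>\<^bsub>direct_limit \<Gamma> r A f\<^esub> = cls i \<zero>\<^bsub>A i\<^esub>"
proof -
  have "cls j \<one>\<^bsub>A j\<^esub> = cls i \<one>\<^bsub>A i\<^esub> \<and> cls j \<zero>\<^bsub>A j\<^esub> = cls i \<zero>\<^bsub>A i\<^esub>" if j: "j \<in> \<Gamma>" for j
  proof -
    interpret Ai: cring "A i" using assms by (rule rings)
    interpret Aj: cring "A j" using j by (rule rings)
    obtain k where k: "(i, k) \<in> r" "(j, k) \<in> r" "k \<in> \<Gamma>"
      using directed[OF assms j] by auto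
    interpret Ak: cring "A k" using k(3) by (rule rings)
    have ones: "f i k \<one>\<^bsub>A i\<^esub> = \<one>\<^bsub>A k\<^esub>" "f j k \<one>\<^bsub>A j\<^esub> = \<one>\<^bsub>A k\<^esub>"
      by (rule ring_hom_one[OF homs[OF k(1)]], rule ring_hom_one[OF homs[OF k(2)]])
    have zeros: "f i k \<zero>\<^bsub>A i\<^esub> = \<zero>\<^bsub>A k\<^esub>" "f j k \<zero>\<^bsub>A j\<^esub> = \<zero>\<^bsub>A k\<^esub>"
      by (rule ring_hom_zero[OF homs[OF k(1)] Ai.ring_axioms Ak.ring_axioms],
          rule ring_hom_zero[OF homs[OF k(2)] Aj.ring_axioms Ak.ring_axioms])
    show ?thesis
      using limit_class_trans[OF k(1) Ai.one_closed] limit_class_trans[OF k(2) Aj.one_closed]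
        limit_class_trans[OF k(1) Ai.zero_closed] limit_class_trans[OF k(2) Aj.zero_closed]
      by (simp add: ones zeros)
  qed
  then have "(\<Union>j\<in>\<Gamma>. cls j \<one>\<^bsub>A j\<^esub>) = cls i \<one>\<^bsub>A i\<^esub>" "(\<Union>j\<in>\<Gamma>. cls j \<zero>\<^bsub>A j\<^esub>) = cls i \<zero>\<^bsub>A i\<^esub>"
    using assms by blast+
  then show "\<one>\<^bsub>direct_limit \<Gamma> r A f\<^esub> = cls i \<one>\<^bsub>A i\<^esub>" "\<zero>\<^bsub>direct_limit \<Gamma> r A f\<^esub> = cls i \<zero>\<^bsub>A i\<^esub>"
    by (simp_all add: direct_limit_def)
qed

lemma limit_class_hom:
  assumes "i \<in> \<Gamma>"
  shows "cls i \<in> ring_hom (A i) (direct_limit \<Gamma> r A f)"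
  using assms by (intro ring_hom_memI)
    (auto simp: direct_limit_ops direct_limit_one_zero[OF assms] direct_limit_carrier)

lemma direct_limit_common:
  assumes "U \<in> carrier (direct_limit \<Gamma> r A f)" "V \<in> carrier (direct_limit \<Gamma> r A f)"
    "W \<in> carrier (direct_limit \<Gamma> r A f)"
  obtains i x y z where "i \<in> \<Gamma>" "x \<in> carrier (A i)" "y \<in> carrier (A i)" "z \<in> carrier (A i)"
    "U = cls i x" "V = cls i y" "W = cls i z"
proof -
  from assms obtain i x j y k z where *: "i \<in> \<Gamma>" "x \<in> carrier (A i)" "U = cls i x"
    "j \<in> \<Gamma>" "y \<in> carrier (A j)" "V = cls j y" "k \<in> \<Gamma>" "z \<in> carrier (A k)" "W = cls k z"
    by (auto simp: direct_limit_carrier)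
  obtain n where n: "(i, n) \<in> r" "(j, n) \<in> r"
    using directed * by meson
  then obtain l where l: "(n, l) \<in> r" "(k, l) \<in> r"
    using directed * index_mem by meson
  then have "(i, l) \<in> r" "(j, l) \<in> r"
    using n index_trans by blast+
  with l * show ?thesis
    by (intro that[of l "f i l x" "f j l y" "f k l z"])
      (auto simp: limit_class_trans trans_closed dest: index_mem)
qed

theorem direct_limit_cring: "cring (direct_limit \<Gamma> r A f)"
proof -
  let ?L = "direct_limit \<Gamma> r A f"
  obtain i0 where i0: "i0 \<in> \<Gamma>" using nonempty by blast
  interpret A0: cring "A i0" using i0 by (rule rings)
  have closed: "cls i x \<in> carrier ?L" if "i \<in> \<Gamma>" "x \<in> carrier (A i)" for i x
    using that by (auto simp: direct_limit_carrier)
  have units: "\<one>\<^bsub>?L\<^esub> \<in> carrier ?L" "\<zero>\<^bsub>?L\<^esub> \<in> carrier ?L"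
    using i0 by (simp_all add: direct_limit_one_zero[OF i0] closed)
  have ax: "U \<oplus>\<^bsub>?L\<^esub> V \<in> carrier ?L" "U \<otimes>\<^bsub>?L\<^esub> V \<in> carrier ?L"
      "(U \<oplus>\<^bsub>?L\<^esub> V) \<oplus>\<^bsub>?L\<^esub> W = U \<oplus>\<^bsub>?L\<^esub> (V \<oplus>\<^bsub>?L\<^esub> W)"
      "(U \<otimes>\<^bsub>?L\<^esub> V) \<otimes>\<^bsub>?L\<^esub> W = U \<otimes>\<^bsub>?L\<^esub> (V \<otimes>\<^bsub>?L\<^esub> W)"
      "(U \<oplus>\<^bsub>?L\<^esub> V) \<otimes>\<^bsub>?L\<^esub> W = U \<otimes>\<^bsub>?L\<^esub> W \<oplus>\<^bsub>?L\<^esub> V \<otimes>\<^bsub>?L\<^esub> W"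
      "U \<oplus>\<^bsub>?L\<^esub> V = V \<oplus>\<^bsub>?L\<^esub> U" "U \<otimes>\<^bsub>?L\<^esub> V = V \<otimes>\<^bsub>?L\<^esub> U"
      "\<zero>\<^bsub>?L\<^esub> \<oplus>\<^bsub>?L\<^esub> U = U" "\<one>\<^bsub>?L\<^esub> \<otimes>\<^bsub>?L\<^esub> U = U"
      "\<exists>V'\<in>carrier ?L. V' \<oplus>\<^bsub>?L\<^esub> U = \<zero>\<^bsub>?L\<^esub>"
    if mem: "U \<in> carrier ?L" "V \<in> carrier ?L" "W \<in> carrier ?L" for U V W
  proof -
    obtain i x y z where *: "i \<in> \<Gamma>" "x \<in> carrier (A i)" "y \<in> carrier (A i)" "z \<in> carrier (A i)"
      "U = cls i x" "V = cls i y" "W = cls i z"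
      by (rule direct_limit_common[OF mem])
    interpret Ai: cring "A i" using *(1) by (rule rings)
    note s = * direct_limit_ops direct_limit_one_zero[OF *(1)] closed
    show "U \<oplus>\<^bsub>?L\<^esub> V \<in> carrier ?L" "U \<otimes>\<^bsub>?L\<^esub> V \<in> carrier ?L"
      by (simp_all add: s)
    show "(U \<oplus>\<^bsub>?L\<^esub> V) \<oplus>\<^bsub>?L\<^esub> W = U \<oplus>\<^bsub>?L\<^esub> (V \<oplus>\<^bsub>?L\<^esub> W)"
      by (simp add: s Ai.a_assoc)
    show "(U \<otimes>\<^bsub>?L\<^esub> V) \<otimes>\<^bsub>?L\<^esub> W = U \<otimes>\<^bsub>?L\<^esub> (V \<otimes>\<^bsub>?L\<^esub> W)"
      by (simp add: s Ai.m_assoc)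
    show "(U \<oplus>\<^bsub>?L\<^esub> V) \<otimes>\<^bsub>?L\<^esub> W = U \<otimes>\<^bsub>?L\<^esub> W \<oplus>\<^bsub>?L\<^esub> V \<otimes>\<^bsub>?L\<^esub> W"
      by (simp add: s Ai.l_distr)
    show "U \<oplus>\<^bsub>?L\<^esub> V = V \<oplus>\<^bsub>?L\<^esub> U"
      using Ai.a_comm[OF *(2,3)] by (simp add: s)
    show "U \<otimes>\<^bsub>?L\<^esub> V = V \<otimes>\<^bsub>?L\<^esub> U"
      using Ai.m_comm[OF *(2,3)] by (simp add: s)
    show "\<zero>\<^bsub>?L\<^esub> \<oplus>\<^bsub>?L\<^esub> U = U" "\<one>\<^bsub>?L\<^esub> \<otimes>\<^bsub>?L\<^esub> U = U"
      by (simp_all add: s)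
    show "\<exists>V'\<in>carrier ?L. V' \<oplus>\<^bsub>?L\<^esub> U = \<zero>\<^bsub>?L\<^esub>"
      by (rule bexI[of _ "cls i (\<ominus>\<^bsub>A i\<^esub> x)"]) (simp_all add: s Ai.l_neg)
  qed
  show ?thesis
  proof (rule cringI)
    show "abelian_group ?L"
      by (rule abelian_groupI; (rule units ax(1,3,6,8,10); assumption?); assumption?)
    show "Group.comm_monoid ?L"
      by (rule comm_monoidI; (rule units ax(2,4,7,9); assumption?); assumption?)
  qed (rule ax(5))
qed

end

end

theory Submission
  imports Defs
begin

text \<open>
  Let \<open>A = lim A\<^sub>i\<close>. The maximal ideals \<open>m\<^sub>i\<close> generate an ideal of \<open>A\<close>, which is finitely generated because
  \<open>A\<close> is Noetherian; its generators live at some index \<open>l\<close>, so every \<open>m\<^sub>j\<close> with \<open>j \<ge> l\<close> lies in the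
  extension of \<open>m\<^sub>l\<close> to \<open>A\<close>. Purity makes extended ideals contract back to themselves
  (\<open>pure_hom_contraction\<close>), hence \<open>m\<^sub>l A\<^sub>j = m\<^sub>j\<close> already in \<open>A\<^sub>j\<close>
  (\<open>maximal_ideals_eventually_extended\<close>). From \<open>l\<close> on, images of generators of \<open>m\<^sub>i\<close> generate \<open>m\<^sub>j\<close>,
  so by regularity \<open>dim A\<^sub>i\<close> is a nonincreasing function of \<open>i\<close>; moving \<open>l\<close> up to where it is smallest makes it constant.
  Then a minimal system of generators \<open>x\<^sub>1, \<dots>, x\<^sub>d\<close> of \<open>m\<^sub>i\<close> maps to a generating system of \<open>m\<^sub>j\<close> that has
  \<open>dim A\<^sub>j\<close> elements, and the theorem becomes a statement about one homomorphism \<open>R \<rightarrow> S\<close>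
  (\<open>flat_of_regular_parameters\<close>).
  
  A system of \<open>dim S\<close> generators of the maximal ideal of the Noetherian local ring \<open>S\<close> is a regular sequence
  whose initial segments generate prime ideals (\<open>regular_system_of_parameters\<close>). The reason is Krull's principal
  ideal theorem, used in the following form: in a chain of primes whose top contains \<open>y\<close>, all members but the
  lowest can be replaced so that they contain \<open>y\<close>, at no loss of length (\<open>prime_between\<close>, \<open>prime_chain_through\<close>).
  Dividing by one generator therefore lowers the dimension by at most one, and induction on the number of generators applies
  (\<open>prime_chain_bound\<close>).
  
  Flatness of \<open>S\<close> over \<open>R\<close> is the vanishing of \<open>Tor\<^sub>1(R/I, S)\<close> for all ideals \<open>I\<close>, that is, injectivity of
  \<open>I \<otimes> S \<rightarrow> S\<close> (\<open>flat_module_ideal_criterion\<close>). Along the ideals \<open>(x\<^sub>1, \<dots>, x\<^sub>k)\<close> it follows from the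
  regular sequence in \<open>S\<close>; this reaches the maximal ideal of \<open>R\<close>. For the other ideals it follows by Noetherian
  induction from above. If \<open>I\<close> is not prime, say \<open>a b \<in> I\<close> with \<open>a, b \<notin> I\<close>, then \<open>R/I\<close> is an extension of
  \<open>R/(I + a)\<close> by \<open>R/(I : a)\<close>, and both ideals are larger. If \<open>I\<close> is a prime below the maximal ideal, an element \<open>x\<close>
  of the maximal ideal outside \<open>I\<close> is a nonzerodivisor on \<open>R/I\<close>, and vanishing for \<open>I + (x)\<close> makes multiplication by \<open>x\<close> surjective on
  \<open>Tor\<^sub>1(R/I, S)\<close>, a finitely generated \<open>S\<close>-module, which is then \<open>0\<close> by Nakayama's lemma
  (\<open>tor_vanishes_prime_step\<close>).
  
  Localizations do not occur: an ideal of \<open>R\<^sub>P\<close> is represented by its preimage in \<open>R\<close> (\<open>saturate\<close>). Nor do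
  derived functors: \<open>M \<otimes> N\<close> is presented by formal sums of pairs modulo \<open>tensor_kernel\<close>, and the vanishing of \<open>Tor\<^sub>1\<close> is
  the comparison of the kernels for \<open>I\<close> and for \<open>R\<close> (\<open>tor_vanishes\<close>).
\<close>


section \<open>Ideals of commutative rings\<close>

locale noetherian_cring = cring R + noetherian_ring R for R (structure)

context cring
begin

lemma ideal_iff:
  "ideal I R \<longleftrightarrow> I \<subseteq> carrier R \<and> \<zero> \<in> I \<and> (\<forall>a\<in>I. \<forall>b\<in>I. a \<oplus> b \<in> I) \<and>
     (\<forall>a\<in>I. \<forall>r\<in>carrier R. r \<otimes> a \<in> I)" (is "_ \<longleftrightarrow> ?R")
proof
  assume "ideal I R"
  then interpret ideal I R .
  show ?R
    using a_subset I_l_closed by auto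
next
  assume R: ?R
  have neg: "\<ominus> a \<in> I" if "a \<in> I" for a
  proof -
    have "\<ominus> a = (\<ominus> \<one>) \<otimes> a"
      using that R by (auto simp: l_minus)
    then show ?thesis
      using that R by auto
  qed
  show "ideal I R"
  proof (rule idealI[OF ring_axioms])
    show "subgroup I (add_monoid R)"
      using R neg by (intro add.subgroupI) (auto simp: a_inv_def)
    show "x \<otimes> a \<in> I" "a \<otimes> x \<in> I" if "a \<in> I" "x \<in> carrier R" for a x
      using that R m_comm[of x a] by (auto simp: subset_iff dest!: sym[of "x \<otimes> a"])
  qed
qed

lemma idealD:
  assumes "ideal I R"
  shows "a \<in> I \<Longrightarrow> a \<in> carrier R" "\<zero> \<in> I" "a \<in> I \<Longrightarrow> b \<in> I \<Longrightarrow> a \<oplus> b \<in> I"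
    "a \<in> I \<Longrightarrow> r \<in> carrier R \<Longrightarrow> r \<otimes> a \<in> I" "a \<in> I \<Longrightarrow> r \<in> carrier R \<Longrightarrow> a \<otimes> r \<in> I"
    "a \<in> I \<Longrightarrow> \<ominus> a \<in> I" "a \<in> I \<Longrightarrow> b \<in> I \<Longrightarrow> a \<ominus> b \<in> I"
proof -
  interpret ideal I R by fact
  show "a \<in> I \<Longrightarrow> a \<in> carrier R" "\<zero> \<in> I" "a \<in> I \<Longrightarrow> b \<in> I \<Longrightarrow> a \<oplus> b \<in> I"
    "a \<in> I \<Longrightarrow> r \<in> carrier R \<Longrightarrow> r \<otimes> a \<in> I" "a \<in> I \<Longrightarrow> r \<in> carrier R \<Longrightarrow> a \<otimes> r \<in> I"
    "a \<in> I \<Longrightarrow> \<ominus> a \<in> I" "a \<in> I \<Longrightarrow> b \<in> I \<Longrightarrow> a \<ominus> b \<in> I"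
    using I_l_closed I_r_closed by (auto simp: minus_eq)
qed

lemma ideal_cancel:
  assumes "ideal I R" "a \<in> I" "b \<in> carrier R" "a \<oplus> b \<in> I"
  shows "b \<in> I"
proof -
  have "b = (a \<oplus> b) \<ominus> a"
    using assms idealD(1)[OF assms(1,2)] by algebra
  then show ?thesis
    using idealD(7)[OF assms(1,4,2)] by simp
qed

definition adjoin :: "'a set \<Rightarrow> 'a \<Rightarrow> 'a set" where
  "adjoin I a = {i \<oplus> r \<otimes> a | i r. i \<in> I \<and> r \<in> carrier R}"

lemma adjoinE:
  assumes "s \<in> adjoin I a"
  obtains i r where "i \<in> I" "r \<in> carrier R" "s = i \<oplus> r \<otimes> a"
  using assms by (auto simp: adjoin_def)

lemma adjoin_ideal:
  assumes I: "ideal I R" and a: "a \<in> carrier R"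
  shows "ideal (adjoin I a) R"
  unfolding ideal_iff
proof (intro conjI ballI)
  note D = idealD[OF I]
  show "adjoin I a \<subseteq> carrier R"
    using D(1) a by (auto simp: adjoin_def)
  have "\<zero> = \<zero> \<oplus> \<zero> \<otimes> a"
    using a by simp
  then show "\<zero> \<in> adjoin I a"
    unfolding adjoin_def using D(2) by blast
next
  note D = idealD[OF I]
  fix u v assume "u \<in> adjoin I a" "v \<in> adjoin I a"
  then obtain i r j s where *: "i \<in> I" "r \<in> carrier R" "u = i \<oplus> r \<otimes> a"
    "j \<in> I" "s \<in> carrier R" "v = j \<oplus> s \<otimes> a"
    by (metis adjoinE)
  then have "u \<oplus> v = (i \<oplus> j) \<oplus> (r \<oplus> s) \<otimes> a"
    using D(1)[of i] D(1)[of j] a by simp algebra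
  then show "u \<oplus> v \<in> adjoin I a"
    unfolding adjoin_def using * D(3) by blast
next
  note D = idealD[OF I]
  fix u s assume "u \<in> adjoin I a" and s: "s \<in> carrier R"
  then obtain i r where *: "i \<in> I" "r \<in> carrier R" "u = i \<oplus> r \<otimes> a"
    by (metis adjoinE)
  then have "s \<otimes> u = (s \<otimes> i) \<oplus> (s \<otimes> r) \<otimes> a"
    using D(1)[of i] a s by simp algebra
  then show "s \<otimes> u \<in> adjoin I a"
    unfolding adjoin_def using * D(4) s by blast
qed

lemma adjoin_subset:
  assumes I: "ideal I R" and a: "a \<in> carrier R"
  shows "I \<subseteq> adjoin I a" "a \<in> adjoin I a"
proof -
  note D = idealD[OF I]
  have "i = i \<oplus> \<zero> \<otimes> a" if "i \<in> I" for i
    using D(1)[OF that] a by simp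
  then show "I \<subseteq> adjoin I a"
    unfolding adjoin_def by blast
  have "a = \<zero> \<oplus> \<one> \<otimes> a"
    using a by simp
  then show "a \<in> adjoin I a"
    unfolding adjoin_def using D(2) by blast
qed

lemma adjoin_least:
  assumes "ideal J R" "I \<subseteq> J" "a \<in> J"
  shows "adjoin I a \<subseteq> J"
  using assms(2,3) idealD[OF assms(1)] by (auto elim!: adjoinE)

lemma genideal_insert:
  assumes I: "ideal I R" and y: "y \<in> carrier R" and Y: "Y \<subseteq> carrier R"
  shows "Idl (I \<union> insert y Y) = Idl (adjoin I y \<union> Y)"
proof
  have Ic: "I \<subseteq> carrier R"
    using idealD(1)[OF I] by blast
  have ac: "adjoin I y \<subseteq> carrier R"
    using idealD(1)[OF adjoin_ideal[OF I y]] by blast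
  have 1: "ideal (Idl (I \<union> insert y Y)) R" "I \<union> insert y Y \<subseteq> Idl (I \<union> insert y Y)"
    using Ic y Y by (intro genideal_ideal genideal_self; blast)+
  then have "adjoin I y \<subseteq> Idl (I \<union> insert y Y)"
    by (intro adjoin_least) auto
  then show "Idl (adjoin I y \<union> Y) \<subseteq> Idl (I \<union> insert y Y)"
    using 1 by (intro genideal_minimal) auto
  have 2: "ideal (Idl (adjoin I y \<union> Y)) R" "adjoin I y \<union> Y \<subseteq> Idl (adjoin I y \<union> Y)"
    using ac Y by (intro genideal_ideal genideal_self; blast)+
  then show "Idl (I \<union> insert y Y) \<subseteq> Idl (adjoin I y \<union> Y)"
    using adjoin_subset[OF I y] by (intro genideal_minimal) auto
qed

text \<open>
  The preimage in \<open>R\<close> of the extension of \<open>I\<close> to the localization \<open>R\<^sub>P\<close>. The saturated ideals are thus in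
  bijection with the ideals of \<open>R\<^sub>P\<close>.
\<close>

definition saturate :: "'a set \<Rightarrow> 'a set \<Rightarrow> 'a set" where
  "saturate P I = {s \<in> carrier R. \<exists>t\<in>carrier R - P. t \<otimes> s \<in> I}"

lemma saturateI: "s \<in> carrier R \<Longrightarrow> t \<in> carrier R \<Longrightarrow> t \<notin> P \<Longrightarrow> t \<otimes> s \<in> I \<Longrightarrow> s \<in> saturate P I"
  by (auto simp: saturate_def)

lemma prime_mult_notin:
  assumes "primeideal P R" "s \<in> carrier R" "t \<in> carrier R" "s \<notin> P" "t \<notin> P"
  shows "s \<otimes> t \<notin> P"
  using primeideal.I_prime[OF assms(1)] assms by blast

lemma prime_proper:
  assumes "primeideal P R"
  shows "ideal P R" "\<one> \<notin> P"
proof -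
  interpret primeideal P R by fact
  show "ideal P R" "\<one> \<notin> P"
    using is_ideal one_imp_carrier I_notcarr by auto
qed

lemma prime_pow_notin:
  assumes "primeideal P R" "x \<in> carrier R" "x \<notin> P"
  shows "x [^] (n::nat) \<notin> P"
  using assms prime_proper[OF assms(1)] prime_mult_notin[OF assms(1)]
  by (induction n) auto

lemma saturate_ideal:
  assumes P: "primeideal P R" and I: "ideal I R"
  shows "ideal (saturate P I) R"
  unfolding ideal_iff
proof (intro conjI ballI)
  note D = idealD[OF I] and o = prime_proper[OF P]
  show "saturate P I \<subseteq> carrier R"
    by (auto simp: saturate_def)
  show "\<zero> \<in> saturate P I"
    using D(2) o by (intro saturateI[of _ \<one>]) auto
next
  note D = idealD[OF I]
  fix u v assume "u \<in> saturate P I" "v \<in> saturate P I"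
  then obtain s t where *: "u \<in> carrier R" "v \<in> carrier R" "s \<in> carrier R" "t \<in> carrier R"
     "s \<notin> P" "t \<notin> P" "s \<otimes> u \<in> I" "t \<otimes> v \<in> I"
    by (auto simp: saturate_def)
  have "(s \<otimes> t) \<otimes> (u \<oplus> v) = t \<otimes> (s \<otimes> u) \<oplus> s \<otimes> (t \<otimes> v)"
    using * by algebra
  then show "u \<oplus> v \<in> saturate P I"
    using * D prime_mult_notin[OF P] by (intro saturateI[of _ "s \<otimes> t"]) auto
next
  note D = idealD[OF I]
  fix u s assume "u \<in> saturate P I" and s: "s \<in> carrier R"
  then obtain t where *: "u \<in> carrier R" "t \<in> carrier R" "t \<notin> P" "t \<otimes> u \<in> I"
    by (auto simp: saturate_def)
  have "t \<otimes> (s \<otimes> u) = s \<otimes> (t \<otimes> u)"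
    using * s by algebra
  then show "s \<otimes> u \<in> saturate P I"
    using * D(4) s by (intro saturateI[of _ t]) auto
qed

lemma saturate_increasing:
  assumes "primeideal P R" "ideal I R"
  shows "I \<subseteq> saturate P I"
  using prime_proper[OF assms(1)] idealD(1)[OF assms(2)] by (auto intro!: saturateI[of _ \<one>])

lemma saturate_idem:
  assumes P: "primeideal P R" and I: "ideal I R"
  shows "saturate P (saturate P I) = saturate P I"
proof
  show "saturate P (saturate P I) \<subseteq> saturate P I"
  proof
    fix u assume "u \<in> saturate P (saturate P I)"
    then obtain s t where *: "u \<in> carrier R" "s \<in> carrier R" "t \<in> carrier R"
     "s \<notin> P" "t \<notin> P" "s \<otimes> (t \<otimes> u) \<in> I"
      by (auto simp: saturate_def)
    then show "u \<in> saturate P I"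
      using prime_mult_notin[OF P] by (intro saturateI[of _ "s \<otimes> t"]) (auto simp: m_assoc)
  qed
qed (rule saturate_increasing[OF P saturate_ideal[OF P I]])

lemma saturate_mono: "I \<subseteq> J \<Longrightarrow> saturate P I \<subseteq> saturate P J"
  by (auto simp: saturate_def)

lemma saturate_antimono: "P \<subseteq> P' \<Longrightarrow> saturate P' I \<subseteq> saturate P I"
  by (auto simp: saturate_def)

definition colon :: "'a set \<Rightarrow> 'a \<Rightarrow> 'a set" where
  "colon I a = {r \<in> carrier R. r \<otimes> a \<in> I}"

lemma colon_ideal:
  assumes I: "ideal I R" and a: "a \<in> carrier R"
  shows "ideal (colon I a) R"
  unfolding ideal_iff using a idealD[OF I]
  by (auto simp: colon_def l_distr m_assoc)

lemma genideal_of_ideal: "ideal I R \<Longrightarrow> Idl I = I"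
  by (intro equalityI genideal_minimal genideal_self) (auto dest: idealD(1))

lemma prime_below_local:
  assumes m: "\<And>t. t \<in> carrier R \<Longrightarrow> t \<notin> m \<Longrightarrow> t \<in> Units R" and Q: "ideal Q R" "\<one> \<notin> Q"
  shows "Q \<subseteq> m"
proof
  fix t assume t: "t \<in> Q"
  show "t \<in> m"
  proof (rule ccontr)
    assume "t \<notin> m"
    then have u: "t \<in> Units R"
      using m t idealD(1)[OF Q(1)] by blast
    then have "inv t \<otimes> t \<in> Q"
      using idealD(4)[OF Q(1) t] by blast
    then show False
      using Q u by simp
  qed
qed

text \<open>
  In a local ring the elements outside \<open>m\<close> are units, so localizing at \<open>m\<close> changes nothing.
\<close>

lemma saturate_local:
  assumes m: "\<And>t. t \<in> carrier R \<Longrightarrow> t \<notin> m \<Longrightarrow> t \<in> Units R" and I: "ideal I R"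
  shows "saturate m I \<subseteq> I"
proof
  fix s assume "s \<in> saturate m I"
  then obtain t where t: "s \<in> carrier R" "t \<in> Units R" "t \<otimes> s \<in> I"
    using m by (auto simp: saturate_def)
  then have "inv t \<otimes> (t \<otimes> s) \<in> I"
    using idealD(4)[OF I t(3)] by blast
  also have "inv t \<otimes> (t \<otimes> s) = (inv t \<otimes> t) \<otimes> s"
    using t by (intro m_assoc[symmetric]) auto
  also have "\<dots> = s"
    using t by simp
  finally show "s \<in> I" .
qed

end

section \<open>Krull's principal ideal theorem\<close>

context noetherian_cring
begin

lemma ideal_maximal:
  assumes "\<I> \<noteq> {}" "\<I> \<subseteq> {I. ideal I R}"
  shows "\<exists>M\<in>\<I>. \<forall>J\<in>\<I>. M \<subseteq> J \<longrightarrow> J = M"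
proof (rule subset_Zorn_nonempty[OF assms(1)])
  fix C assume C: "C \<noteq> {}" "subset.chain \<I> C"
  then have "subset.chain {I. ideal I R} C"
    using assms(2) by (auto simp: pred_on.chain_def)
  then show "\<Union>C \<in> \<I>"
    using ideal_chain_is_trivial[OF C(1)] C by (auto simp: pred_on.chain_def)
qed

text \<open>
  A maximal element among the proper ideals \<open>(K : a)\<close> is prime: if \<open>b c \<in> (K : a)\<close> and \<open>c \<notin> (K : a)\<close>, then \<open>(K : c a)\<close>
  is proper, contains \<open>(K : a)\<close>, hence equals it, and it contains \<open>b\<close>.
\<close>

lemma associated_prime:
  assumes K: "ideal K R" and "K \<noteq> carrier R"
  obtains a where "a \<in> carrier R" "a \<notin> K" "primeideal (colon K a) R"
proof -
  have "K \<subseteq> carrier R"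
    using idealD(1)[OF K] by blast
  then obtain a0 where a0: "a0 \<in> carrier R" "a0 \<notin> K"
    using assms(2) by blast
  let ?\<I> = "colon K ` (carrier R - K)"
  have "?\<I> \<noteq> {}" "?\<I> \<subseteq> {I. ideal I R}"
    using a0 colon_ideal[OF K] by auto
  then have "\<exists>L\<in>?\<I>. \<forall>J\<in>?\<I>. L \<subseteq> J \<longrightarrow> J = L"
    by (rule ideal_maximal)
  then obtain M where M0: "M \<in> ?\<I>" "\<forall>J\<in>?\<I>. M \<subseteq> J \<longrightarrow> J = M"
    by (rule bexE)
  note M = M0(1) M0(2)[rule_format]
  from M(1) obtain a where a: "a \<in> carrier R" "a \<notin> K" "M = colon K a"
    by blast
  have "primeideal (colon K a) R"
  proof (rule primeidealI[OF colon_ideal[OF K a(1)] is_cring])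
    have "\<one> \<notin> colon K a"
      using a by (simp add: colon_def)
    then show "carrier R \<noteq> colon K a"
      by blast
    fix b c assume bc: "b \<in> carrier R" "c \<in> carrier R" "b \<otimes> c \<in> colon K a"
    show "b \<in> colon K a \<or> c \<in> colon K a"
    proof (rule disjCI)
      assume "c \<notin> colon K a"
      then have ca: "c \<otimes> a \<in> carrier R" "c \<otimes> a \<notin> K"
        using bc a by (auto simp: colon_def)
      have "colon K a \<subseteq> colon K (c \<otimes> a)"
      proof
        fix r assume r: "r \<in> colon K a"
        then have "r \<otimes> (c \<otimes> a) = c \<otimes> (r \<otimes> a)"
          using bc a by (simp add: colon_def m_lcomm)
        then show "r \<in> colon K (c \<otimes> a)"
          using r idealD(4)[OF K] bc by (simp add: colon_def)
      qed
      then have "colon K (c \<otimes> a) = colon K a"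
        using M(2)[of "colon K (c \<otimes> a)"] ca a by blast
      then show "b \<in> colon K a"
        using bc a by (auto simp: colon_def m_assoc)
    qed
  qed
  with a that show ?thesis by blast
qed

text \<open>
  If \<open>P\<close> is minimal over \<open>K\<close>, then \<open>R\<^sub>P/K\<^sub>P\<close> is Artinian. The proof is a Noetherian induction on \<open>K\<close>: minimality
  forces an associated prime \<open>(K : a)\<close> to be \<open>P\<close> itself, so that \<open>(K + (a))/K\<close> is a simple module over \<open>R\<^sub>P\<close>.
  A descending sequence above \<open>K\<close> either stays above \<open>K + (a)\<close>, or eventually meets \<open>K + (a)\<close> only in \<open>K\<close>
  and is then determined by its sum with \<open>(a)\<close>. Both reduce to the larger ideal \<open>K + (a)\<close>.
\<close>

lemma saturated_dcc:
  assumes P: "primeideal P R"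
    and K: "ideal K R" "saturate P K = K"
    and min: "\<And>Q. primeideal Q R \<Longrightarrow> K \<subseteq> Q \<Longrightarrow> Q \<subseteq> P \<Longrightarrow> Q = P"
    and J: "\<And>n. ideal (J n) R" "\<And>n. saturate P (J n) = J n" "\<And>n. K \<subseteq> J n"
      "\<And>n k. n \<le> k \<Longrightarrow> J k \<subseteq> J n"
  shows "\<exists>n::nat. \<forall>k\<ge>n. J k = J n"
proof (rule ccontr)
  assume bad: "\<not> ?thesis"
  define unstable where "unstable L \<longleftrightarrow> (\<exists>J::nat \<Rightarrow> 'a set. (\<forall>n. ideal (J n) R) \<and>
     (\<forall>n. saturate P (J n) = J n) \<and> (\<forall>n. L \<subseteq> J n) \<and> (\<forall>n k. n \<le> k \<longrightarrow> J k \<subseteq> J n) \<and>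
     \<not> (\<exists>n. \<forall>k\<ge>n. J k = J n))" for L
  have unstableI: "unstable L"
    if "\<And>n. ideal (J n) R" "\<And>n. saturate P (J n) = J n" "\<And>n. L \<subseteq> J n"
      "\<And>n k. n \<le> k \<Longrightarrow> J k \<subseteq> J n" "\<not> (\<exists>n. \<forall>k\<ge>n. J k = J n)" for L and J :: "nat \<Rightarrow> 'a set"
    unfolding unstable_def by (intro exI[of _ J] conjI allI impI; (rule that; assumption))
  define minp where "minp L \<longleftrightarrow> (\<forall>Q. primeideal Q R \<longrightarrow> L \<subseteq> Q \<longrightarrow> Q \<subseteq> P \<longrightarrow> Q = P)" for L
  define \<I> where "\<I> = {L. ideal L R \<and> saturate P L = L \<and> minp L \<and> unstable L}"
  have "K \<in> \<I>"
    using K min unstableI[OF J bad] by (simp add: \<I>_def minp_def)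
  then have "\<I> \<noteq> {}"
    by blast
  moreover have "\<I> \<subseteq> {I. ideal I R}"
    by (auto simp: \<I>_def)
  ultimately have "\<exists>L\<in>\<I>. \<forall>J\<in>\<I>. L \<subseteq> J \<longrightarrow> J = L"
    by (rule ideal_maximal)
  then obtain L where L0: "L \<in> \<I>" "\<forall>J\<in>\<I>. L \<subseteq> J \<longrightarrow> J = L"
    by (rule bexE)
  note L = L0(1) L0(2)[rule_format]
  have L': "ideal L R" "saturate P L = L" "minp L" "unstable L"
    using L(1) by (simp_all add: \<I>_def)
  note L' = L'(1,2) L'(3)[unfolded minp_def, rule_format] L'(4)
  from L'(4) obtain H where H0: "\<forall>n. ideal (H n) R" "\<forall>n. saturate P (H n) = H n" "\<forall>n. L \<subseteq> H n"
      "\<forall>n k. n \<le> k \<longrightarrow> H k \<subseteq> H n" and Hbad: "\<not> (\<exists>n::nat. \<forall>k\<ge>n. H k = H n)"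
    unfolding unstable_def by (elim exE conjE)
  note H = H0[rule_format]
  have "L \<noteq> carrier R"
  proof
    assume "L = carrier R"
    then have "H n = carrier R" for n
      using H(3)[of n] idealD(1)[OF H(1)[of n]] by blast
    with Hbad show False by blast
  qed
  then obtain a where a: "a \<in> carrier R" "a \<notin> L" "primeideal (colon L a) R"
    using associated_prime[OF L'(1)] by blast
  have "L \<subseteq> colon L a"
    using idealD[OF L'(1)] a by (auto simp: colon_def)
  moreover have "colon L a \<subseteq> P"
    using L'(2) a by (auto simp: colon_def saturate_def)
  ultimately have colon: "colon L a = P"
    using L'(3) a(3) by blast
  define L1 where "L1 = saturate P (adjoin L a)"
  note adj = adjoin_ideal[OF L'(1) a(1)] adjoin_subset[OF L'(1) a(1)]
  have L1: "ideal L1 R" "saturate P L1 = L1" "L \<subseteq> L1" "a \<in> L1"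
    using saturate_ideal[OF P adj(1)] saturate_idem[OF P adj(1)] saturate_increasing[OF P adj(1)] adj(2,3)
    by (auto simp: L1_def)
  have stable: "\<exists>n. \<forall>k\<ge>n. G k = G n"
    if G: "\<And>n. ideal (G n) R" "\<And>n. saturate P (G n) = G n" "\<And>n. L1 \<subseteq> G n"
      "\<And>n k. n \<le> k \<Longrightarrow> G k \<subseteq> G n" for G :: "nat \<Rightarrow> 'a set"
  proof (rule ccontr)
    assume badG: "\<not> ?thesis"
    have "minp L1"
      using L'(3) L1(3) by (auto simp: minp_def)
    then have "L1 \<in> \<I>"
      using L1 unstableI[OF G badG] by (simp add: \<I>_def)
    then show False
      using L(2)[of L1] L1 a by auto
  qed
  show False
  proof (cases "\<forall>n. a \<in> H n")
    case True
    then have "L1 \<subseteq> H n" for n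
      unfolding L1_def using saturate_mono[OF adjoin_least[OF H(1)[of n] H(3)[of n]]] H(2)[of n] by blast
    then have "\<exists>n. \<forall>k\<ge>n. H k = H n"
      by (intro stable H)
    with Hbad show False by blast
  next
    case False
    then obtain n0 where n0: "a \<notin> H n0" by blast
    define G where "G n = saturate P (adjoin (H n) a)" for n
    have adjH: "ideal (adjoin (H n) a) R" for n
      by (rule adjoin_ideal[OF H(1) a(1)])
    have Gmono: "G k \<subseteq> G n" if "n \<le> k" for n k
    proof -
      have "adjoin (H k) a \<subseteq> adjoin (H n) a"
        using H(4)[OF that] by (auto simp: adjoin_def)
      then show ?thesis
        unfolding G_def by (rule saturate_mono)
    qed
    have "adjoin L a \<subseteq> adjoin (H n) a" for n
      using H(3)[of n] by (auto simp: adjoin_def)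
    then have "L1 \<subseteq> G n" for n
      unfolding L1_def G_def by (rule saturate_mono)
    then have "\<exists>n. \<forall>k\<ge>n. G k = G n"
      using saturate_ideal[OF P adjH] saturate_idem[OF P adjH] Gmono
      by (intro stable) (auto simp: G_def)
    then obtain n1 where n1: "\<And>k. k \<ge> n1 \<Longrightarrow> G k = G n1" by blast
    define n where "n = max n0 n1"
    have "H k = H n" if k: "k \<ge> n" for k
    proof
      show "H k \<subseteq> H n"
        using H(4) k by blast
      show "H n \<subseteq> H k"
      proof
        fix s assume s: "s \<in> H n"
        note Dn = idealD[OF H(1)[of n]] and Dk = idealD[OF H(1)[of k]]
        have "s \<in> G n"
          using s adjoin_subset[OF H(1)[of n] a(1)] saturate_increasing[OF P adjH] by (auto simp: G_def)
        moreover have "G n = G k"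
          using n1[of n] n1[of k] k by (simp add: n_def)
        ultimately obtain t where t: "t \<in> carrier R" "t \<notin> P" "t \<otimes> s \<in> adjoin (H k) a"
          by (auto simp: G_def saturate_def)
        then obtain j r where jr: "j \<in> H k" "r \<in> carrier R" "t \<otimes> s = j \<oplus> r \<otimes> a"
          by (auto elim: adjoinE)
        have ra: "r \<otimes> a \<in> H n"
          using ideal_cancel[OF H(1)[of n], of j "r \<otimes> a"] jr a s t Dn(4)[OF s t(1)] H(4)[OF k] by auto
        have "r \<in> P"
        proof (rule ccontr)
          assume "r \<notin> P"
          then have "a \<in> saturate P (H n)"
            using ra jr a by (intro saturateI[of _ r]) auto
          then show False
            using H(2)[of n] H(4)[of n0 n] n0 by (auto simp: n_def)
        qed
        then have "r \<otimes> a \<in> L"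
          using colon by (auto simp: colon_def)
        then have "t \<otimes> s \<in> H k"
          using jr Dk(3) H(3) by auto
        then have "s \<in> saturate P (H k)"
          using t Dn(1)[OF s] by (intro saturateI[of _ t]) auto
        then show "s \<in> H k"
          using H(2) by simp
      qed
    qed
    with Hbad show False by blast
  qed
qed

text \<open>
  Nakayama's lemma over \<open>R\<^sub>P\<close>: if \<open>M = N + y M\<close> with \<open>y \<in> P\<close>, then \<open>M = N\<close>. Instead of counting generators,
  choose a largest saturated ideal \<open>L \<supseteq> N\<close> that does not contain \<open>M\<close>. If \<open>y a \<notin> L\<close> for some \<open>a \<in> M\<close>, maximality yields
  \<open>a \<in> L + (y a)\<close> up to a factor outside \<open>P\<close>, and since \<open>1 - r y\<close> is a unit of \<open>R\<^sub>P\<close> this gives \<open>a \<in> L\<close>.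
  So \<open>y M \<subseteq> L\<close>, hence \<open>M = N + y M \<subseteq> L\<close>, a contradiction.
\<close>

lemma nakayama_saturated:
  assumes P: "primeideal P R" and M: "ideal M R" and N: "ideal N R" and y: "y \<in> P"
    and *: "\<And>s. s \<in> M \<Longrightarrow> \<exists>t\<in>carrier R - P. \<exists>u\<in>N. \<exists>v\<in>M. t \<otimes> s = u \<oplus> y \<otimes> v"
  shows "M \<subseteq> saturate P N"
proof (rule ccontr)
  assume bad: "\<not> ?thesis"
  note Pi = prime_proper[OF P]
  have yc: "y \<in> carrier R"
    using idealD(1)[OF Pi(1) y] .
  define \<I> where "\<I> = {L. ideal L R \<and> N \<subseteq> L \<and> saturate P L = L \<and> \<not> M \<subseteq> L}"
  have "saturate P N \<in> \<I>"
    unfolding \<I>_def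
    using bad saturate_ideal[OF P N] saturate_idem[OF P N] saturate_increasing[OF P N] by auto
  then have "\<I> \<noteq> {}"
    by blast
  moreover have "\<I> \<subseteq> {I. ideal I R}"
    by (auto simp: \<I>_def)
  ultimately have "\<exists>L\<in>\<I>. \<forall>J\<in>\<I>. L \<subseteq> J \<longrightarrow> J = L"
    by (rule ideal_maximal)
  then obtain L where L0: "L \<in> \<I>" "\<forall>J\<in>\<I>. L \<subseteq> J \<longrightarrow> J = L"
    by (rule bexE)
  note L = L0(1) L0(2)[rule_format]
  have L': "ideal L R" "N \<subseteq> L" "saturate P L = L" "\<not> M \<subseteq> L"
    using L(1) by (simp_all add: \<I>_def)
  have yM: "y \<otimes> a \<in> L" if a: "a \<in> M" for a
  proof (rule ccontr)
    assume ya: "y \<otimes> a \<notin> L"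
    have ac: "a \<in> carrier R"
      using idealD(1)[OF M a] .
    then have yac: "y \<otimes> a \<in> carrier R"
      using yc by simp
    note adj = adjoin_ideal[OF L'(1) yac] adjoin_subset[OF L'(1) yac]
    define L1 where "L1 = saturate P (adjoin L (y \<otimes> a))"
    have L1: "ideal L1 R" "saturate P L1 = L1" "L \<subseteq> L1" "y \<otimes> a \<in> L1"
      using saturate_ideal[OF P adj(1)] saturate_idem[OF P adj(1)] saturate_increasing[OF P adj(1)] adj(2,3)
      by (auto simp: L1_def)
    then have "L1 \<notin> \<I>"
      using L(2)[of L1] ya by blast
    then have "a \<in> L1"
      using L1 L'(2) a by (auto simp: \<I>_def)
    then obtain t where t: "t \<in> carrier R" "t \<notin> P" "t \<otimes> a \<in> adjoin L (y \<otimes> a)"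
      by (auto simp: L1_def saturate_def)
    then obtain l r where lr: "l \<in> L" "r \<in> carrier R" "t \<otimes> a = l \<oplus> r \<otimes> (y \<otimes> a)"
      by (auto elim: adjoinE)
    have lc: "l \<in> carrier R" using idealD(1)[OF L'(1) lr(1)] .
    have "(t \<ominus> r \<otimes> y) \<otimes> a = t \<otimes> a \<ominus> r \<otimes> (y \<otimes> a)"
      using t lr ac yc by algebra
    also have "\<dots> = l"
      unfolding lr(3) using lc lr(2) ac yc by algebra
    finally have "(t \<ominus> r \<otimes> y) \<otimes> a \<in> L"
      using lr by simp
    moreover have "t \<ominus> r \<otimes> y \<notin> P"
    proof
      assume "t \<ominus> r \<otimes> y \<in> P"
      then have "(t \<ominus> r \<otimes> y) \<oplus> r \<otimes> y \<in> P"
        using idealD(3,4)[OF Pi(1)] y lr by blast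
      moreover have "(t \<ominus> r \<otimes> y) \<oplus> r \<otimes> y = t"
        using t lr yc by algebra
      ultimately show False
        using t by simp
    qed
    ultimately have "a \<in> saturate P L"
      using t lr yc ac by (intro saturateI[of _ "t \<ominus> r \<otimes> y"]) auto
    then have "a \<in> L"
      using L' by simp
    then show False
      using idealD(4)[OF L'(1)] yc ya by blast
  qed
  have "M \<subseteq> L"
  proof
    fix s assume s: "s \<in> M"
    from *[OF s] obtain t u v where t: "t \<in> carrier R" "t \<notin> P" "u \<in> N" "v \<in> M" "t \<otimes> s = u \<oplus> y \<otimes> v"
      by blast
    then have "t \<otimes> s \<in> L"
      using yM L'(2) idealD(3)[OF L'(1)] by auto
    then have "s \<in> saturate P L"
      using t idealD(1)[OF M s] by (intro saturateI[of _ t]) auto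
    then show "s \<in> L"
      using L' by simp
  qed
  with L' show False by blast
qed

text \<open>
  Krull's principal ideal theorem: in the domain \<open>R/P\<^sub>0\<close>, localized at \<open>P\<^sub>2\<close>, the maximal ideal has height at least
  \<open>2\<close>, so it cannot be minimal over \<open>y\<close>. Krull's argument with symbolic powers of \<open>P\<^sub>1\<close> works with the
  powers of one element \<open>x \<in> P\<^sub>1 - P\<^sub>0\<close>. Let \<open>S\<^sub>n\<close> be the saturation of \<open>P\<^sub>0 + (x\<^sup>n)\<close> with respect
  to \<open>P\<^sub>1\<close>. If \<open>P\<^sub>2\<close> is minimal over \<open>y\<close>, the ideals \<open>S\<^sub>n + (y)\<close> become stationary, which gives
  \<open>S\<^sub>n = S\<^sub>n\<^sub>+\<^sub>1 + y S\<^sub>n\<close> because \<open>y \<notin> P\<^sub>1\<close>, and then \<open>S\<^sub>n = S\<^sub>n\<^sub>+\<^sub>1\<close> by Nakayama. But then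
  \<open>t x\<^sup>n = r x\<^sup>n\<^sup>+\<^sup>1\<close> modulo \<open>P\<^sub>0\<close> for some \<open>t \<notin> P\<^sub>1\<close>, and cancelling \<open>x\<^sup>n\<close> puts \<open>t\<close> into \<open>P\<^sub>1\<close>.
\<close>

lemma prime_between:
  assumes P0: "primeideal P0 R" and P1: "primeideal P1 R" and P2: "primeideal P2 R"
    and sub: "P0 \<subset> P1" "P1 \<subset> P2" and y: "y \<in> P2"
  obtains Q where "primeideal Q R" "P0 \<subset> Q" "Q \<subset> P2" "y \<in> Q"
proof (cases "y \<in> P1")
  case True
  then show ?thesis
    using that[OF P1] sub by blast
next
  case y1: False
  note I0 = prime_proper[OF P0] and I1 = prime_proper[OF P1] and I2 = prime_proper[OF P2]
  have yc: "y \<in> carrier R"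
    using idealD(1)[OF I2(1) y] .
  have "\<exists>Q. primeideal Q R \<and> P0 \<subset> Q \<and> Q \<subset> P2 \<and> y \<in> Q"
  proof (rule ccontr)
    assume none: "\<not> ?thesis"
    obtain x where x: "x \<in> P1" "x \<notin> P0"
      using sub by blast
    have xc: "x \<in> carrier R"
      using idealD(1)[OF I1(1) x(1)] .
    have xn: "x [^] n \<in> carrier R" for n :: nat
      using xc by simp
    define K where "K = saturate P2 (adjoin P0 y)"
    note adj = adjoin_ideal[OF I0(1) yc] adjoin_subset[OF I0(1) yc]
    have K: "ideal K R" "saturate P2 K = K" "adjoin P0 y \<subseteq> K"
      using saturate_ideal[OF P2 adj(1)] saturate_idem[OF P2 adj(1)] saturate_increasing[OF P2 adj(1)]
      by (auto simp: K_def)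
    have min: "Q = P2" if "primeideal Q R" "K \<subseteq> Q" "Q \<subseteq> P2" for Q
      using none that K(3) adj y1 sub by blast
    define S where "S n = saturate P1 (adjoin P0 (x [^] n))" for n :: nat
    have Sadj: "ideal (adjoin P0 (x [^] n)) R" for n :: nat
      by (rule adjoin_ideal[OF I0(1) xn])
    have S: "ideal (S n) R" "saturate P1 (S n) = S n" "adjoin P0 (x [^] n) \<subseteq> S n" for n
      using saturate_ideal[OF P1 Sadj] saturate_idem[OF P1 Sadj] saturate_increasing[OF P1 Sadj]
      by (auto simp: S_def)
    have S_Suc: "S (Suc n) \<subseteq> S n" for n
    proof -
      have "x [^] Suc n \<in> adjoin P0 (x [^] n)"
        using adjoin_subset[OF I0(1) xn[of n]] idealD(5)[OF Sadj[of n]] xc by auto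
      then have "adjoin P0 (x [^] Suc n) \<subseteq> adjoin P0 (x [^] n)"
        using adjoin_subset[OF I0(1) xn[of n]] by (intro adjoin_least[OF Sadj])
      then show ?thesis
        unfolding S_def by (rule saturate_mono)
    qed
    define J where "J n = saturate P2 (adjoin (S n) y)" for n
    have Jadj: "ideal (adjoin (S n) y) R" for n
      by (rule adjoin_ideal[OF S(1) yc])
    have J: "ideal (J n) R" "saturate P2 (J n) = J n" for n
      using saturate_ideal[OF P2 Jadj] saturate_idem[OF P2 Jadj] by (auto simp: J_def)
    have KJ: "K \<subseteq> J n" for n
    proof -
      have "P0 \<subseteq> S n"
        using adjoin_subset[OF I0(1) xn[of n]] S(3)[of n] by blast
      then have "adjoin P0 y \<subseteq> adjoin (S n) y"
        by (auto simp: adjoin_def)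
      then show ?thesis
        unfolding K_def J_def by (rule saturate_mono)
    qed
    have "J (Suc n) \<subseteq> J n" for n
    proof -
      have "adjoin (S (Suc n)) y \<subseteq> adjoin (S n) y"
        using S_Suc[of n] by (auto simp: adjoin_def)
      then show ?thesis
        unfolding J_def by (rule saturate_mono)
    qed
    then have mono: "J k \<subseteq> J n" if "n \<le> k" for n k
      using lift_Suc_antimono_le[of J] that by blast
    have "\<exists>n. \<forall>k\<ge>n. J k = J n"
      by (rule saturated_dcc[OF P2 K(1,2) min J KJ mono])
    then obtain n where n0: "\<forall>k\<ge>n. J k = J n" ..
    have n: "J (Suc n) = J n"
      by (rule n0[rule_format]) simp
    have "S n \<subseteq> saturate P2 (S (Suc n))"
    proof (rule nakayama_saturated[OF P2 S(1)[of n] S(1)[of "Suc n"] y])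
      fix s assume s: "s \<in> S n"
      then have "s \<in> adjoin (S n) y"
        using subsetD[OF adjoin_subset(1)[OF S(1)[of n] yc]] by simp
      then have "s \<in> J n"
        unfolding J_def by (rule subsetD[OF saturate_increasing[OF P2 Jadj[of n]]])
      then have "s \<in> J (Suc n)"
        by (simp only: n)
      then obtain t where t: "t \<in> carrier R" "t \<notin> P2" "t \<otimes> s \<in> adjoin (S (Suc n)) y"
        by (auto simp: J_def saturate_def)
      then obtain u v where uv: "u \<in> S (Suc n)" "v \<in> carrier R" "t \<otimes> s = u \<oplus> v \<otimes> y"
        by (auto elim: adjoinE)
      \<comment> \<open>As \<open>S n\<close> is saturated with respect to \<open>P1\<close>, the factor \<open>y \<notin> P1\<close> can be cancelled.\<close>
      have "v \<otimes> y \<in> S n"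
        using ideal_cancel[OF S(1)[of n], of u "v \<otimes> y"] uv S_Suc idealD(4)[OF S(1)[of n] s t(1)] yc by auto
      then have "v \<in> saturate P1 (S n)"
        using y1 yc uv by (intro saturateI[of _ y]) (auto simp: m_comm)
      then have "v \<in> S n"
        using S(2) by simp
      moreover have "t \<otimes> s = u \<oplus> y \<otimes> v"
        using uv yc by (simp add: m_comm)
      ultimately show "\<exists>t\<in>carrier R - P2. \<exists>u\<in>S (Suc n). \<exists>v\<in>S n. t \<otimes> s = u \<oplus> y \<otimes> v"
        using t uv by blast
    qed
    also have "\<dots> \<subseteq> saturate P1 (S (Suc n))"
      using sub by (intro saturate_antimono) auto
    also have "\<dots> = S (Suc n)"
      by (rule S)
    finally have "x [^] n \<in> S (Suc n)"
      using S(3)[of n] adjoin_subset[OF I0(1) xn[of n]] by blast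
    then obtain t where t: "t \<in> carrier R" "t \<notin> P1" "t \<otimes> x [^] n \<in> adjoin P0 (x [^] Suc n)"
      by (auto simp: S_def saturate_def)
    then obtain p r where pr: "p \<in> P0" "r \<in> carrier R" "t \<otimes> x [^] n = p \<oplus> r \<otimes> x [^] Suc n"
      by (auto elim: adjoinE)
    have pc: "p \<in> carrier R" using idealD(1)[OF I0(1) pr(1)] .
    have "(t \<ominus> r \<otimes> x) \<otimes> x [^] n = t \<otimes> x [^] n \<ominus> r \<otimes> (x [^] n \<otimes> x)"
      using t pr xc xn[of n] by algebra
    also have "\<dots> = p"
      unfolding pr(3) nat_pow_Suc using pc pr(2) xc xn[of n] by algebra
    finally have "(t \<ominus> r \<otimes> x) \<otimes> x [^] n \<in> P0"
      using pr by simp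
    then have "t \<ominus> r \<otimes> x \<in> P0"
      using prime_mult_notin[OF P0, of "t \<ominus> r \<otimes> x" "x [^] n"] prime_pow_notin[OF P0 xc x(2)] t pr xc by auto
    then have "t \<ominus> r \<otimes> x \<oplus> r \<otimes> x \<in> P1"
      using sub idealD(3,4)[OF I1(1)] x pr by blast
    moreover have "t \<ominus> r \<otimes> x \<oplus> r \<otimes> x = t"
      using t pr xc by algebra
    ultimately show False
      using t by simp
  qed
  with that show ?thesis by blast
qed

section \<open>Chains of primes in local rings\<close>

text \<open>
  The element \<open>y\<close> is pushed down the chain one step at a time, from the top, with the principal ideal theorem applied to
  three consecutive primes. The lowest prime is dropped, so the new chain is one step shorter.
\<close>

lemma prime_chain_through:
  assumes "\<And>i. i \<le> Suc n \<Longrightarrow> primeideal (P i) R" "\<And>i. i \<le> n \<Longrightarrow> P i \<subset> P (Suc i)" "y \<in> P (Suc n)"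
  shows "\<exists>Q. (\<forall>i\<le>n. primeideal (Q i) R) \<and> (\<forall>i<n. Q i \<subset> Q (Suc i)) \<and> P 0 \<subset> Q 0 \<and> y \<in> Q 0 \<and>
     Q n = P (Suc n)"
  using assms
proof (induction n arbitrary: P)
  case 0
  show ?case
    using 0(1)[of 1] 0(2)[of 0] 0(3) by (intro exI[of _ "\<lambda>_. P 1"]) simp
next
  case (Suc n)
  have "P n \<subset> P (Suc n)" "P (Suc n) \<subset> P (Suc (Suc n))" 
    using Suc.prems(2)[of n] Suc.prems(2)[of "Suc n"] by simp_all
  moreover have "primeideal (P n) R" "primeideal (P (Suc n)) R" "primeideal (P (Suc (Suc n))) R"
    using Suc.prems(1) by simp_all
  ultimately obtain Q where Q: "primeideal Q R" "P n \<subset> Q" "Q \<subset> P (Suc (Suc n))" "y \<in> Q"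
    using prime_between[of "P n" "P (Suc n)" "P (Suc (Suc n))" y] Suc.prems(3) by metis
  define P' where "P' = P(Suc n := Q)"
  have P': "primeideal (P' i) R" if "i \<le> Suc n" for i
    using Suc.prems(1)[of i] Q(1) that by (simp add: P'_def)
  moreover have "P' i \<subset> P' (Suc i)" if "i \<le> n" for i
    using Suc.prems(2)[of i] Q(2) that by (simp add: P'_def)
  moreover have "y \<in> P' (Suc n)"
    using Q(4) by (simp add: P'_def)
  ultimately have "\<exists>Q'. (\<forall>i\<le>n. primeideal (Q' i) R) \<and> (\<forall>i<n. Q' i \<subset> Q' (Suc i)) \<and> P' 0 \<subset> Q' 0 \<and>
      y \<in> Q' 0 \<and> Q' n = P' (Suc n)"
    by (rule Suc.IH)
  then obtain Q' where Q': "\<And>i. i \<le> n \<Longrightarrow> primeideal (Q' i) R" "\<And>i. i < n \<Longrightarrow> Q' i \<subset> Q' (Suc i)"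
    "P 0 \<subset> Q' 0" "y \<in> Q' 0" "Q' n = Q"
    by (auto simp: P'_def)
  let ?Q = "Q'(Suc n := P (Suc (Suc n)))"
  have "?Q i \<subset> ?Q (Suc i)" if "i < Suc n" for i
    using Q'(2)[of i] Q'(5) Q(3) that by (cases "i = n") simp_all
  moreover have "primeideal (?Q i) R" if "i \<le> Suc n" for i
    using Q'(1)[of i] Suc.prems(1)[of "Suc (Suc n)"] that by simp
  ultimately show ?case
    using Q'(3,4) by (intro exI[of _ ?Q]) simp
qed

text \<open>
  For \<open>I = 0\<close> this is Krull's bound of the dimension of a local ring by the number of generators of \<open>m\<close>, together with
  the equality case. The induction removes a generator \<open>y\<close> and passes from \<open>I\<close> to \<open>I + (y)\<close>, with a chain through \<open>y\<close> that
  is one step shorter. If the bound is attained, then \<open>y \<notin> P\<^sub>0\<close>, since otherwise the original chain would be too long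
  for \<open>I + (y)\<close>. By induction \<open>I + (y)\<close> is the first prime of the shorter chain, so \<open>P\<^sub>0 \<subseteq> I + (y)\<close>. As
  \<open>y \<notin> P\<^sub>0\<close>, this means \<open>P\<^sub>0 = I + y P\<^sub>0\<close>, and Nakayama gives \<open>P\<^sub>0 = I\<close>.
\<close>

theorem prime_chain_bound:
  assumes m: "primeideal m R" "\<And>t. t \<in> carrier R \<Longrightarrow> t \<notin> m \<Longrightarrow> t \<in> Units R"
    and I: "ideal I R" and ys: "set ys \<subseteq> carrier R" and gen: "Idl (I \<union> set ys) = m"
    and P: "\<And>i. i \<le> n \<Longrightarrow> primeideal (P i) R" "\<And>i. i < n \<Longrightarrow> P i \<subset> P (Suc i)" "I \<subseteq> P 0"
  shows "n \<le> length ys \<and> (n = length ys \<longrightarrow> P 0 = I \<and> (\<forall>k<length ys.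
     primeideal (Idl (I \<union> set (take k ys))) R \<and> ys ! k \<notin> Idl (I \<union> set (take k ys))))"
  using I ys gen P
proof (induction ys arbitrary: I n P)
  case Nil
    have "m = I"
      using Nil(3) genideal_of_ideal[OF Nil(1)] by simp
    moreover have "n = 0"
    proof (rule ccontr)
      assume "n \<noteq> 0"
      then have "P 0 \<subset> P 1" "P 1 \<subseteq> m"
        using Nil(5)[of 0] prime_below_local[OF m(2) prime_proper[OF Nil(4)[of 1]]] by auto
      then show False
        using Nil(6) \<open>m = I\<close> by blast
    qed
    ultimately show ?case
      using Nil(6) prime_below_local[OF m(2) prime_proper[OF Nil(4)[of 0]]] by auto
  next
    case (Cons y ys)
    then have y: "y \<in> carrier R" by simp
    note adj = adjoin_ideal[OF Cons(2) y] adjoin_subset[OF Cons(2) y]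
    have gen: "Idl (adjoin I y \<union> set ys) = m"
      using genideal_insert[OF Cons(2) y, of "set ys"] Cons by simp
    have ym: "y \<in> m"
      using genideal_self[of "I \<union> set (y # ys)"] Cons(3,4) idealD(1)[OF Cons(2)] by auto
    note IH = Cons.IH[OF adj(1) _ gen]
    show ?case
    proof (cases n)
      case 0
      then show ?thesis by simp
    next
      case (Suc k)
      have top: "P k \<subset> P n" "P n \<subseteq> m"
        using Cons(6)[of k] prime_below_local[OF m(2) prime_proper[OF Cons(5)[of n]]] Suc by auto
      \<comment> \<open>The top of the chain need not contain \<open>y\<close>; the maximal ideal does.\<close>
      define P' where "P' = P(n := m)"
      have P': "primeideal (P' i) R" if "i \<le> Suc k" for i
        using Cons(5)[of i] m(1) that Suc by (simp add: P'_def)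
      have "P' i \<subset> P' (Suc i)" if "i \<le> k" for i
      proof (cases "i = k")
        case True
        then show ?thesis
          using top Suc by (auto simp: P'_def)
      next
        case False
        then show ?thesis
          using Cons(6)[of i] that Suc by (simp add: P'_def)
      qed
      moreover have "y \<in> P' (Suc k)"
        using ym Suc by (simp add: P'_def)
      ultimately have "\<exists>Q. (\<forall>i\<le>k. primeideal (Q i) R) \<and> (\<forall>i<k. Q i \<subset> Q (Suc i)) \<and> P' 0 \<subset> Q 0 \<and>
          y \<in> Q 0 \<and> Q k = P' (Suc k)"
        using P' by (intro prime_chain_through)
      then obtain Q where Q: "\<And>i. i \<le> k \<Longrightarrow> primeideal (Q i) R" "\<And>i. i < k \<Longrightarrow> Q i \<subset> Q (Suc i)"
          "P' 0 \<subset> Q 0" "y \<in> Q 0"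
        by blast
      have "P' 0 = P 0"
        using Suc by (simp add: P'_def)
      note Q = Q(1,2) Q(3)[unfolded this] Q(4)
      have "adjoin I y \<subseteq> Q 0"
        using Q Cons(7) prime_proper[OF Q(1)[of 0]] by (intro adjoin_least) auto
      then have IHQ: "k \<le> length ys \<and> (k = length ys \<longrightarrow> Q 0 = adjoin I y \<and> (\<forall>k<length ys.
         primeideal (Idl (adjoin I y \<union> set (take k ys))) R \<and> ys ! k \<notin> Idl (adjoin I y \<union> set (take k ys))))"
        using Cons(3) Q by (intro IH) auto
      show ?thesis
      proof (intro conjI impI)
        show "n \<le> length (y # ys)"
          using IHQ Suc by simp
        assume n: "n = length (y # ys)"
        then have Q0: "Q 0 = adjoin I y"
          using IHQ Suc by simp
        have P0: "primeideal (P 0) R"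
          using Cons(5) by simp
        have yP: "y \<notin> P 0"
        proof
          assume "y \<in> P 0"
          then have "adjoin I y \<subseteq> P 0"
            using Cons(7) prime_proper[OF P0] by (intro adjoin_least) auto
          then have "n \<le> length ys"
            using IH[of n P] Cons(3,5,6) by simp
          then show False
            using n by simp
        qed
        have "P 0 \<subseteq> saturate m I"
        proof (rule nakayama_saturated[OF m(1) prime_proper(1)[OF P0] Cons(2) ym])
          fix s assume s: "s \<in> P 0"
          then have "s \<in> adjoin I y"
            using Q(3) Q0 by blast
          then obtain i r where ir: "i \<in> I" "r \<in> carrier R" "s = i \<oplus> r \<otimes> y"
            by (auto elim: adjoinE)
          then have "i \<in> P 0" "r \<otimes> y \<in> carrier R" "i \<oplus> r \<otimes> y \<in> P 0"
            using s Cons(7) y by auto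
          then have "r \<otimes> y \<in> P 0"
            by (rule ideal_cancel[OF prime_proper(1)[OF P0]])
          then have "r \<in> P 0"
            using prime_mult_notin[OF P0] yP ir y by blast
          moreover have "\<one> \<otimes> s = i \<oplus> y \<otimes> r"
            using ir y idealD(1)[OF Cons(2)] by (simp add: m_comm)
          ultimately show "\<exists>t\<in>carrier R - m. \<exists>u\<in>I. \<exists>v\<in>P 0. t \<otimes> s = u \<oplus> y \<otimes> v"
            using ir prime_proper[OF m(1)] by blast
        qed
        then show PI: "P 0 = I"
          using saturate_local[OF m(2) Cons(2)] Cons(7) by blast
        show "\<forall>k<length (y # ys). primeideal (Idl (I \<union> set (take k (y # ys)))) R \<and>
                (y # ys) ! k \<notin> Idl (I \<union> set (take k (y # ys)))"
        proof (intro allI impI)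
          fix j assume j: "j < length (y # ys)"
          show "primeideal (Idl (I \<union> set (take j (y # ys)))) R \<and>
                (y # ys) ! j \<notin> Idl (I \<union> set (take j (y # ys)))"
          proof (cases j)
            case 0
            then show ?thesis
              using PI P0 yP genideal_of_ideal[OF Cons(2)] by simp
          next
            case j': (Suc j')
            have "Idl (I \<union> set (take j (y # ys))) = Idl (adjoin I y \<union> set (take j' ys))"
              using genideal_insert[OF Cons(2) y, of "set (take j' ys)"] Cons(3) set_take_subset[of j' ys]
              by (auto simp: j')
            then show ?thesis
              using IHQ n Suc j j' by auto
          qed
        qed
      qed
    qed
qed

end

section \<open>Kernels of tensor products and right exactness\<close>

lemma tensor_kernel_diff:
  assumes "module R M" "module R N"
    and "c \<in> tensor_kernel R M N" "d \<in> tensor_kernel R M N"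
  shows "c - d \<in> tensor_kernel R M N"
  using tensor_kernel_props(3)[OF assms(1-3)] tensor_kernel_props(4)[OF assms(1,2,4)] by fastforce

lemma tensor_kernel_add_left: "\<lbrakk>x \<in> carrier M; y \<in> carrier M; z \<in> carrier N\<rbrakk> \<Longrightarrow>
      frag_of (x \<oplus>\<^bsub>M\<^esub> y, z) - frag_of (x, z) - frag_of (y, z) \<in> tensor_kernel R M N"
  unfolding tensor_kernel_def tensor_relators_def by (rule generate.incl, blast)

lemma tensor_kernel_add_right: "\<lbrakk>x \<in> carrier M; y \<in> carrier N; z \<in> carrier N\<rbrakk> \<Longrightarrow>
      frag_of (x, y \<oplus>\<^bsub>N\<^esub> z) - frag_of (x, y) - frag_of (x, z) \<in> tensor_kernel R M N"
  unfolding tensor_kernel_def tensor_relators_def by (rule generate.incl, blast)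

lemma tensor_kernel_smult: "\<lbrakk>a \<in> carrier R; x \<in> carrier M; y \<in> carrier N\<rbrakk> \<Longrightarrow>
      frag_of (a \<odot>\<^bsub>M\<^esub> x, y) - frag_of (x, a \<odot>\<^bsub>N\<^esub> y) \<in> tensor_kernel R M N"
  unfolding tensor_kernel_def tensor_relators_def by (rule generate.incl, blast)

lemma tensor_kernel_induct [consumes 3, case_names zero add_left add_right smult plus minus]:
  assumes M: "module R M" and N: "module R N" and c: "c \<in> tensor_kernel R M N"
    and "P 0"
    and "\<And>x y z. \<lbrakk>x \<in> carrier M; y \<in> carrier M; z \<in> carrier N\<rbrakk> \<Longrightarrow>
      P (frag_of (x \<oplus>\<^bsub>M\<^esub> y, z) - frag_of (x, z) - frag_of (y, z))"
    and "\<And>x y z. \<lbrakk>x \<in> carrier M; y \<in> carrier N; z \<in> carrier N\<rbrakk> \<Longrightarrow>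
      P (frag_of (x, y \<oplus>\<^bsub>N\<^esub> z) - frag_of (x, y) - frag_of (x, z))"
    and "\<And>a x y. \<lbrakk>a \<in> carrier R; x \<in> carrier M; y \<in> carrier N\<rbrakk> \<Longrightarrow>
      P (frag_of (a \<odot>\<^bsub>M\<^esub> x, y) - frag_of (x, a \<odot>\<^bsub>N\<^esub> y))"
    and "\<And>c d. P c \<Longrightarrow> P d \<Longrightarrow> P (c + d)"
    and "\<And>c. P c \<Longrightarrow> P (- c)"
  shows "P c"
proof -
  have rel: "P t" if "t \<in> tensor_relators R M N" for t
    using that unfolding tensor_relators_def by (elim UnE CollectE exE conjE) (simp_all add: assms)
  show ?thesis
    using c unfolding tensor_kernel_def
  proof (induction rule: generate.induct)
    case one
    then show ?case using assms by simp
  next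
    case (incl t)
    then show ?case by (rule rel)
  next
    case (inv t)
    then have "inv\<^bsub>pairs_group M N\<^esub> t = - t"
      using subsetD[OF tensor_relators_carrier[OF M N] inv] by simp
    then show ?case using rel[OF inv] assms by simp
  next
    case (eng c d)
    then show ?case using assms by simp
  qed
qed

lemma tensor_kernel_zero_left:
  assumes M: "module R M" and N: "module R N" and z: "z \<in> carrier N"
  shows "frag_of (\<zero>\<^bsub>M\<^esub>, z) \<in> tensor_kernel R M N"
proof -
  interpret M: module R M by fact
  have "frag_of (\<zero>\<^bsub>M\<^esub> \<oplus>\<^bsub>M\<^esub> \<zero>\<^bsub>M\<^esub>, z) - frag_of (\<zero>\<^bsub>M\<^esub>, z) - frag_of (\<zero>\<^bsub>M\<^esub>, z) \<in> tensor_kernel R M N"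
    using z by (intro tensor_kernel_add_left) auto
  from tensor_kernel_props(4)[OF M N this] show ?thesis
    by simp
qed

lemma tensor_kernel_zero_right:
  assumes M: "module R M" and N: "module R N" and z: "z \<in> carrier M"
  shows "frag_of (z, \<zero>\<^bsub>N\<^esub>) \<in> tensor_kernel R M N"
proof -
  interpret N: module R N by fact
  have "frag_of (z, \<zero>\<^bsub>N\<^esub> \<oplus>\<^bsub>N\<^esub> \<zero>\<^bsub>N\<^esub>) - frag_of (z, \<zero>\<^bsub>N\<^esub>) - frag_of (z, \<zero>\<^bsub>N\<^esub>) \<in> tensor_kernel R M N"
    using z by (intro tensor_kernel_add_right) auto
  from tensor_kernel_props(4)[OF M N this] show ?thesis
    by simp
qed

lemma tensor_kernel_all_zero:
  assumes M: "module R M" and N: "module R N" and c: "Poly_Mapping.keys c \<subseteq> {\<zero>\<^bsub>M\<^esub>} \<times> carrier N"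
  shows "c \<in> tensor_kernel R M N"
proof (rule free_Abelian_group_induct[OF c])
  show "0 \<in> tensor_kernel R M N"
    by (rule tensor_kernel_props[OF M N])
  show "x - y \<in> tensor_kernel R M N" if "x \<in> tensor_kernel R M N" "y \<in> tensor_kernel R M N" for x y
    using that by (rule tensor_kernel_diff[OF M N])
  show "frag_of a \<in> tensor_kernel R M N" if "a \<in> {\<zero>\<^bsub>M\<^esub>} \<times> carrier N" for a
    using that tensor_kernel_zero_left[OF M N] by auto
qed

lemma tensor_kernel_mono:
  assumes M: "module R (M\<lparr>carrier := H\<rparr>)" and M': "module R (M\<lparr>carrier := H'\<rparr>)" and N: "module R N"
    and "H \<subseteq> H'" "c \<in> tensor_kernel R (M\<lparr>carrier := H\<rparr>) N"
  shows "c \<in> tensor_kernel R (M\<lparr>carrier := H'\<rparr>) N"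
proof -
  have "linear_map R (M\<lparr>carrier := H\<rparr>) (M\<lparr>carrier := H'\<rparr>) (\<lambda>x. x)"
    using assms(4) by (auto simp: linear_map_def)
  from tensor_kernel_functorial[OF M M' N this assms(5)] show ?thesis
    using frag_map_fst_ident[of c UNIV UNIV "\<lambda>x. x"] by simp
qed

definition adjoin_submodule :: "('a, 'r) ring_scheme \<Rightarrow> ('a, 'm, 'z) module_scheme \<Rightarrow> 'm set \<Rightarrow> 'm \<Rightarrow> 'm set" where
  "adjoin_submodule R M H x = {u \<oplus>\<^bsub>M\<^esub> r \<odot>\<^bsub>M\<^esub> x | u r. u \<in> H \<and> r \<in> carrier R}"

text \<open>
  The annihilator of the class of \<open>x\<close> in \<open>M/H\<close>, so that \<open>(H + R x)/H \<cong> R/(H : x)\<close>.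
\<close>

definition transporter :: "('a, 'r) ring_scheme \<Rightarrow> ('a, 'm, 'z) module_scheme \<Rightarrow> 'm set \<Rightarrow> 'm \<Rightarrow> 'a set" where
  "transporter R M H x = {r \<in> carrier R. r \<odot>\<^bsub>M\<^esub> x \<in> H}"

definition ideal_module :: "('a, 'r) ring_scheme \<Rightarrow> 'a set \<Rightarrow> ('a, 'a) module" where
  "ideal_module R I =
     \<lparr>carrier = I, monoid.mult = monoid.mult R, one = one R, ring.zero = ring.zero R, ring.add = ring.add R,
      smult = monoid.mult R\<rparr>"

lemma ideal_module_simps [simp]:
  "carrier (ideal_module R I) = I" "\<zero>\<^bsub>ideal_module R I\<^esub> = \<zero>\<^bsub>R\<^esub>"
  "x \<oplus>\<^bsub>ideal_module R I\<^esub> y = x \<oplus>\<^bsub>R\<^esub> y" "a \<odot>\<^bsub>ideal_module R I\<^esub> x = a \<otimes>\<^bsub>R\<^esub> x"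
  "(ideal_module R I)\<lparr>carrier := J\<rparr> = ideal_module R J"
  by (simp_all add: ideal_module_def)

lemma (in module) submodule_facts:
  assumes "submodule H R M"
  shows "u \<in> H \<Longrightarrow> u \<in> carrier M" "\<zero>\<^bsub>M\<^esub> \<in> H" "u \<in> H \<Longrightarrow> v \<in> H \<Longrightarrow> u \<oplus>\<^bsub>M\<^esub> v \<in> H"
    "u \<in> H \<Longrightarrow> r \<in> carrier R \<Longrightarrow> r \<odot>\<^bsub>M\<^esub> u \<in> H" "u \<in> H \<Longrightarrow> \<ominus>\<^bsub>M\<^esub> u \<in> H"
    "u \<in> H \<Longrightarrow> v \<in> H \<Longrightarrow> u \<ominus>\<^bsub>M\<^esub> v \<in> H"
  using submoduleE[OF assms] subgroup.one_closed[OF submodule.axioms(1)[OF assms]]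
  by (auto simp: M.minus_eq)

lemma adjoin_submodule:
  assumes M: "module R M" and H: "submodule H R M" and x: "x \<in> carrier M"
  shows "submodule (adjoin_submodule R M H x) R M"
    and "H \<subseteq> adjoin_submodule R M H x" and "x \<in> adjoin_submodule R M H x"
proof -
  interpret module R M by fact
  note E = submodule_facts[OF H]
  define H' where "H' = adjoin_submodule R M H x"
  have H'I: "a \<odot>\<^bsub>M\<^esub> x \<oplus>\<^bsub>M\<^esub> y \<in> H'" if "a \<in> carrier R" "y \<in> H" for a y
    using that x E(1) unfolding H'_def adjoin_submodule_def by (auto simp: M.a_comm)
  have H'E: "\<exists>a y. u = a \<odot>\<^bsub>M\<^esub> x \<oplus>\<^bsub>M\<^esub> y \<and> a \<in> carrier R \<and> y \<in> H" if u: "u \<in> H'" for u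
  proof -
    from u obtain a y where "u = y \<oplus>\<^bsub>M\<^esub> a \<odot>\<^bsub>M\<^esub> x" "a \<in> carrier R" "y \<in> H"
      unfolding H'_def adjoin_submodule_def by blast
    moreover from this have "u = a \<odot>\<^bsub>M\<^esub> x \<oplus>\<^bsub>M\<^esub> y"
      using x E(1) by (simp add: M.a_comm)
    ultimately show ?thesis by blast
  qed
  have "submodule H' R M"
  proof (rule submoduleI)
    show "H' \<subseteq> carrier M"
      using x E(1) H'E by fastforce
    show "\<zero>\<^bsub>M\<^esub> \<in> H'"
      using H'I[OF R.zero_closed E(2)] x by simp
    show "\<ominus>\<^bsub>M\<^esub> u \<in> H'" if "u \<in> H'" for u
    proof -
      from H'E[OF that] obtain a y where u: "u = a \<odot>\<^bsub>M\<^esub> x \<oplus>\<^bsub>M\<^esub> y" "a \<in> carrier R" "y \<in> H"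
        by blast
      then have "\<ominus>\<^bsub>M\<^esub> u = (\<ominus>\<^bsub>R\<^esub> a) \<odot>\<^bsub>M\<^esub> x \<oplus>\<^bsub>M\<^esub> (\<ominus>\<^bsub>M\<^esub> y)"
        using x E(1) by (simp add: smult_l_minus M.minus_add)
      then show ?thesis using H'I[of "\<ominus>\<^bsub>R\<^esub> a" "\<ominus>\<^bsub>M\<^esub> y"] u E by simp
    qed
    show "u \<oplus>\<^bsub>M\<^esub> v \<in> H'" if "u \<in> H'" "v \<in> H'" for u v
    proof -
      from H'E[OF that(1)] H'E[OF that(2)] obtain a y b z where u: "u = a \<odot>\<^bsub>M\<^esub> x \<oplus>\<^bsub>M\<^esub> y" "a \<in> carrier R" "y \<in> H"
        "v = b \<odot>\<^bsub>M\<^esub> x \<oplus>\<^bsub>M\<^esub> z" "b \<in> carrier R" "z \<in> H"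
        by blast
      then have "u \<oplus>\<^bsub>M\<^esub> v = (a \<oplus>\<^bsub>R\<^esub> b) \<odot>\<^bsub>M\<^esub> x \<oplus>\<^bsub>M\<^esub> (y \<oplus>\<^bsub>M\<^esub> z)"
        using x E(1) by (simp add: smult_l_distr M.a_ac)
      then show ?thesis using H'I[of "a \<oplus>\<^bsub>R\<^esub> b" "y \<oplus>\<^bsub>M\<^esub> z"] u E by simp
    qed
    show "b \<odot>\<^bsub>M\<^esub> u \<in> H'" if "b \<in> carrier R" "u \<in> H'" for b u
    proof -
      from H'E[OF that(2)] obtain a y where u: "u = a \<odot>\<^bsub>M\<^esub> x \<oplus>\<^bsub>M\<^esub> y" "a \<in> carrier R" "y \<in> H"
        by blast
      then have "b \<odot>\<^bsub>M\<^esub> u = (b \<otimes>\<^bsub>R\<^esub> a) \<odot>\<^bsub>M\<^esub> x \<oplus>\<^bsub>M\<^esub> (b \<odot>\<^bsub>M\<^esub> y)"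
        using x E(1) that by (simp add: smult_r_distr smult_assoc1)
      then show ?thesis using H'I[of "b \<otimes>\<^bsub>R\<^esub> a" "b \<odot>\<^bsub>M\<^esub> y"] u E that by simp
    qed
  qed
  moreover have "x \<in> H'" using H'I[OF R.one_closed E(2)] x by simp
  moreover have "y \<in> H'" if "y \<in> H" for y
    using H'I[OF R.zero_closed that] x E(1)[OF that] by simp
  ultimately show "submodule (adjoin_submodule R M H x) R M"
    "H \<subseteq> adjoin_submodule R M H x" "x \<in> adjoin_submodule R M H x"
    unfolding H'_def by blast+
qed

lemma ideal_module_module:
  assumes "cring R" "ideal I R"
  shows "module R (ideal_module R I)"
proof -
  interpret R: cring R by fact
  interpret I: ideal I R by fact
  note I = I.Icarr
  have "abelian_group (ideal_module R I)"
  proof (rule abelian_groupI)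
    fix x assume "x \<in> carrier (ideal_module R I)"
    then show "\<exists>y\<in>carrier (ideal_module R I). y \<oplus>\<^bsub>ideal_module R I\<^esub> x = \<zero>\<^bsub>ideal_module R I\<^esub>"
      by (auto intro!: bexI[of _ "\<ominus>\<^bsub>R\<^esub> x"] simp: R.l_neg I)
  qed (auto simp: R.a_ac I)
  then show ?thesis
    by (intro moduleI assms(1)) (auto simp: R.l_distr R.r_distr R.m_assoc I I.I_l_closed)
qed

lemma ideal_submodule:
  assumes "cring R" "ideal I R"
  shows "submodule I R (ideal_module R (carrier R))"
proof -
  interpret R: cring R by fact
  interpret I: ideal I R by fact
  interpret M: module R "ideal_module R (carrier R)"
    using assms R.oneideal by (intro ideal_module_module)
  show ?thesis
  proof (rule M.submoduleI)
    fix a assume a: "a \<in> I"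
    have "\<ominus>\<^bsub>ideal_module R (carrier R)\<^esub> a = \<ominus>\<^bsub>R\<^esub> a"
      using a I.Icarr by (intro M.minus_equality) (auto simp: R.l_neg)
    then show "\<ominus>\<^bsub>ideal_module R (carrier R)\<^esub> a \<in> I"
      using a by simp
  qed (use I.Icarr I.I_l_closed in auto)
qed

text \<open>
  The exact sequence \<open>Tor\<^sub>1(R/(H : x), N) \<rightarrow> H \<otimes> N \<rightarrow> (H + R x) \<otimes> N\<close>, where \<open>Tor\<^sub>1(R/J, N)\<close> is the kernel of
  \<open>J \<otimes> N \<rightarrow> R \<otimes> N\<close> and the first map sends \<open>a \<otimes> s\<close> to \<open>a x \<otimes> s\<close>. The module \<open>H + R x\<close> is the quotient of
  \<open>H \<oplus> R\<close> by the elements \<open>(a x, -a)\<close> with \<open>a \<in> (H : x)\<close>. Write each \<open>u\<close> as \<open>p u + q u x\<close>. The functions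
  \<open>p\<close> and \<open>q\<close> fail to be linear by terms \<open>i x\<close> and \<open>-i\<close> with \<open>i \<in> (H : x)\<close>; these defects, collected over the
  relators that make up \<open>c\<close>, form \<open>e\<close>.
\<close>

lemma tensor_kernel_adjoin:
  fixes R :: "('a, 'r) ring_scheme" and M :: "('a, 'm, 'z) module_scheme" and N :: "('a, 'n, 'w) module_scheme"
  assumes M: "module R M" and N: "module R N" and H: "submodule H R M" and x: "x \<in> carrier M"
    and cH: "Poly_Mapping.keys c \<subseteq> H \<times> carrier N"
    and cK: "c \<in> tensor_kernel R (M\<lparr>carrier := adjoin_submodule R M H x\<rparr>) N"
  shows "\<exists>e. Poly_Mapping.keys e \<subseteq> transporter R M H x \<times> carrier N \<and>
     e \<in> tensor_kernel R (ideal_module R (carrier R)) N \<and>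
     c - frag_map_fst (\<lambda>a. a \<odot>\<^bsub>M\<^esub> x) e \<in> tensor_kernel R (M\<lparr>carrier := H\<rparr>) N"
proof -
  interpret module R M by fact
  interpret N: module R N by fact
  note E = submodule_facts[OF H]
  define L where "L = adjoin_submodule R M H x"
  have subL: "submodule L R M"
    unfolding L_def by (rule adjoin_submodule[OF M H x])
  note EL = submodule_facts[OF subL]
  let ?I = "transporter R M H x" and ?MH = "M\<lparr>carrier := H\<rparr>" and ?Mx = "M\<lparr>carrier := L\<rparr>"
    and ?RR = "ideal_module R (carrier R)" and ?\<Phi> = "frag_map_fst (\<lambda>a. a \<odot>\<^bsub>M\<^esub> x) :: ('a \<times> 'n \<Rightarrow>\<^sub>0 int) \<Rightarrow> _"
  have modH: "module R ?MH" and modL: "module R ?Mx"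
    by (rule submodule.submodule_is_module[OF H M], rule submodule.submodule_is_module[OF subL M])
  have modR: "module R ?RR"
    by (rule ideal_module_module[OF R.is_cring R.oneideal])
  note KH = tensor_kernel_props[OF modH N] and KR = tensor_kernel_props[OF modR N]
  \<comment> \<open>On \<open>H\<close> the decomposition is the trivial one, so that \<open>p\<close> fixes \<open>c\<close> and \<open>q\<close> annihilates it.\<close>
  have "\<exists>pq. u = fst pq \<oplus>\<^bsub>M\<^esub> snd pq \<odot>\<^bsub>M\<^esub> x \<and> fst pq \<in> H \<and> snd pq \<in> carrier R \<and> (u \<in> H \<longrightarrow> pq = (u, \<zero>\<^bsub>R\<^esub>))"
    if "u \<in> L" for u
  proof (cases "u \<in> H")
    case True
    then show ?thesis using E(1) x by (intro exI[of _ "(u, \<zero>\<^bsub>R\<^esub>)"]) simp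
  next
    case False
    then show ?thesis using that unfolding L_def adjoin_submodule_def by auto
  qed
  then obtain pq where pq: "\<And>u. u \<in> L \<Longrightarrow> u = fst (pq u) \<oplus>\<^bsub>M\<^esub> snd (pq u) \<odot>\<^bsub>M\<^esub> x \<and> fst (pq u) \<in> H \<and>
      snd (pq u) \<in> carrier R \<and> (u \<in> H \<longrightarrow> pq u = (u, \<zero>\<^bsub>R\<^esub>))"
    by metis
  define p q where "p u = fst (pq u)" and "q u = snd (pq u)" for u
  have p: "u = p u \<oplus>\<^bsub>M\<^esub> q u \<odot>\<^bsub>M\<^esub> x" "p u \<in> H" "p u \<in> carrier M" "q u \<in> carrier R"
    if "u \<in> L" for u
    using pq[OF that] E(1) by (auto simp: p_def q_def)
  have pH: "p u = u" "q u = \<zero>\<^bsub>R\<^esub>" if "u \<in> H" for u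
    using pq[of u] that adjoin_submodule(2)[OF M H x] by (auto simp: p_def q_def L_def)
  \<comment> \<open>\<open>i\<close> is the difference of the coefficients of \<open>x\<close> in two decompositions of \<open>w\<close>.\<close>
  have cancel: "p w = v \<oplus>\<^bsub>M\<^esub> i \<odot>\<^bsub>M\<^esub> x \<and> i \<in> ?I"
    if "w \<in> L" "v \<in> H" "r \<in> carrier R" "w = v \<oplus>\<^bsub>M\<^esub> r \<odot>\<^bsub>M\<^esub> x" "i = r \<ominus>\<^bsub>R\<^esub> q w" for w v r i
  proof -
    have v: "v \<in> carrier M" using E(1) that by blast
    have "p w \<oplus>\<^bsub>M\<^esub> q w \<odot>\<^bsub>M\<^esub> x = v \<oplus>\<^bsub>M\<^esub> r \<odot>\<^bsub>M\<^esub> x"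
      using p(1)[OF that(1)] that(4) by simp
    note eq0 = this
    have "p w = (p w \<oplus>\<^bsub>M\<^esub> q w \<odot>\<^bsub>M\<^esub> x) \<oplus>\<^bsub>M\<^esub> \<ominus>\<^bsub>M\<^esub> (q w \<odot>\<^bsub>M\<^esub> x)"
      using p(3,4)[OF that(1)] x by (simp add: M.a_assoc M.r_neg)
    also have "\<dots> = (v \<oplus>\<^bsub>M\<^esub> r \<odot>\<^bsub>M\<^esub> x) \<oplus>\<^bsub>M\<^esub> \<ominus>\<^bsub>M\<^esub> (q w \<odot>\<^bsub>M\<^esub> x)"
      by (simp only: eq0)
    also have "\<dots> = v \<oplus>\<^bsub>M\<^esub> i \<odot>\<^bsub>M\<^esub> x"
      using p(4)[OF that(1)] v that(3) x
      by (simp add: that(5) M.a_assoc R.minus_eq smult_l_distr smult_l_minus)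
    finally have eq: "p w = v \<oplus>\<^bsub>M\<^esub> i \<odot>\<^bsub>M\<^esub> x" .
    have "i \<odot>\<^bsub>M\<^esub> x = \<ominus>\<^bsub>M\<^esub> v \<oplus>\<^bsub>M\<^esub> p w"
      unfolding eq using v that(3,5) p(4)[OF that(1)] x by (simp add: M.r_neg1)
    then have "i \<in> ?I"
      using that(2,3,5) p(2,4)[OF that(1)] E by (simp add: transporter_def)
    with eq show ?thesis by simp
  qed
  have relsum: "frag_of (a \<oplus>\<^bsub>M\<^esub> b, s) - frag_of (a, s) - frag_of (b, s) \<in> tensor_kernel R ?MH N"
    if "a \<in> H" "b \<in> H" "s \<in> carrier N" for a b s
    using tensor_kernel_add_left[where M = ?MH and R = R and N = N and x = a and y = b and z = s] that by simp
  have relsumR: "frag_of (a \<oplus>\<^bsub>R\<^esub> b, s) - frag_of (a, s) - frag_of (b, s) \<in> tensor_kernel R ?RR N"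
    if "a \<in> carrier R" "b \<in> carrier R" "s \<in> carrier N" for a b s
    using tensor_kernel_add_left[where M = ?RR and R = R and N = N and x = a and y = b and z = s] that by simp
  have "\<exists>e. Poly_Mapping.keys e \<subseteq> ?I \<times> carrier N \<and>
      frag_map_fst p c - ?\<Phi> e \<in> tensor_kernel R ?MH N \<and> frag_map_fst q c + e \<in> tensor_kernel R ?RR N"
    using modL N cK[folded L_def]
  proof (induction rule: tensor_kernel_induct)
    case zero
    show ?case
      using KH(2) KR(2) by (intro exI[of _ 0]) simp
  next
    case (add_left u v s)
    then have uv: "u \<in> L" "v \<in> L" "s \<in> carrier N" "u \<oplus>\<^bsub>M\<^esub> v \<in> L"
      using EL by simp_all
    note pu = p[OF uv(1)] and pv = p[OF uv(2)] and pw = p[OF uv(4)]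
    define i where "i = (q u \<oplus>\<^bsub>R\<^esub> q v) \<ominus>\<^bsub>R\<^esub> q (u \<oplus>\<^bsub>M\<^esub> v)"
    have "(p u \<oplus>\<^bsub>M\<^esub> q u \<odot>\<^bsub>M\<^esub> x) \<oplus>\<^bsub>M\<^esub> (p v \<oplus>\<^bsub>M\<^esub> q v \<odot>\<^bsub>M\<^esub> x) = (p u \<oplus>\<^bsub>M\<^esub> p v) \<oplus>\<^bsub>M\<^esub> (q u \<oplus>\<^bsub>R\<^esub> q v) \<odot>\<^bsub>M\<^esub> x"
      using pu(3,4) pv(3,4) x by (simp add: smult_l_distr M.a_ac)
    then have w: "u \<oplus>\<^bsub>M\<^esub> v = (p u \<oplus>\<^bsub>M\<^esub> p v) \<oplus>\<^bsub>M\<^esub> (q u \<oplus>\<^bsub>R\<^esub> q v) \<odot>\<^bsub>M\<^esub> x"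
      unfolding pu(1)[symmetric] pv(1)[symmetric] .
    then have i: "p (u \<oplus>\<^bsub>M\<^esub> v) = (p u \<oplus>\<^bsub>M\<^esub> p v) \<oplus>\<^bsub>M\<^esub> i \<odot>\<^bsub>M\<^esub> x" "i \<in> ?I"
      using cancel[OF uv(4) _ _ w i_def] pu(2,4) pv(2,4) E(3) by simp_all
    then have ic: "i \<in> carrier R" "i \<odot>\<^bsub>M\<^esub> x \<in> H"
      by (auto simp: transporter_def)
    have qi: "q (u \<oplus>\<^bsub>M\<^esub> v) \<oplus>\<^bsub>R\<^esub> i = q u \<oplus>\<^bsub>R\<^esub> q v"
      unfolding i_def using pu(4) pv(4) pw(4) by algebra
    have "frag_of ((p u \<oplus>\<^bsub>M\<^esub> p v) \<oplus>\<^bsub>M\<^esub> i \<odot>\<^bsub>M\<^esub> x, s) - frag_of (p u \<oplus>\<^bsub>M\<^esub> p v, s) - frag_of (i \<odot>\<^bsub>M\<^esub> x, s)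
        + (frag_of (p u \<oplus>\<^bsub>M\<^esub> p v, s) - frag_of (p u, s) - frag_of (p v, s)) \<in> tensor_kernel R ?MH N"
      using pu(2) pv(2) ic uv(3) E(3) by (intro KH(3) relsum) simp_all
    moreover have "(frag_of (q u \<oplus>\<^bsub>R\<^esub> q v, s) - frag_of (q u, s) - frag_of (q v, s))
        - (frag_of (q (u \<oplus>\<^bsub>M\<^esub> v) \<oplus>\<^bsub>R\<^esub> i, s) - frag_of (q (u \<oplus>\<^bsub>M\<^esub> v), s) - frag_of (i, s)) \<in> tensor_kernel R ?RR N"
      using pu(4) pv(4) pw(4) ic uv(3) by (intro tensor_kernel_diff[OF modR N] relsumR) simp_all
    ultimately show ?case
      using i uv qi by (intro exI[of _ "frag_of (i, s)"]) (simp add: frag_extend_diff frag_extend_add algebra_simps)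
  next
    case (add_right u s t)
    then have u: "u \<in> L" "s \<in> carrier N" "t \<in> carrier N"
      by simp_all
    have "frag_of (p u, s \<oplus>\<^bsub>N\<^esub> t) - frag_of (p u, s) - frag_of (p u, t) \<in> tensor_kernel R ?MH N"
      "frag_of (q u, s \<oplus>\<^bsub>N\<^esub> t) - frag_of (q u, s) - frag_of (q u, t) \<in> tensor_kernel R ?RR N"
      using u p(2,4)[OF u(1)] by (intro tensor_kernel_add_right; simp)+
    then show ?case
      by (intro exI[of _ 0]) (simp add: frag_extend_diff)
  next
    case (smult a u s)
    then have u: "u \<in> L" "s \<in> carrier N" "a \<in> carrier R" "a \<odot>\<^bsub>M\<^esub> u \<in> L"
      using EL by simp_all
    note pu = p[OF u(1)] and pw = p[OF u(4)]
    define i where "i = a \<otimes>\<^bsub>R\<^esub> q u \<ominus>\<^bsub>R\<^esub> q (a \<odot>\<^bsub>M\<^esub> u)"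
    have "a \<odot>\<^bsub>M\<^esub> (p u \<oplus>\<^bsub>M\<^esub> q u \<odot>\<^bsub>M\<^esub> x) = a \<odot>\<^bsub>M\<^esub> p u \<oplus>\<^bsub>M\<^esub> (a \<otimes>\<^bsub>R\<^esub> q u) \<odot>\<^bsub>M\<^esub> x"
      using pu(3,4) x u(3) by (simp add: smult_r_distr smult_assoc1)
    then have w: "a \<odot>\<^bsub>M\<^esub> u = a \<odot>\<^bsub>M\<^esub> p u \<oplus>\<^bsub>M\<^esub> (a \<otimes>\<^bsub>R\<^esub> q u) \<odot>\<^bsub>M\<^esub> x"
      unfolding pu(1)[symmetric] .
    then have i: "p (a \<odot>\<^bsub>M\<^esub> u) = a \<odot>\<^bsub>M\<^esub> p u \<oplus>\<^bsub>M\<^esub> i \<odot>\<^bsub>M\<^esub> x" "i \<in> ?I"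
      using cancel[OF u(4) _ _ w i_def] pu(2,4) u(3) E(4) by simp_all
    then have ic: "i \<in> carrier R" "i \<odot>\<^bsub>M\<^esub> x \<in> H"
      by (auto simp: transporter_def)
    have qi: "q (a \<odot>\<^bsub>M\<^esub> u) \<oplus>\<^bsub>R\<^esub> i = a \<otimes>\<^bsub>R\<^esub> q u"
      unfolding i_def using pu(4) pw(4) u by algebra
    have f1: "frag_of (a \<odot>\<^bsub>M\<^esub> p u, s) - frag_of (p u, a \<odot>\<^bsub>N\<^esub> s) \<in> tensor_kernel R ?MH N"
      using tensor_kernel_smult[of a R "p u" ?MH s N] pu(2) u(2,3) by simp
    have f2: "frag_of (a \<odot>\<^bsub>M\<^esub> p u \<oplus>\<^bsub>M\<^esub> i \<odot>\<^bsub>M\<^esub> x, s) - frag_of (a \<odot>\<^bsub>M\<^esub> p u, s) - frag_of (i \<odot>\<^bsub>M\<^esub> x, s)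
      \<in> tensor_kernel R ?MH N"
      using pu(2) ic u(2,3) E(4) by (intro relsum) simp_all
    have g1: "frag_of (a \<otimes>\<^bsub>R\<^esub> q u, s) - frag_of (q u, a \<odot>\<^bsub>N\<^esub> s) \<in> tensor_kernel R ?RR N"
      using tensor_kernel_smult[of a R "q u" ?RR s N] pu(4) u(2,3) by simp
    have g2: "frag_of (q (a \<odot>\<^bsub>M\<^esub> u) \<oplus>\<^bsub>R\<^esub> i, s) - frag_of (q (a \<odot>\<^bsub>M\<^esub> u), s) - frag_of (i, s) \<in> tensor_kernel R ?RR N"
      using pu(4) pw(4) ic u(2,3) by (intro relsumR) simp_all
    from KH(3)[OF f2 f1] tensor_kernel_diff[OF modR N g1 g2] show ?case
      using i u qi by (intro exI[of _ "frag_of (i, s)"]) (simp add: frag_extend_diff frag_extend_add algebra_simps)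
  next
    case (plus c d)
    then obtain e e' where "Poly_Mapping.keys e \<subseteq> ?I \<times> carrier N" "Poly_Mapping.keys e' \<subseteq> ?I \<times> carrier N"
      "frag_map_fst p c - ?\<Phi> e \<in> tensor_kernel R ?MH N" "frag_map_fst q c + e \<in> tensor_kernel R ?RR N"
      "frag_map_fst p d - ?\<Phi> e' \<in> tensor_kernel R ?MH N" "frag_map_fst q d + e' \<in> tensor_kernel R ?RR N"
      by blast
    moreover from this have "(frag_map_fst p c - ?\<Phi> e) + (frag_map_fst p d - ?\<Phi> e') \<in> tensor_kernel R ?MH N"
      "(frag_map_fst q c + e) + (frag_map_fst q d + e') \<in> tensor_kernel R ?RR N"
      by (simp_all only: KH(3) KR(3))
    ultimately show ?case
      using keys_add[of e e'] by (intro exI[of _ "e + e'"]) (auto simp: frag_extend_add algebra_simps)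
  next
    case (minus c)
    then obtain e where "Poly_Mapping.keys e \<subseteq> ?I \<times> carrier N"
      "frag_map_fst p c - ?\<Phi> e \<in> tensor_kernel R ?MH N" "frag_map_fst q c + e \<in> tensor_kernel R ?RR N"
      by blast
    then show ?case
      using KH(4) KR(4) by (intro exI[of _ "- e"]) (fastforce simp: frag_extend_minus algebra_simps)
  qed
  then obtain e where e: "Poly_Mapping.keys e \<subseteq> ?I \<times> carrier N"
    "frag_map_fst p c - ?\<Phi> e \<in> tensor_kernel R ?MH N" "frag_map_fst q c + e \<in> tensor_kernel R ?RR N"
    by blast
  have pc: "frag_map_fst p c = c"
    by (rule frag_map_fst_ident[OF cH]) (rule pH)
  have "Poly_Mapping.keys (frag_map_fst q c) \<subseteq> {\<zero>\<^bsub>?RR\<^esub>} \<times> carrier N"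
    by (rule frag_map_fst_keys[OF cH]) (auto simp: pH)
  then have "frag_map_fst q c \<in> tensor_kernel R ?RR N"
    by (rule tensor_kernel_all_zero[OF modR N])
  from tensor_kernel_diff[OF modR N e(3) this] have "e \<in> tensor_kernel R ?RR N"
    by simp
  with e pc show ?thesis by auto
qed

section \<open>Flatness and ideals\<close>

text \<open>
  Injectivity of \<open>I \<otimes> N \<rightarrow> R \<otimes> N\<close>. This is \<open>Tor\<^sub>1(R/I, N) = 0\<close>, by the long exact sequence of
  \<open>0 \<rightarrow> I \<rightarrow> R \<rightarrow> R/I \<rightarrow> 0\<close>.
\<close>

definition tor_vanishes :: "('a, 'r) ring_scheme \<Rightarrow> ('a, 'n, 'z) module_scheme \<Rightarrow> 'a set \<Rightarrow> bool" where
  "tor_vanishes R N I \<longleftrightarrow> (\<forall>c. Poly_Mapping.keys c \<subseteq> I \<times> carrier N \<longrightarrow>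
     c \<in> tensor_kernel R (ideal_module R (carrier R)) N \<longrightarrow> c \<in> tensor_kernel R (ideal_module R I) N)"

lemma transporter_ideal:
  assumes M: "module R M" and H: "submodule H R M" and x: "x \<in> carrier M"
  shows "ideal (transporter R M H x) R"
proof -
  interpret module R M by fact
  note E = submodule_facts[OF H]
  show ?thesis
    unfolding R.ideal_iff transporter_def using E x by (auto simp: smult_l_distr smult_assoc1)
qed

lemma tensor_kernel_adjoin_inj:
  assumes M: "module R M" and N: "module R N" and H: "submodule H R M" and x: "x \<in> carrier M"
    and tor: "tor_vanishes R N (transporter R M H x)"
    and c: "Poly_Mapping.keys c \<subseteq> H \<times> carrier N"
      "c \<in> tensor_kernel R (M\<lparr>carrier := adjoin_submodule R M H x\<rparr>) N"
  shows "c \<in> tensor_kernel R (M\<lparr>carrier := H\<rparr>) N"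
proof -
  interpret module R M by fact
  let ?I = "transporter R M H x" and ?\<Phi> = "frag_map_fst (\<lambda>a. a \<odot>\<^bsub>M\<^esub> x)"
  from tensor_kernel_adjoin[OF M N H x c] obtain e where e: "Poly_Mapping.keys e \<subseteq> ?I \<times> carrier N"
    "e \<in> tensor_kernel R (ideal_module R (carrier R)) N"
    "c - ?\<Phi> e \<in> tensor_kernel R (M\<lparr>carrier := H\<rparr>) N"
    by blast
  have modH: "module R (M\<lparr>carrier := H\<rparr>)"
    by (rule submodule.submodule_is_module[OF H M])
  have modI: "module R (ideal_module R ?I)"
    by (rule ideal_module_module[OF R.is_cring transporter_ideal[OF M H x]])
  have "linear_map R (ideal_module R ?I) (M\<lparr>carrier := H\<rparr>) (\<lambda>a. a \<odot>\<^bsub>M\<^esub> x)"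
    using x by (auto simp: linear_map_def transporter_def smult_l_distr smult_assoc1)
  moreover have "e \<in> tensor_kernel R (ideal_module R ?I) N"
    using tor e by (simp add: tor_vanishes_def)
  ultimately have "?\<Phi> e \<in> tensor_kernel R (M\<lparr>carrier := H\<rparr>) N"
    by (rule tensor_kernel_functorial[OF modI modH N])
  from tensor_kernel_props(3)[OF modH N e(3) this] show ?thesis
    by simp
qed

text \<open>
  Reaches an arbitrary finitely generated extension of \<open>H\<close> by adjoining one element at a time; each step is controlled by
  the colon ideal of that element.
\<close>

lemma tensor_kernel_finite_extension:
  assumes M: "module R M" and N: "module R N" and tor: "\<And>I. ideal I R \<Longrightarrow> tor_vanishes R N I"
    and H: "submodule H R M" and B: "finite B" "B \<subseteq> carrier M"
  shows "\<exists>L. submodule L R M \<and> H \<union> B \<subseteq> L \<and> (\<forall>c. Poly_Mapping.keys c \<subseteq> H \<times> carrier N \<longrightarrow>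
     c \<in> tensor_kernel R (M\<lparr>carrier := L\<rparr>) N \<longrightarrow> c \<in> tensor_kernel R (M\<lparr>carrier := H\<rparr>) N)"
  using B
proof (induction B)
  case empty
  then show ?case using H by auto
next
  case (insert x B)
  then obtain L where L: "submodule L R M" "H \<union> B \<subseteq> L"
    "\<And>c. Poly_Mapping.keys c \<subseteq> H \<times> carrier N \<Longrightarrow>
     c \<in> tensor_kernel R (M\<lparr>carrier := L\<rparr>) N \<Longrightarrow> c \<in> tensor_kernel R (M\<lparr>carrier := H\<rparr>) N"
    by auto
  have x: "x \<in> carrier M"
    using insert by simp
  let ?L = "adjoin_submodule R M L x"
  note adj = adjoin_submodule[OF M L(1) x]
  have "c \<in> tensor_kernel R (M\<lparr>carrier := H\<rparr>) N"
    if c: "Poly_Mapping.keys c \<subseteq> H \<times> carrier N" "c \<in> tensor_kernel R (M\<lparr>carrier := ?L\<rparr>) N" for c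
  proof (rule L(3)[OF c(1)])
    have "Poly_Mapping.keys c \<subseteq> L \<times> carrier N"
      using c(1) L(2) by blast
    then show "c \<in> tensor_kernel R (M\<lparr>carrier := L\<rparr>) N"
      using c(2) by (rule tensor_kernel_adjoin_inj[OF M N L(1) x tor[OF transporter_ideal[OF M L(1) x]]])
  qed
  moreover have "H \<union> insert x B \<subseteq> ?L"
    using adj L(2) by blast
  ultimately show ?case
    using adj(1) by (intro exI[of _ ?L]) blast
qed

lemma linear_map_image_submodule:
  assumes M: "module R M" and M': "module R M'" and g: "linear_map R M M' g"
  shows "submodule (g ` carrier M) R M'"
proof -
  interpret M: module R M by fact
  interpret M': module R M' by fact
  have g': "\<And>x y. x \<in> carrier M \<Longrightarrow> y \<in> carrier M \<Longrightarrow> g (x \<oplus>\<^bsub>M\<^esub> y) = g x \<oplus>\<^bsub>M'\<^esub> g y"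
    "\<And>a x. a \<in> carrier R \<Longrightarrow> x \<in> carrier M \<Longrightarrow> g (a \<odot>\<^bsub>M\<^esub> x) = a \<odot>\<^bsub>M'\<^esub> g x"
    "\<And>x. x \<in> carrier M \<Longrightarrow> g x \<in> carrier M'"
    using g by (auto simp: linear_map_def)
  have z: "g \<zero>\<^bsub>M\<^esub> = \<zero>\<^bsub>M'\<^esub>"
    using g'(2)[of "\<zero>\<^bsub>R\<^esub>" "\<zero>\<^bsub>M\<^esub>"] g'(3)[of "\<zero>\<^bsub>M\<^esub>"] by simp
  have neg: "g (\<ominus>\<^bsub>M\<^esub> x) = \<ominus>\<^bsub>M'\<^esub> g x" if "x \<in> carrier M" for x
    using g'(1)[of "\<ominus>\<^bsub>M\<^esub> x" x] g'(3) that z by (intro M'.minus_equality[symmetric]) (auto simp: M.l_neg)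
  show ?thesis
  proof (rule M'.submoduleI)
    show "g ` carrier M \<subseteq> carrier M'" "\<zero>\<^bsub>M'\<^esub> \<in> g ` carrier M"
      using g'(3) z by (auto intro: rev_image_eqI[of "\<zero>\<^bsub>M\<^esub>"])
    show "\<ominus>\<^bsub>M'\<^esub> a \<in> g ` carrier M" if "a \<in> g ` carrier M" for a
      using that neg by (auto simp flip: neg)
    show "a \<oplus>\<^bsub>M'\<^esub> b \<in> g ` carrier M" if "a \<in> g ` carrier M" "b \<in> g ` carrier M" for a b
      using that by (auto simp flip: g'(1))
    show "a \<odot>\<^bsub>M'\<^esub> x \<in> g ` carrier M" if "a \<in> carrier R" "x \<in> g ` carrier M" for a x
      using that by (auto simp flip: g'(2))
  qed
qed

text \<open>
  That a tensor vanishes in \<open>M' \<otimes> N\<close> involves finitely many elements of \<open>M'\<close>, so it already vanishes over a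
  finitely generated extension of the image of \<open>M\<close>, and the finite case applies.
\<close>

theorem flat_module_ideal_criterion:
  fixes R :: "('a, 'r) ring_scheme" and N :: "('a, 'n, 'z) module_scheme"
  assumes N: "module R N" and tor: "\<And>I. ideal I R \<Longrightarrow> tor_vanishes R N I"
  shows "flat_module R N"
  unfolding flat_module_def
proof (intro conjI N allI impI)
  fix M M' :: "('a, 'a list) module" and g
  assume M: "module R M" and M': "module R M'" and g: "linear_map R M M' g" and inj: "inj_on g (carrier M)"
  show "inj_on (tensor_map R M M' N g) (carrier (tensor_product R M N))"
    unfolding tensor_map_inj_iff[OF M M' N g]
  proof (intro allI impI)
    fix c assume c: "Poly_Mapping.keys c \<subseteq> carrier M \<times> carrier N"
      and gc: "frag_map_fst g c \<in> tensor_kernel R M' N"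
    from tensor_kernel_finite[OF M' N gc] obtain B where B: "finite B" "B \<subseteq> carrier M'"
      "\<And>H. submodule H R M' \<Longrightarrow> B \<subseteq> H \<Longrightarrow> frag_map_fst g c \<in> tensor_kernel R (M'\<lparr>carrier := H\<rparr>) N"
      by blast
    let ?H = "g ` carrier M"
    note subH = linear_map_image_submodule[OF M M' g]
    have modH: "module R (M'\<lparr>carrier := ?H\<rparr>)"
      by (rule submodule.submodule_is_module[OF subH M'])
    obtain L where L: "submodule L R M'" "?H \<union> B \<subseteq> L"
      "\<And>c. Poly_Mapping.keys c \<subseteq> ?H \<times> carrier N \<Longrightarrow>
       c \<in> tensor_kernel R (M'\<lparr>carrier := L\<rparr>) N \<Longrightarrow> c \<in> tensor_kernel R (M'\<lparr>carrier := ?H\<rparr>) N"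
      using tensor_kernel_finite_extension[OF M' N tor subH B(1,2)] by blast
    have "Poly_Mapping.keys (frag_map_fst g c) \<subseteq> ?H \<times> carrier N"
      by (rule frag_map_fst_keys[OF c]) simp
    then have gcH: "frag_map_fst g c \<in> tensor_kernel R (M'\<lparr>carrier := ?H\<rparr>) N"
      using L(2) by (intro L(3) B(3)[OF L(1)]) auto
    have "linear_map R (M'\<lparr>carrier := ?H\<rparr>) M (inv_into (carrier M) g)"
    proof -
      interpret M: module R M by fact
      have g': "\<And>x y. x \<in> carrier M \<Longrightarrow> y \<in> carrier M \<Longrightarrow> g x \<oplus>\<^bsub>M'\<^esub> g y = g (x \<oplus>\<^bsub>M\<^esub> y)"
        "\<And>a x. a \<in> carrier R \<Longrightarrow> x \<in> carrier M \<Longrightarrow> a \<odot>\<^bsub>M'\<^esub> g x = g (a \<odot>\<^bsub>M\<^esub> x)"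
        using g by (auto simp: linear_map_def)
      show ?thesis
        using inj by (auto simp: linear_map_def g')
    qed
    from tensor_kernel_functorial[OF modH M N this gcH]
    have "frag_map_fst (inv_into (carrier M) g \<circ> g) c \<in> tensor_kernel R M N"
      by (simp add: frag_map_fst_compose)
    moreover have "frag_map_fst (inv_into (carrier M) g \<circ> g) c = c"
      by (rule frag_map_fst_ident[OF c]) (use inj in auto)
    ultimately show "c \<in> tensor_kernel R M N"
      by simp
  qed
qed

lemma (in cring) adjoin_submodule_ideal:
  "adjoin_submodule R (ideal_module R (carrier R)) I a = adjoin I a"
  "transporter R (ideal_module R (carrier R)) I a = colon I a"
  by (auto simp: adjoin_submodule_def adjoin_def transporter_def colon_def)

text \<open>
  The injection \<open>I \<rightarrow> R\<close> factors through \<open>I + (a)\<close>. For the first factor \<open>(I + (a))/I \<cong> R/(I : a)\<close> is what matters.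
\<close>

lemma (in cring) tor_vanishes_extension:
  assumes N: "module R N" and I: "ideal I R" and a: "a \<in> carrier R"
    and tor: "tor_vanishes R N (colon I a)" "tor_vanishes R N (adjoin I a)"
  shows "tor_vanishes R N I"
  unfolding tor_vanishes_def
proof (intro allI impI)
  let ?R = "ideal_module R (carrier R)"
  fix c assume c: "Poly_Mapping.keys c \<subseteq> I \<times> carrier N" "c \<in> tensor_kernel R ?R N"
  have "Poly_Mapping.keys c \<subseteq> adjoin I a \<times> carrier N"
    using c(1) adjoin_subset[OF I a] by blast
  then have "c \<in> tensor_kernel R (?R\<lparr>carrier := adjoin_submodule R ?R I a\<rparr>) N"
    using tor(2) c(2) by (simp add: tor_vanishes_def adjoin_submodule_ideal)
  then have "c \<in> tensor_kernel R (?R\<lparr>carrier := I\<rparr>) N"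
    using c(1) tor(1) a
    by (intro tensor_kernel_adjoin_inj[of R ?R N I a])
      (auto simp: adjoin_submodule_ideal N intro: ideal_module_module ideal_submodule is_cring oneideal I)
  then show "c \<in> tensor_kernel R (ideal_module R I) N"
    by simp
qed

lemma (in cring) tor_vanishes_trivial:
  assumes N: "module R N"
  shows "tor_vanishes R N {\<zero>}" "tor_vanishes R N (carrier R)"
  using tensor_kernel_all_zero[of R "ideal_module R {\<zero>}" N] N ideal_module_module[OF is_cring zeroideal]
  by (auto simp: tor_vanishes_def)

lemma restrict_scalars_simps [simp]:
  "carrier (restrict_scalars f S) = carrier S" "\<zero>\<^bsub>restrict_scalars f S\<^esub> = \<zero>\<^bsub>S\<^esub>"
  "x \<oplus>\<^bsub>restrict_scalars f S\<^esub> y = x \<oplus>\<^bsub>S\<^esub> y" "a \<odot>\<^bsub>restrict_scalars f S\<^esub> x = f a \<otimes>\<^bsub>S\<^esub> x"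
  by (simp_all add: restrict_scalars_def)

section \<open>Extending the base along a ring homomorphism\<close>

abbreviation frag_map_snd :: "('n \<Rightarrow> 'k) \<Rightarrow> ('m \<times> 'n \<Rightarrow>\<^sub>0 int) \<Rightarrow> ('m \<times> 'k \<Rightarrow>\<^sub>0 int)" where
  "frag_map_snd g \<equiv> frag_extend (\<lambda>(x, y). frag_of (x, g y))"

lemma frag_map_snd_keys:
  assumes "Poly_Mapping.keys c \<subseteq> S \<times> T" "g ` T \<subseteq> T'"
  shows "Poly_Mapping.keys (frag_map_snd g c) \<subseteq> S \<times> T'"
  using assms keys_frag_extend[of "\<lambda>(x, y). frag_of (x, g y)" c] by (fastforce simp: case_prod_beta)

lemma tensor_kernel_functorial_right:
  assumes M: "module R M" and N: "module R N" and N': "module R N'"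
    and g: "linear_map R N N' g" and c: "c \<in> tensor_kernel R M N"
  shows "frag_map_snd g c \<in> tensor_kernel R M N'"
proof -
  note T = tensor_kernel_props[OF M N']
  have g': "\<And>x y. x \<in> carrier N \<Longrightarrow> y \<in> carrier N \<Longrightarrow> g (x \<oplus>\<^bsub>N\<^esub> y) = g x \<oplus>\<^bsub>N'\<^esub> g y"
    "\<And>a x. a \<in> carrier R \<Longrightarrow> x \<in> carrier N \<Longrightarrow> g (a \<odot>\<^bsub>N\<^esub> x) = a \<odot>\<^bsub>N'\<^esub> g x"
    "\<And>x. x \<in> carrier N \<Longrightarrow> g x \<in> carrier N'"
    using g by (auto simp: linear_map_def)
  show ?thesis
    using M N c
  proof (induction rule: tensor_kernel_induct)
    case zero
    then show ?case using T by simp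
  next
    case (add_left x y z)
    then show ?case using tensor_kernel_add_left[of x M y "g z" N'] g'(3) by (simp add: frag_extend_diff)
  next
    case (add_right x y z)
    then show ?case using tensor_kernel_add_right[of x M "g y" N' "g z"] g' by (simp add: frag_extend_diff)
  next
    case (smult a x y)
    then show ?case using tensor_kernel_smult[of a R x M "g y" N'] g' by (simp add: frag_extend_diff)
  next
    case (plus c d)
    then show ?case using T by (simp add: frag_extend_add)
  next
    case (minus c)
    then show ?case using T by (simp add: frag_extend_minus)
  qed
qed

context ring_hom_cring
begin

abbreviation "N \<equiv> restrict_scalars h S"

lemma restrict_module: "module R N"
  by (rule restrict_scalars_module[OF R.is_cring S.is_cring homh])

text \<open>
  By functoriality the elements of \<open>S\<close> act on \<open>M \<otimes> S\<close>, although the tensor product is formed over \<open>R\<close>.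
\<close>

lemma scale_linear:
  assumes "b \<in> carrier S"
  shows "linear_map R N N (\<lambda>s. b \<otimes>\<^bsub>S\<^esub> s)"
  using assms by (auto simp: linear_map_def S.r_distr S.m_lcomm)

text \<open>
  The map \<open>R \<otimes> S \<rightarrow> S\<close>, \<open>a \<otimes> s \<mapsto> h a s\<close>, on formal sums. Its values lie in a carrier and not in a type of class
  \<open>ab_group_add\<close>, so it comes from the universal property of the free abelian group.
\<close>

lemma evaluation:
  obtains v where
    "\<And>a s. a \<in> carrier R \<Longrightarrow> s \<in> carrier S \<Longrightarrow> v (frag_of (a, s)) = h a \<otimes>\<^bsub>S\<^esub> s"
    "\<And>c. Poly_Mapping.keys c \<subseteq> carrier R \<times> carrier S \<Longrightarrow> v c \<in> carrier S"
    "\<And>c d. Poly_Mapping.keys c \<subseteq> carrier R \<times> carrier S \<Longrightarrow> Poly_Mapping.keys d \<subseteq> carrier R \<times> carrier S \<Longrightarrow>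
       v (c + d) = v c \<oplus>\<^bsub>S\<^esub> v d"
    "\<And>c d. Poly_Mapping.keys c \<subseteq> carrier R \<times> carrier S \<Longrightarrow> Poly_Mapping.keys d \<subseteq> carrier R \<times> carrier S \<Longrightarrow>
       v (c - d) = v c \<ominus>\<^bsub>S\<^esub> v d"
    "\<And>c. c \<in> tensor_kernel R (ideal_module R (carrier R)) N \<Longrightarrow> v c = \<zero>\<^bsub>S\<^esub>"
proof -
  let ?D = "carrier R \<times> carrier S" and ?RR = "ideal_module R (carrier R)"
  have "(\<lambda>(a, s). h a \<otimes>\<^bsub>S\<^esub> s) ` ?D \<subseteq> carrier (add_monoid S)"
    by auto
  then obtain v where v: "v \<in> hom (free_Abelian_group ?D) (add_monoid S)"
    "\<And>p. p \<in> ?D \<Longrightarrow> v (frag_of p) = (case p of (a, s) \<Rightarrow> h a \<otimes>\<^bsub>S\<^esub> s)"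
    using comm_group.free_Abelian_group_universal[OF S.a_comm_group, of "\<lambda>(a, s). h a \<otimes>\<^bsub>S\<^esub> s" ?D] by blast
  have closed: "v c \<in> carrier S" if "Poly_Mapping.keys c \<subseteq> ?D" for c
    using hom_in_carrier[OF v(1), of c] that by simp
  have add: "v (c + d) = v c \<oplus>\<^bsub>S\<^esub> v d" if "Poly_Mapping.keys c \<subseteq> ?D" "Poly_Mapping.keys d \<subseteq> ?D" for c d
    using Group.hom_mult[OF v(1), of c d] that by simp
  have diff: "v (c - d) = v c \<ominus>\<^bsub>S\<^esub> v d" if "Poly_Mapping.keys c \<subseteq> ?D" "Poly_Mapping.keys d \<subseteq> ?D" for c d
  proof -
    have k: "Poly_Mapping.keys (c - d) \<subseteq> ?D"
      using keys_diff[of c d] that by blast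
    have "v c = v (c - d) \<oplus>\<^bsub>S\<^esub> v d"
      using add[OF k that(2)] by simp
    then show ?thesis
      using closed[OF k] closed[OF that(2)] by (simp add: S.minus_eq S.a_assoc S.r_neg)
  qed
  have val: "v (frag_of (a, s)) = h a \<otimes>\<^bsub>S\<^esub> s" if "a \<in> carrier R" "s \<in> carrier S" for a s
    using v(2)[of "(a, s)"] that by simp
  have modR: "module R ?RR"
    by (rule ideal_module_module[OF R.is_cring R.oneideal])
  have zero: "v 0 = \<zero>\<^bsub>S\<^esub>"
    using diff[of 0 0] closed[of 0] by (simp add: S.minus_eq S.r_neg)
  have keys3: "Poly_Mapping.keys (frag_of p - frag_of q) \<subseteq> ?D" if "p \<in> ?D" "q \<in> ?D" for p q
    using keys_diff[of "frag_of p" "frag_of q"] that by auto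
  have cancel: "(a \<oplus>\<^bsub>S\<^esub> b) \<ominus>\<^bsub>S\<^esub> a \<ominus>\<^bsub>S\<^esub> b = \<zero>\<^bsub>S\<^esub>" if "a \<in> carrier S" "b \<in> carrier S" for a b
    using that by algebra
  have "Poly_Mapping.keys c \<subseteq> ?D \<and> v c = \<zero>\<^bsub>S\<^esub>" if "c \<in> tensor_kernel R ?RR N" for c
    using modR restrict_module that
  proof (induction rule: tensor_kernel_induct)
    case zero
    then show ?case using \<open>v 0 = \<zero>\<^bsub>S\<^esub>\<close> by simp
  next
    case (add_left x y z)
    then have *: "x \<in> carrier R" "y \<in> carrier R" "z \<in> carrier S" by simp_all
    let ?u = "frag_of (x \<oplus> y, z) - frag_of (x, z)"
    have k: "Poly_Mapping.keys ?u \<subseteq> ?D"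
      using * by (intro keys3) auto
    have "v (?u - frag_of (y, z)) = v (frag_of (x \<oplus> y, z)) \<ominus>\<^bsub>S\<^esub> v (frag_of (x, z)) \<ominus>\<^bsub>S\<^esub> v (frag_of (y, z))"
      using * k by (simp add: diff)
    also have "\<dots> = (h x \<otimes>\<^bsub>S\<^esub> z \<oplus>\<^bsub>S\<^esub> h y \<otimes>\<^bsub>S\<^esub> z) \<ominus>\<^bsub>S\<^esub> h x \<otimes>\<^bsub>S\<^esub> z \<ominus>\<^bsub>S\<^esub> h y \<otimes>\<^bsub>S\<^esub> z"
      using * by (simp add: val S.l_distr)
    also have "\<dots> = \<zero>\<^bsub>S\<^esub>"
      using * by (intro cancel) auto
    finally have "v (?u - frag_of (y, z)) = \<zero>\<^bsub>S\<^esub>" .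
    moreover have "Poly_Mapping.keys (?u - frag_of (y, z)) \<subseteq> ?D"
      using * k keys_diff[of ?u "frag_of (y, z)"] by auto
    ultimately show ?case by simp
  next
    case (add_right x y z)
    then have *: "x \<in> carrier R" "y \<in> carrier S" "z \<in> carrier S" by simp_all
    let ?u = "frag_of (x, y \<oplus>\<^bsub>S\<^esub> z) - frag_of (x, y)"
    have k: "Poly_Mapping.keys ?u \<subseteq> ?D"
      using * by (intro keys3) auto
    have "v (?u - frag_of (x, z)) = v (frag_of (x, y \<oplus>\<^bsub>S\<^esub> z)) \<ominus>\<^bsub>S\<^esub> v (frag_of (x, y)) \<ominus>\<^bsub>S\<^esub> v (frag_of (x, z))"
      using * k by (simp add: diff)
    also have "\<dots> = (h x \<otimes>\<^bsub>S\<^esub> y \<oplus>\<^bsub>S\<^esub> h x \<otimes>\<^bsub>S\<^esub> z) \<ominus>\<^bsub>S\<^esub> h x \<otimes>\<^bsub>S\<^esub> y \<ominus>\<^bsub>S\<^esub> h x \<otimes>\<^bsub>S\<^esub> z"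
      using * by (simp add: val S.r_distr)
    also have "\<dots> = \<zero>\<^bsub>S\<^esub>"
      using * by (intro cancel) auto
    finally have "v (?u - frag_of (x, z)) = \<zero>\<^bsub>S\<^esub>" .
    moreover have "Poly_Mapping.keys (?u - frag_of (x, z)) \<subseteq> ?D"
      using * k keys_diff[of ?u "frag_of (x, z)"] by auto
    ultimately show ?case by simp
  next
    case (smult a x y)
    then have *: "a \<in> carrier R" "x \<in> carrier R" "y \<in> carrier S" by simp_all
    have "v (frag_of (a \<otimes> x, y) - frag_of (x, h a \<otimes>\<^bsub>S\<^esub> y)) = \<zero>\<^bsub>S\<^esub>"
      using * by (simp add: diff val S.m_assoc S.m_lcomm)
    then show ?case
      using * keys3[of "(a \<otimes> x, y)" "(x, h a \<otimes>\<^bsub>S\<^esub> y)"] by simp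
  next
    case (plus c d)
    then show ?case using keys_add[of c d] add[of c d] by auto
  next
    case (minus c)
    then show ?case using diff[of 0 c] \<open>v 0 = \<zero>\<^bsub>S\<^esub>\<close> by (simp add: S.minus_eq)
  qed
  then show ?thesis
    using that[of v] val closed add diff by blast
qed

end

context ring_hom_cring
begin

text \<open>
  Modulo the kernel for \<open>I + (x)\<close>, each tensor can be written as \<open>c\<^sub>1 + x \<otimes> s\<close> with \<open>c\<^sub>1 \<in> I \<otimes> S\<close>. If it
  vanishes in \<open>R \<otimes> S = S\<close>, then \<open>h x s \<in> I S\<close>, hence \<open>s \<in> I S\<close> by the regularity of \<open>h x\<close> on \<open>S/I S\<close>. Then
  \<open>x \<otimes> s\<close> also comes from \<open>I \<otimes> S\<close>, where the vanishing is known.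
\<close>

lemma tor_vanishes_regular_step:
  assumes I: "ideal I R" and x: "x \<in> carrier R" and tor: "tor_vanishes R N I"
    and regular: "\<And>b. b \<in> carrier S \<Longrightarrow> h x \<otimes>\<^bsub>S\<^esub> b \<in> Idl\<^bsub>S\<^esub> (h ` I) \<Longrightarrow> b \<in> Idl\<^bsub>S\<^esub> (h ` I)"
  shows "tor_vanishes R N (R.adjoin I x)"
  unfolding tor_vanishes_def
proof (intro allI impI)
  let ?L = "R.adjoin I x" and ?J = "Idl\<^bsub>S\<^esub> (h ` I)" and ?RR = "ideal_module R (carrier R)"
  note N = restrict_module and Ic = R.idealD(1)[OF I]
  have L: "ideal ?L R" "I \<subseteq> ?L" "x \<in> ?L"
    using R.adjoin_ideal[OF I x] R.adjoin_subset[OF I x] by auto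
  have modL: "module R (ideal_module R ?L)" and modI: "module R (ideal_module R I)" and modR: "module R ?RR"
    using L(1) I R.oneideal by (auto intro: ideal_module_module R.is_cring)
  note KL = tensor_kernel_props[OF modL N] and KLd = tensor_kernel_diff[OF modL N]
  have J: "ideal ?J S" "h ` I \<subseteq> ?J"
    using Ic by (auto intro!: S.genideal_ideal S.genideal_self)
  note Jd = S.idealD[OF J(1)]
  fix c assume c: "Poly_Mapping.keys c \<subseteq> ?L \<times> carrier N" and cR: "c \<in> tensor_kernel R ?RR N"
  have "\<exists>c1 s. Poly_Mapping.keys c1 \<subseteq> I \<times> carrier S \<and> s \<in> carrier S \<and>
      c - c1 - frag_of (x, s) \<in> tensor_kernel R (ideal_module R ?L) N"
  proof (rule free_Abelian_group_induct[OF c])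
    show "\<exists>c1 s. Poly_Mapping.keys c1 \<subseteq> I \<times> carrier S \<and> s \<in> carrier S \<and>
      0 - c1 - frag_of (x, s) \<in> tensor_kernel R (ideal_module R ?L) N"
      using KL(4)[OF tensor_kernel_zero_right[OF modL N, of x]] L(3)
      by (intro exI[of _ 0] exI[of _ "\<zero>\<^bsub>S\<^esub>"]) simp
  next
    fix c d
    assume "\<exists>c1 s. Poly_Mapping.keys c1 \<subseteq> I \<times> carrier S \<and> s \<in> carrier S \<and>
      c - c1 - frag_of (x, s) \<in> tensor_kernel R (ideal_module R ?L) N"
      "\<exists>c1 s. Poly_Mapping.keys c1 \<subseteq> I \<times> carrier S \<and> s \<in> carrier S \<and>
      d - c1 - frag_of (x, s) \<in> tensor_kernel R (ideal_module R ?L) N"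
    then obtain c1 s d1 t where *: "Poly_Mapping.keys c1 \<subseteq> I \<times> carrier S" "s \<in> carrier S"
      "c - c1 - frag_of (x, s) \<in> tensor_kernel R (ideal_module R ?L) N"
      "Poly_Mapping.keys d1 \<subseteq> I \<times> carrier S" "t \<in> carrier S"
      "d - d1 - frag_of (x, t) \<in> tensor_kernel R (ideal_module R ?L) N"
      by blast
    have st: "(s \<ominus>\<^bsub>S\<^esub> t) \<oplus>\<^bsub>S\<^esub> t = s"
      using *(2,5) by algebra
    have "frag_of (x, s) - frag_of (x, s \<ominus>\<^bsub>S\<^esub> t) - frag_of (x, t) \<in> tensor_kernel R (ideal_module R ?L) N"
      using tensor_kernel_add_right[of x "ideal_module R ?L" "s \<ominus>\<^bsub>S\<^esub> t" N t R] *(2,5) L(3) st by simp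
    from KL(3)[OF KLd[OF *(3,6)] this]
    have "(c - d) - (c1 - d1) - frag_of (x, s \<ominus>\<^bsub>S\<^esub> t) \<in> tensor_kernel R (ideal_module R ?L) N"
      by (simp add: algebra_simps)
    then show "\<exists>c1 s. Poly_Mapping.keys c1 \<subseteq> I \<times> carrier S \<and> s \<in> carrier S \<and>
      c - d - c1 - frag_of (x, s) \<in> tensor_kernel R (ideal_module R ?L) N"
      using * keys_diff[of c1 d1] by (intro exI[of _ "c1 - d1"] exI[of _ "s \<ominus>\<^bsub>S\<^esub> t"]) auto
  next
    fix p assume "p \<in> ?L \<times> carrier N"
    then obtain a s where p: "p = (a, s)" "a \<in> ?L" "s \<in> carrier S"
      by auto
    then obtain i r where ir: "i \<in> I" "r \<in> carrier R" "a = i \<oplus> r \<otimes> x"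
      by (auto elim: R.adjoinE)
    have rx: "r \<otimes> x \<in> ?L"
      using R.idealD(4)[OF L(1,3) ir(2)] .
    have 1: "frag_of (i \<oplus> r \<otimes> x, s) - frag_of (i, s) - frag_of (r \<otimes> x, s) \<in> tensor_kernel R (ideal_module R ?L) N"
      using tensor_kernel_add_left[of i "ideal_module R ?L" "r \<otimes> x" s N R] ir L(2) rx p by auto
    have 2: "frag_of (r \<otimes> x, s) - frag_of (x, h r \<otimes>\<^bsub>S\<^esub> s) \<in> tensor_kernel R (ideal_module R ?L) N"
      using tensor_kernel_smult[of r R x "ideal_module R ?L" s N] ir L(3) p by auto
    from KL(3)[OF 1 2] have "frag_of p - frag_of (i, s) - frag_of (x, h r \<otimes>\<^bsub>S\<^esub> s) \<in> tensor_kernel R (ideal_module R ?L) N"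
      by (simp add: p(1) ir(3) algebra_simps)
    then show "\<exists>c1 s. Poly_Mapping.keys c1 \<subseteq> I \<times> carrier S \<and> s \<in> carrier S \<and>
      frag_of p - c1 - frag_of (x, s) \<in> tensor_kernel R (ideal_module R ?L) N"
      using ir p by (intro exI[of _ "frag_of (i, s)"] exI[of _ "h r \<otimes>\<^bsub>S\<^esub> s"]) simp
  qed
  then obtain c1 s where c1: "Poly_Mapping.keys c1 \<subseteq> I \<times> carrier S" "s \<in> carrier S"
      "c - c1 - frag_of (x, s) \<in> tensor_kernel R (ideal_module R ?L) N"
    by blast
  have LR: "d \<in> tensor_kernel R ?RR N" if "d \<in> tensor_kernel R (ideal_module R ?L) N" for d
    using tensor_kernel_mono[of R ?L ?RR "carrier R" N d] modL modR N that R.idealD(1)[OF L(1)] by auto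
  have IL: "d \<in> tensor_kernel R (ideal_module R ?L) N" if "d \<in> tensor_kernel R (ideal_module R I) N" for d
    using tensor_kernel_mono[of R I ?RR ?L N d] modL modI N that L(2) by auto
  obtain v where v:
    "\<And>a s. a \<in> carrier R \<Longrightarrow> s \<in> carrier S \<Longrightarrow> v (frag_of (a, s)) = h a \<otimes>\<^bsub>S\<^esub> s"
    "\<And>c. Poly_Mapping.keys c \<subseteq> carrier R \<times> carrier S \<Longrightarrow> v c \<in> carrier S"
    "\<And>c d. Poly_Mapping.keys c \<subseteq> carrier R \<times> carrier S \<Longrightarrow> Poly_Mapping.keys d \<subseteq> carrier R \<times> carrier S \<Longrightarrow>
       v (c + d) = v c \<oplus>\<^bsub>S\<^esub> v d"
    "\<And>c d. Poly_Mapping.keys c \<subseteq> carrier R \<times> carrier S \<Longrightarrow> Poly_Mapping.keys d \<subseteq> carrier R \<times> carrier S \<Longrightarrow>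
       v (c - d) = v c \<ominus>\<^bsub>S\<^esub> v d"
    "\<And>c. c \<in> tensor_kernel R ?RR N \<Longrightarrow> v c = \<zero>\<^bsub>S\<^esub>"
    using evaluation by blast
  have ID: "I \<times> carrier S \<subseteq> carrier R \<times> carrier S"
    using Ic by blast
  have vJ: "v d \<in> ?J" if d: "Poly_Mapping.keys d \<subseteq> I \<times> carrier S" for d
  proof -
    have "Poly_Mapping.keys d \<subseteq> I \<times> carrier S \<and> v d \<in> ?J"
    proof (rule free_Abelian_group_induct[OF d])
      show "Poly_Mapping.keys 0 \<subseteq> I \<times> carrier S \<and> v 0 \<in> ?J"
        using v(5)[OF tensor_kernel_props(2)[OF modR N]] Jd(2) by simp
    next
      fix c d assume "Poly_Mapping.keys c \<subseteq> I \<times> carrier S \<and> v c \<in> ?J" "Poly_Mapping.keys d \<subseteq> I \<times> carrier S \<and> v d \<in> ?J"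
      then show "Poly_Mapping.keys (c - d) \<subseteq> I \<times> carrier S \<and> v (c - d) \<in> ?J"
        using keys_diff[of c d] ID v(4)[of c d] Jd(7) by auto
    next
      fix p assume "p \<in> I \<times> carrier S"
      then obtain a s where p: "p = (a, s)" "a \<in> I" "s \<in> carrier S"
        by auto
      then have "h a \<otimes>\<^bsub>S\<^esub> s \<in> ?J"
        using J(2) Jd(5) by blast
      then show "Poly_Mapping.keys (frag_of p) \<subseteq> I \<times> carrier S \<and> v (frag_of p) \<in> ?J"
        using p v(1) Ic by simp
    qed
    then show ?thesis by simp
  qed
  have "c - (c - c1 - frag_of (x, s)) \<in> tensor_kernel R ?RR N"
    using tensor_kernel_diff[OF modR N cR LR[OF c1(3)]] .
  then have "v (frag_of (x, s) + c1) = \<zero>\<^bsub>S\<^esub>"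
    using v(5) by (simp add: add.commute)
  then have "v c1 \<oplus>\<^bsub>S\<^esub> h x \<otimes>\<^bsub>S\<^esub> s = \<zero>\<^bsub>S\<^esub>"
    using v(1)[of x s] v(3)[of "frag_of (x, s)" c1] v(2)[of c1] c1 x ID by (auto simp: S.a_comm)
  then have "h x \<otimes>\<^bsub>S\<^esub> s \<in> ?J"
    using S.ideal_cancel[OF J(1) vJ[OF c1(1)], of "h x \<otimes>\<^bsub>S\<^esub> s"] Jd(2) x c1 by simp
  then have s: "s \<in> ?J"
    using regular c1(2) by blast
  \<comment> \<open>The elements \<open>s\<close> for which \<open>x \<otimes> s\<close> comes from \<open>I \<otimes> S\<close> form an ideal that contains \<open>h ` I\<close>.\<close>
  define D where "D = {s \<in> carrier S. \<exists>c2. Poly_Mapping.keys c2 \<subseteq> I \<times> carrier S \<and>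
     frag_of (x, s) - c2 \<in> tensor_kernel R (ideal_module R ?L) N}"
  have "ideal D S"
    unfolding S.ideal_iff
  proof (intro conjI ballI)
    show "D \<subseteq> carrier S"
      by (auto simp: D_def)
    show "\<zero>\<^bsub>S\<^esub> \<in> D"
      using tensor_kernel_zero_right[OF modL N, of x] L(3) unfolding D_def
      by (intro CollectI conjI exI[of _ 0]) auto
  next
    fix s t assume "s \<in> D" "t \<in> D"
    then obtain c d where *: "s \<in> carrier S" "t \<in> carrier S"
      "Poly_Mapping.keys c \<subseteq> I \<times> carrier S" "frag_of (x, s) - c \<in> tensor_kernel R (ideal_module R ?L) N"
      "Poly_Mapping.keys d \<subseteq> I \<times> carrier S" "frag_of (x, t) - d \<in> tensor_kernel R (ideal_module R ?L) N"
      unfolding D_def by blast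
    have "frag_of (x, s \<oplus>\<^bsub>S\<^esub> t) - frag_of (x, s) - frag_of (x, t) \<in> tensor_kernel R (ideal_module R ?L) N"
      using tensor_kernel_add_right[of x "ideal_module R ?L" s N t R] *(1,2) L(3) by simp
    from KL(3)[OF KL(3)[OF this *(4)] *(6)]
    have "frag_of (x, s \<oplus>\<^bsub>S\<^esub> t) - (c + d) \<in> tensor_kernel R (ideal_module R ?L) N"
      by (simp add: algebra_simps)
    then show "s \<oplus>\<^bsub>S\<^esub> t \<in> D"
      unfolding D_def using * keys_add[of c d] by (intro CollectI conjI exI[of _ "c + d"]) auto
  next
    fix s b assume "s \<in> D" and b: "b \<in> carrier S"
    then obtain c where *: "s \<in> carrier S"
      "Poly_Mapping.keys c \<subseteq> I \<times> carrier S" "frag_of (x, s) - c \<in> tensor_kernel R (ideal_module R ?L) N"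
      unfolding D_def by blast
    from tensor_kernel_functorial_right[OF modL N N scale_linear[OF b] *(3)]
    have "frag_of (x, b \<otimes>\<^bsub>S\<^esub> s) - frag_map_snd (\<lambda>s. b \<otimes>\<^bsub>S\<^esub> s) c \<in> tensor_kernel R (ideal_module R ?L) N"
      by (simp add: frag_extend_diff)
    moreover have "Poly_Mapping.keys (frag_map_snd (\<lambda>s. b \<otimes>\<^bsub>S\<^esub> s) c) \<subseteq> I \<times> carrier S"
      using b by (intro frag_map_snd_keys[OF *(2)]) auto
    ultimately show "b \<otimes>\<^bsub>S\<^esub> s \<in> D"
      unfolding D_def using * b by auto
  qed
  moreover have "h ` I \<subseteq> D"
  proof
    fix t assume "t \<in> h ` I"
    then obtain i where i: "i \<in> I" "t = h i" by blast
    have ic: "i \<in> carrier R" using Ic[OF i(1)] .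
    have xi: "i \<otimes> x \<in> I"
      using R.idealD(5)[OF I i(1) x] .
    have "frag_of (i \<otimes> x, \<one>\<^bsub>S\<^esub>) - frag_of (x, h i) \<in> tensor_kernel R (ideal_module R ?L) N"
      using tensor_kernel_smult[of i R x "ideal_module R ?L" "\<one>\<^bsub>S\<^esub>" N] ic L(3) by simp
    from KL(4)[OF this] have "frag_of (x, h i) - frag_of (i \<otimes> x, \<one>\<^bsub>S\<^esub>) \<in> tensor_kernel R (ideal_module R ?L) N"
      by simp
    then show "t \<in> D"
      unfolding D_def using xi i ic by (intro CollectI conjI exI[of _ "frag_of (i \<otimes> x, \<one>\<^bsub>S\<^esub>)"]) auto
  qed
  ultimately have "?J \<subseteq> D"
    by (rule S.genideal_minimal)
  with s obtain c2 where c2: "Poly_Mapping.keys c2 \<subseteq> I \<times> carrier S"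
     "frag_of (x, s) - c2 \<in> tensor_kernel R (ideal_module R ?L) N"
    unfolding D_def by blast
  from KL(3)[OF c1(3) c2(2)] have diff: "c - (c1 + c2) \<in> tensor_kernel R (ideal_module R ?L) N"
    by (simp add: algebra_simps)
  have "c1 + c2 \<in> tensor_kernel R ?RR N"
    using tensor_kernel_diff[OF modR N cR LR[OF diff]] by (simp add: add.commute)
  moreover have "Poly_Mapping.keys (c1 + c2) \<subseteq> I \<times> carrier N"
    using keys_add[of c1 c2] c1(1) c2(1) by auto
  ultimately have "c1 + c2 \<in> tensor_kernel R (ideal_module R I) N"
    using tor unfolding tor_vanishes_def by blast
  from KL(3)[OF diff IL[OF this]] show "c \<in> tensor_kernel R (ideal_module R ?L) N"
    by simp
qed

end

section \<open>The prime step\<close>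

text \<open>
  Submodules of \<open>R\<^sup>n\<close>, with vectors as functions on \<open>nat\<close>; the bound \<open>n\<close> on the support is imposed where it is
  needed, which lets an induction over \<open>n\<close> stay within one type.
\<close>

definition (in cring) vector_module :: "(nat \<Rightarrow> 'a) set \<Rightarrow> bool" where
  "vector_module V \<longleftrightarrow> (\<forall>s\<in>V. \<forall>i. s i \<in> carrier R) \<and> (\<lambda>i. \<zero>) \<in> V \<and>
     (\<forall>s\<in>V. \<forall>t\<in>V. (\<lambda>i. s i \<oplus> t i) \<in> V) \<and> (\<forall>r\<in>carrier R. \<forall>s\<in>V. (\<lambda>i. r \<otimes> s i) \<in> V)"

lemma (in cring) vector_moduleD:
  assumes "vector_module V"
  shows "s \<in> V \<Longrightarrow> s i \<in> carrier R" "(\<lambda>i. \<zero>) \<in> V" "s \<in> V \<Longrightarrow> t \<in> V \<Longrightarrow> (\<lambda>i. s i \<oplus> t i) \<in> V"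
    "r \<in> carrier R \<Longrightarrow> s \<in> V \<Longrightarrow> (\<lambda>i. r \<otimes> s i) \<in> V" "s \<in> V \<Longrightarrow> t \<in> V \<Longrightarrow> (\<lambda>i. s i \<ominus> t i) \<in> V"
proof -
  show *: "s \<in> V \<Longrightarrow> s i \<in> carrier R" "(\<lambda>i. \<zero>) \<in> V" "s \<in> V \<Longrightarrow> t \<in> V \<Longrightarrow> (\<lambda>i. s i \<oplus> t i) \<in> V"
    "r \<in> carrier R \<Longrightarrow> s \<in> V \<Longrightarrow> (\<lambda>i. r \<otimes> s i) \<in> V" for s t r i
    using assms by (auto simp: vector_module_def)
  assume st: "s \<in> V" "t \<in> V"
  have "(\<lambda>i. s i \<oplus> (\<ominus> \<one>) \<otimes> t i) \<in> V"
    using *(3)[OF st(1) *(4)[OF _ st(2)], of "\<ominus> \<one>"] by simp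
  moreover have "s i \<oplus> (\<ominus> \<one>) \<otimes> t i = s i \<ominus> t i" for i
    using *(1)[OF st(1)] *(1)[OF st(2)] by (simp add: minus_eq l_minus)
  ultimately show "(\<lambda>i. s i \<ominus> t i) \<in> V" by simp
qed

lemma (in cring) vector_module_slice:
  assumes "vector_module V"
  shows "ideal {s n | s. s \<in> V} R" "vector_module {s \<in> V. s n = \<zero>}"
proof -
  note D = vector_moduleD[OF assms]
  show "ideal {s n | s. s \<in> V} R"
    unfolding ideal_iff
  proof (intro conjI ballI)
    show "{s n | s. s \<in> V} \<subseteq> carrier R"
      using D(1) by blast
    show "\<zero> \<in> {s n | s. s \<in> V}"
      using D(2) by (intro CollectI exI[of _ "\<lambda>i. \<zero>"]) simp
  next
    fix a b assume "a \<in> {s n | s. s \<in> V}" "b \<in> {s n | s. s \<in> V}"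
    then obtain s t where "s \<in> V" "a = s n" "t \<in> V" "b = t n" by blast
    then show "a \<oplus> b \<in> {s n | s. s \<in> V}"
      using D(3)[of s t] by (intro CollectI exI[of _ "\<lambda>i. s i \<oplus> t i"]) simp
  next
    fix a r assume "a \<in> {s n | s. s \<in> V}" "r \<in> carrier R"
    then obtain s where "s \<in> V" "a = s n" by blast
    then show "r \<otimes> a \<in> {s n | s. s \<in> V}"
      using D(4)[of r s] \<open>r \<in> carrier R\<close> by (intro CollectI exI[of _ "\<lambda>i. r \<otimes> s i"]) simp
  qed
  show "vector_module {s \<in> V. s n = \<zero>}"
    unfolding vector_module_def using D by auto
qed

text \<open>
  Nakayama's lemma for submodules of \<open>R\<^sup>n\<close>, from the one for ideals: if \<open>V = W + y V\<close>, the ideals of last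
  coordinates of \<open>V\<close> and \<open>W\<close> satisfy the same equation and therefore agree. This allows to correct the elements of \<open>V\<close> by elements of \<open>W\<close>
  so that their last coordinate vanishes, and the equation descends to the submodules of vectors with last coordinate \<open>0\<close>.
\<close>

lemma (in noetherian_cring) nakayama_vectors:
  assumes m: "primeideal m R" "\<And>t. t \<in> carrier R \<Longrightarrow> t \<notin> m \<Longrightarrow> t \<in> Units R" and y: "y \<in> m"
    and "vector_module V" "vector_module W" "W \<subseteq> V"
    and "\<And>s i. s \<in> V \<Longrightarrow> n \<le> i \<Longrightarrow> s i = \<zero>"
    and "\<And>s. s \<in> V \<Longrightarrow> \<exists>w\<in>W. \<exists>t\<in>V. s = (\<lambda>i. w i \<oplus> y \<otimes> t i)"
  shows "V \<subseteq> W"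
  using assms(4-)
proof (induction n arbitrary: V W)
  case 0
  then have "s = (\<lambda>i. \<zero>)" if "s \<in> V" for s
    using that by (intro ext) simp
  then show ?case
    using vector_moduleD(2)[OF 0(2)] by blast
next
  case (Suc n)
  have yc: "y \<in> carrier R"
    using idealD(1)[OF prime_proper(1)[OF m(1)] y] .
  note DV = vector_moduleD[OF Suc.prems(1)] and DW = vector_moduleD[OF Suc.prems(2)]
  let ?V = "{s \<in> V. s n = \<zero>}" and ?W = "{s \<in> W. s n = \<zero>}"
  note sV = vector_module_slice[OF Suc.prems(1), of n] and sW = vector_module_slice[OF Suc.prems(2), of n]
  have "{s n | s. s \<in> V} \<subseteq> saturate m {s n | s. s \<in> W}"
  proof (rule nakayama_saturated[OF m(1) sV(1) sW(1) y])
    fix a assume "a \<in> {s n | s. s \<in> V}"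
    then obtain s where s: "s \<in> V" "a = s n" by blast
    from Suc.prems(5)[OF s(1)] obtain w t where wt: "w \<in> W" "t \<in> V" "s = (\<lambda>i. w i \<oplus> y \<otimes> t i)"
      by blast
    then have "a = w n \<oplus> y \<otimes> t n"
      using s by simp
    then have "\<one> \<otimes> a = w n \<oplus> y \<otimes> t n"
      using DV(1)[OF s(1), of n] s(2) by (metis l_one)
    then show "\<exists>r\<in>carrier R - m. \<exists>u\<in>{s n | s. s \<in> W}. \<exists>v\<in>{s n | s. s \<in> V}. r \<otimes> a = u \<oplus> y \<otimes> v"
      using prime_proper(2)[OF m(1)] wt(1,2) by blast
  qed
  also have "\<dots> \<subseteq> {s n | s. s \<in> W}"
    by (rule saturate_local[OF m(2) sW(1)])
  finally have proj: "\<exists>w\<in>W. s n = w n" if "s \<in> V" for s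
    using that by blast
  have "?V \<subseteq> ?W"
  proof (rule Suc.IH[OF sV(2) sW(2)])
    show "?W \<subseteq> ?V"
      using Suc.prems(3) by blast
    show "s i = \<zero>" if "s \<in> ?V" "n \<le> i" for s i
      using that Suc.prems(4)[of s i] by (cases "i = n") auto
    fix s assume s: "s \<in> ?V"
    then obtain w t where wt: "w \<in> W" "t \<in> V" "s = (\<lambda>i. w i \<oplus> y \<otimes> t i)"
      using Suc.prems(5)[of s] by blast
    obtain u where u: "u \<in> W" "t n = u n"
      using proj[OF wt(2)] by blast
    \<comment> \<open>\<open>s = w + y t = (w + y u) + y (t - u)\<close>, where \<open>t - u\<close> has last coordinate \<open>0\<close>, hence so has \<open>w + y u\<close>.\<close>
    let ?w = "\<lambda>i. w i \<oplus> y \<otimes> u i" and ?t = "\<lambda>i. t i \<ominus> u i"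
    have c: "w i \<in> carrier R" "t i \<in> carrier R" "u i \<in> carrier R" for i
      using DW(1)[OF wt(1)] DV(1)[OF wt(2)] DW(1)[OF u(1)] by auto
    have "?w \<in> W" "?t \<in> V"
      using DW(3)[OF wt(1) DW(4)[OF yc u(1)]] DV(5)[OF wt(2)] u(1) Suc.prems(3) by auto
    moreover have "?w n = \<zero>"
      using s wt(3) u(2) by simp
    moreover have "?t n = \<zero>"
      using u(2) c(3)[of n] by (simp add: minus_eq r_neg)
    moreover have "s = (\<lambda>i. ?w i \<oplus> y \<otimes> ?t i)"
    proof
      fix i
      have "w i \<oplus> y \<otimes> t i = (w i \<oplus> y \<otimes> u i) \<oplus> y \<otimes> (t i \<ominus> u i)"
        using c[of i] yc by algebra
      then show "s i = ?w i \<oplus> y \<otimes> ?t i"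
        using wt(3) by simp
    qed
    ultimately show "\<exists>w\<in>?W. \<exists>t\<in>?V. s = (\<lambda>i. w i \<oplus> y \<otimes> t i)"
      by (intro bexI[of _ ?w] bexI[of _ ?t]) auto
  qed
  show ?case
  proof
    fix s assume s: "s \<in> V"
    obtain w where w: "w \<in> W" "s n = w n"
      using proj[OF s] by blast
    have c: "s i \<in> carrier R" "w i \<in> carrier R" for i
      using DV(1)[OF s] DW(1)[OF w(1)] by auto
    have "(\<lambda>i. s i \<ominus> w i) \<in> ?V"
      using DV(5)[OF s] w Suc.prems(3) c(2)[of n] by (auto simp: minus_eq r_neg)
    then have "(\<lambda>i. s i \<ominus> w i) \<in> W"
      using \<open>?V \<subseteq> ?W\<close> by blast
    from DW(3)[OF this w(1)] have "(\<lambda>i. (s i \<ominus> w i) \<oplus> w i) \<in> W" .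
    moreover have "(s i \<ominus> w i) \<oplus> w i = s i" for i
      using c[of i] by algebra
    ultimately show "s \<in> W"
      by simp
  qed
qed

lemma tensor_kernel_sum:
  assumes M: "module R M" and N: "module R N" and "\<And>i. i < (n::nat) \<Longrightarrow> g i \<in> tensor_kernel R M N"
  shows "(\<Sum>i<n. g i) \<in> tensor_kernel R M N"
  using assms(3) by (induction n) (auto intro: tensor_kernel_props[OF M N])

definition tensor_combination :: "'m list \<Rightarrow> (nat \<Rightarrow> 'n) \<Rightarrow> ('m \<times> 'n \<Rightarrow>\<^sub>0 int)" where
  "tensor_combination as s = (\<Sum>i<length as. frag_of (as ! i, s i))"

lemma tensor_combination_keys:
  assumes "\<And>i. s i \<in> T"
  shows "Poly_Mapping.keys (tensor_combination as s) \<subseteq> set as \<times> T"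
  using keys_sum[of "\<lambda>i. frag_of (as ! i, s i)" "{..<length as}"] assms
  by (fastforce simp: tensor_combination_def)

context ring_hom_cring
begin

context
  fixes as I
  assumes I: "ideal I R" and as: "set as \<subseteq> I"
begin

lemma generator_mem: "i < length as \<Longrightarrow> as ! i \<in> I"
  using as nth_mem by blast

lemma ideal_is_module: "module R (ideal_module R I)"
  by (rule ideal_module_module[OF R.is_cring I])

lemma combination_add:
  assumes "\<And>i. s i \<in> carrier S" "\<And>i. t i \<in> carrier S"
  shows "tensor_combination as (\<lambda>i. s i \<oplus>\<^bsub>S\<^esub> t i) - tensor_combination as s - tensor_combination as t
    \<in> tensor_kernel R (ideal_module R I) N"
  unfolding tensor_combination_def sum_subtractf[symmetric]
  using assms generator_mem by (intro tensor_kernel_sum ideal_is_module restrict_module)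
    (use tensor_kernel_add_right[of _ "ideal_module R I" _ N _ R] in simp)

lemma combination_diff:
  assumes "\<And>i. s i \<in> carrier S" "\<And>i. t i \<in> carrier S"
  shows "tensor_combination as (\<lambda>i. s i \<ominus>\<^bsub>S\<^esub> t i) - (tensor_combination as s - tensor_combination as t)
    \<in> tensor_kernel R (ideal_module R I) N"
proof -
  have "(s i \<ominus>\<^bsub>S\<^esub> t i) \<oplus>\<^bsub>S\<^esub> t i = s i" for i
    using assms[of i] by algebra
  then have "tensor_combination as s - tensor_combination as (\<lambda>i. s i \<ominus>\<^bsub>S\<^esub> t i) - tensor_combination as t
    \<in> tensor_kernel R (ideal_module R I) N"
    using combination_add[of "\<lambda>i. s i \<ominus>\<^bsub>S\<^esub> t i" t] assms by simp
  from tensor_kernel_props(4)[OF ideal_is_module restrict_module this] show ?thesis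
    by (simp add: algebra_simps)
qed

lemma combination_zero: "tensor_combination as (\<lambda>i. \<zero>\<^bsub>S\<^esub>) \<in> tensor_kernel R (ideal_module R I) N"
  unfolding tensor_combination_def
  using generator_mem by (intro tensor_kernel_sum ideal_is_module restrict_module)
    (use tensor_kernel_zero_right[OF ideal_is_module restrict_module] in simp)

lemma combination_scale:
  "frag_map_snd (\<lambda>s. b \<otimes>\<^bsub>S\<^esub> s) (tensor_combination as s) = tensor_combination as (\<lambda>i. b \<otimes>\<^bsub>S\<^esub> s i)"
  by (simp add: tensor_combination_def frag_extend_sum)

lemma combination_multiply:
  assumes "\<And>i. s i \<in> carrier S" and x: "x \<in> carrier R"
  shows "frag_map_fst (\<lambda>a. a \<otimes> x) (tensor_combination as s) - tensor_combination as (\<lambda>i. h x \<otimes>\<^bsub>S\<^esub> s i)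
    \<in> tensor_kernel R (ideal_module R I) N"
proof -
  have "frag_map_fst (\<lambda>a. a \<otimes> x) (tensor_combination as s) = (\<Sum>i<length as. frag_of (as ! i \<otimes> x, s i))"
    by (simp add: tensor_combination_def frag_extend_sum)
  moreover have "frag_of (as ! i \<otimes> x, s i) - frag_of (as ! i, h x \<otimes>\<^bsub>S\<^esub> s i) \<in> tensor_kernel R (ideal_module R I) N"
    if "i < length as" for i
    using tensor_kernel_smult[of x R "as ! i" "ideal_module R I" "s i" N] generator_mem[OF that] assms
      R.idealD(1)[OF I generator_mem[OF that]] by (simp add: R.m_comm)
  ultimately show ?thesis
    unfolding tensor_combination_def
    by (simp add: sum_subtractf[symmetric] tensor_kernel_sum[OF ideal_is_module restrict_module])
qed

text \<open>
  The vectors \<open>s\<close> with \<open>\<Sum> a\<^sub>i \<otimes> s\<^sub>i = 0\<close> in \<open>I \<otimes> S\<close>, where the \<open>a\<^sub>i\<close> form the list \<open>as\<close>. For \<open>I = R\<close> these are the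
  syzygies of the \<open>h a\<^sub>i\<close> over \<open>S\<close>. If \<open>as\<close> generates \<open>J\<close>, the relations in \<open>R \<otimes> S\<close> modulo those in \<open>J \<otimes> S\<close>
  are \<open>Tor\<^sub>1(R/J, S)\<close>.
\<close>

definition relations :: "(nat \<Rightarrow> 'c) set" where
  "relations = {s. (\<forall>i. s i \<in> carrier S) \<and> (\<forall>i\<ge>length as. s i = \<zero>\<^bsub>S\<^esub>) \<and>
     tensor_combination as s \<in> tensor_kernel R (ideal_module R I) N}"

lemma relations_vector_module: "S.vector_module relations"
  unfolding S.vector_module_def
proof (intro conjI ballI allI)
  note T = tensor_kernel_props[OF ideal_is_module restrict_module]
  show "s i \<in> carrier S" if "s \<in> relations" for s i
    using that by (simp add: relations_def)
  show "(\<lambda>i. \<zero>\<^bsub>S\<^esub>) \<in> relations"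
    using combination_zero by (simp add: relations_def)
  show "(\<lambda>i. s i \<oplus>\<^bsub>S\<^esub> t i) \<in> relations" if "s \<in> relations" "t \<in> relations" for s t
    using that T(3)[OF T(3)[OF combination_add[of s t]], of "tensor_combination as s" "tensor_combination as t"]
    by (simp add: relations_def)
  show "(\<lambda>i. b \<otimes>\<^bsub>S\<^esub> s i) \<in> relations" if "b \<in> carrier S" "s \<in> relations" for b s
    using that tensor_kernel_functorial_right[OF ideal_is_module restrict_module restrict_module scale_linear[OF that(1)],
      of "tensor_combination as s"]
    by (simp add: relations_def combination_scale)
qed

text \<open>
  Every element of \<open>I \<otimes> S\<close> is a combination \<open>\<Sum> a\<^sub>i \<otimes> s\<^sub>i\<close> of the generators, since
  \<open>(\<Sum> r\<^sub>i a\<^sub>i) \<otimes> s = \<Sum> a\<^sub>i \<otimes> h r\<^sub>i s\<close>.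
\<close>

lemma combination_exists:
  assumes gen: "I = Idl (set as)" and c: "Poly_Mapping.keys c \<subseteq> I \<times> carrier S"
  shows "\<exists>s. (\<forall>i. s i \<in> carrier S) \<and> (\<forall>i\<ge>length as. s i = \<zero>\<^bsub>S\<^esub>) \<and>
    c - tensor_combination as s \<in> tensor_kernel R (ideal_module R I) N"
proof -
  note T = tensor_kernel_props[OF ideal_is_module restrict_module] and Td = tensor_kernel_diff[OF ideal_is_module restrict_module]
  define vec where "vec s \<longleftrightarrow> (\<forall>i. s i \<in> carrier S) \<and> (\<forall>i\<ge>length as. s i = \<zero>\<^bsub>S\<^esub>)" for s
  have vec_add: "vec (\<lambda>i. s i \<oplus>\<^bsub>S\<^esub> t i)" if "vec s" "vec t" for s t
    using that by (simp add: vec_def)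
  have vec_diff: "vec (\<lambda>i. s i \<ominus>\<^bsub>S\<^esub> t i)" if "vec s" "vec t" for s t
    using that by (simp add: vec_def S.minus_eq S.r_neg)
  have vec_zero: "vec (\<lambda>i. \<zero>\<^bsub>S\<^esub>)"
    by (simp add: vec_def)
  define D where "D = {a \<in> I. \<forall>z\<in>carrier S. \<exists>s. vec s \<and>
     frag_of (a, z) - tensor_combination as s \<in> tensor_kernel R (ideal_module R I) N}"
  have "ideal D R"
    unfolding R.ideal_iff
  proof (intro conjI ballI)
    note Ic = R.idealD[OF I]
    show "D \<subseteq> carrier R"
      using Ic(1) by (auto simp: D_def)
    show "\<zero> \<in> D"
      unfolding D_def
    proof (intro CollectI conjI ballI Ic(2))
      fix z assume z: "z \<in> carrier S"
      have "frag_of (\<zero>, z) \<in> tensor_kernel R (ideal_module R I) N"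
        using tensor_kernel_zero_left[OF ideal_is_module restrict_module] z by simp
      from Td[OF this combination_zero]
      show "\<exists>s. vec s \<and> frag_of (\<zero>, z) - tensor_combination as s \<in> tensor_kernel R (ideal_module R I) N"
        using vec_zero by blast
    qed
    show "a \<oplus> b \<in> D" if ab: "a \<in> D" "b \<in> D" for a b
      unfolding D_def
    proof (intro CollectI conjI ballI)
      have abI: "a \<in> I" "b \<in> I"
        using ab by (auto simp: D_def)
      then show "a \<oplus> b \<in> I"
        by (rule Ic(3))
      fix z assume z: "z \<in> carrier S"
      obtain s t where s: "vec s" "frag_of (a, z) - tensor_combination as s \<in> tensor_kernel R (ideal_module R I) N"
        and t: "vec t" "frag_of (b, z) - tensor_combination as t \<in> tensor_kernel R (ideal_module R I) N"
        using ab z unfolding D_def by blast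
      have 1: "frag_of (a \<oplus> b, z) - frag_of (a, z) - frag_of (b, z) \<in> tensor_kernel R (ideal_module R I) N"
        using tensor_kernel_add_left[of a "ideal_module R I" b z N R] abI z by simp
      have 2: "tensor_combination as (\<lambda>i. s i \<oplus>\<^bsub>S\<^esub> t i) - tensor_combination as s - tensor_combination as t
          \<in> tensor_kernel R (ideal_module R I) N"
        using s(1) t(1) by (intro combination_add) (auto simp: vec_def)
      from Td[OF T(3)[OF T(3)[OF 1 s(2)] t(2)] 2]
      have "frag_of (a \<oplus> b, z) - tensor_combination as (\<lambda>i. s i \<oplus>\<^bsub>S\<^esub> t i) \<in> tensor_kernel R (ideal_module R I) N"
        by (simp add: algebra_simps)
      then show "\<exists>s. vec s \<and> frag_of (a \<oplus> b, z) - tensor_combination as s \<in> tensor_kernel R (ideal_module R I) N"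
        using vec_add[OF s(1) t(1)] by blast
    qed
    show "r \<otimes> a \<in> D" if a: "a \<in> D" and r: "r \<in> carrier R" for a r
      unfolding D_def
    proof (intro CollectI conjI ballI)
      have aI: "a \<in> I"
        using a by (auto simp: D_def)
      then show "r \<otimes> a \<in> I"
        using r by (rule Ic(4))
      fix z assume z: "z \<in> carrier S"
      then have "h r \<otimes>\<^bsub>S\<^esub> z \<in> carrier S"
        using r by simp
      then obtain s where s: "vec s" "frag_of (a, h r \<otimes>\<^bsub>S\<^esub> z) - tensor_combination as s \<in> tensor_kernel R (ideal_module R I) N"
        using a unfolding D_def by blast
      have 1: "frag_of (r \<otimes> a, z) - frag_of (a, h r \<otimes>\<^bsub>S\<^esub> z) \<in> tensor_kernel R (ideal_module R I) N"
        using tensor_kernel_smult[of r R a "ideal_module R I" z N] aI r z by simp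
      from T(3)[OF 1 s(2)] s(1)
      show "\<exists>s. vec s \<and> frag_of (r \<otimes> a, z) - tensor_combination as s \<in> tensor_kernel R (ideal_module R I) N"
        by auto
    qed
  qed
  moreover have "set as \<subseteq> D"
  proof
    fix a assume "a \<in> set as"
    then obtain j where j: "j < length as" "a = as ! j"
      by (auto simp: in_set_conv_nth)
    have "\<exists>s. vec s \<and> frag_of (a, z) - tensor_combination as s \<in> tensor_kernel R (ideal_module R I) N"
      if z: "z \<in> carrier S" for z
    proof -
      let ?s = "\<lambda>i. if i = j then z else \<zero>\<^bsub>S\<^esub>"
      have "frag_of (a, z) = (\<Sum>i<length as. if i = j then frag_of (as ! i, z) else 0)"
        using j by simp
      then have "tensor_combination as ?s - frag_of (a, z) =
          (\<Sum>i<length as. frag_of (as ! i, ?s i) - (if i = j then frag_of (as ! i, z) else 0))"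
        by (simp add: tensor_combination_def sum_subtractf)
      also have "\<dots> \<in> tensor_kernel R (ideal_module R I) N"
        using tensor_kernel_zero_right[OF ideal_is_module restrict_module] generator_mem T(2)
        by (intro tensor_kernel_sum ideal_is_module restrict_module) simp
      finally have "frag_of (a, z) - tensor_combination as ?s \<in> tensor_kernel R (ideal_module R I) N"
        using T(4) by fastforce
      moreover have "vec ?s"
        using z j by (simp add: vec_def)
      ultimately show ?thesis by blast
    qed
    then show "a \<in> D"
      using generator_mem[OF j(1)] j(2) by (simp add: D_def)
  qed
  ultimately have ID: "I \<subseteq> D"
    unfolding gen by (rule R.genideal_minimal)
  have "\<exists>s. vec s \<and> c - tensor_combination as s \<in> tensor_kernel R (ideal_module R I) N"
  proof (rule free_Abelian_group_induct[OF c])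
    show "\<exists>s. vec s \<and> 0 - tensor_combination as s \<in> tensor_kernel R (ideal_module R I) N"
      using Td[OF T(2) combination_zero] vec_zero by blast
    show "\<exists>s. vec s \<and> frag_of p - tensor_combination as s \<in> tensor_kernel R (ideal_module R I) N"
      if "p \<in> I \<times> carrier S" for p
      using that ID by (auto simp: D_def)
    fix c d
    assume "\<exists>s. vec s \<and> c - tensor_combination as s \<in> tensor_kernel R (ideal_module R I) N"
      "\<exists>s. vec s \<and> d - tensor_combination as s \<in> tensor_kernel R (ideal_module R I) N"
    then obtain s t where s: "vec s" "c - tensor_combination as s \<in> tensor_kernel R (ideal_module R I) N"
      and t: "vec t" "d - tensor_combination as t \<in> tensor_kernel R (ideal_module R I) N"
      by blast
    have "tensor_combination as (\<lambda>i. s i \<ominus>\<^bsub>S\<^esub> t i) - (tensor_combination as s - tensor_combination as t)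
        \<in> tensor_kernel R (ideal_module R I) N"
      using s(1) t(1) by (intro combination_diff) (auto simp: vec_def)
    from Td[OF Td[OF s(2) t(2)] this]
    have "c - d - tensor_combination as (\<lambda>i. s i \<ominus>\<^bsub>S\<^esub> t i) \<in> tensor_kernel R (ideal_module R I) N"
      by (simp add: algebra_simps)
    then show "\<exists>s. vec s \<and> c - d - tensor_combination as s \<in> tensor_kernel R (ideal_module R I) N"
      using vec_diff[OF s(1) t(1)] by blast
  qed
  then show ?thesis
    by (auto simp: vec_def)
qed

end

text \<open>
  As \<open>I\<close> is prime and \<open>x \<notin> I\<close>, the ideal \<open>(I : x)\<close> is \<open>I\<close>. By hypothesis a tensor in \<open>I \<otimes> S\<close> that vanishes
  in \<open>R \<otimes> S\<close> vanishes in \<open>(I + (x)) \<otimes> S\<close>, so by the exact sequence of \<open>tensor_kernel_adjoin\<close> it is \<open>x\<close> times another such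
  tensor. Thus \<open>Tor\<^sub>1(R/I, S) = x Tor\<^sub>1(R/I, S)\<close>. Written with the coordinates of a generating list of \<open>I\<close>, this is
  the hypothesis of Nakayama's lemma for the submodules of relations.
\<close>

lemma tor_vanishes_prime_step:
  assumes S: "noetherian_ring S" and n: "primeideal n S" "\<And>t. t \<in> carrier S \<Longrightarrow> t \<notin> n \<Longrightarrow> t \<in> Units S"
    and I: "primeideal I R" and as: "set as \<subseteq> carrier R" "I = Idl (set as)"
    and x: "x \<in> carrier R" "x \<notin> I" "h x \<in> n" and tor: "tor_vanishes R N (R.adjoin I x)"
  shows "tor_vanishes R N I"
  unfolding tor_vanishes_def
proof (intro allI impI)
  interpret S: noetherian_cring S
    by (intro noetherian_cring.intro S S.is_cring)
  let ?RR = "ideal_module R (carrier R)"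
  have Ii: "ideal I R"
    by (rule R.prime_proper(1)[OF I])
  have asI: "set as \<subseteq> I"
    unfolding as(2) by (rule R.genideal_self[OF as(1)])
  note N = restrict_module and modI = ideal_is_module[OF Ii asI] and adj = R.adjoin_ideal[OF Ii x(1)] R.adjoin_subset[OF Ii x(1)]
  have modR: "module R ?RR"
    by (rule ideal_module_module[OF R.is_cring R.oneideal])
  note T = tensor_kernel_props[OF modI N] and Td = tensor_kernel_diff[OF modI N]
  have IR: "d \<in> tensor_kernel R ?RR N" if "d \<in> tensor_kernel R (ideal_module R I) N" for d
    using tensor_kernel_mono[of R I ?RR "carrier R" N d] modI modR N that R.idealD(1)[OF Ii] by auto
  let ?V = "relations as (carrier R)" and ?W = "relations as I"
  have dec: "\<exists>w\<in>?W. \<exists>t\<in>?V. s = (\<lambda>i. w i \<oplus>\<^bsub>S\<^esub> h x \<otimes>\<^bsub>S\<^esub> t i)" if s: "s \<in> ?V" for s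
  proof -
    have s': "\<And>i. s i \<in> carrier S" "\<And>i. i \<ge> length as \<Longrightarrow> s i = \<zero>\<^bsub>S\<^esub>"
      "tensor_combination as s \<in> tensor_kernel R ?RR N"
      using s by (auto simp: relations_def[OF R.oneideal as(1)])
    have kI: "Poly_Mapping.keys (tensor_combination as s) \<subseteq> I \<times> carrier N"
      using tensor_combination_keys[of s "carrier S" as] s'(1) asI by auto
    then have "Poly_Mapping.keys (tensor_combination as s) \<subseteq> R.adjoin I x \<times> carrier N"
      using adj(2) by blast
    then have "tensor_combination as s \<in> tensor_kernel R (?RR\<lparr>carrier := adjoin_submodule R ?RR I x\<rparr>) N"
      using tor s'(3) by (simp add: tor_vanishes_def R.adjoin_submodule_ideal)
    from tensor_kernel_adjoin[OF modR N ideal_submodule[OF R.is_cring Ii] _ kI this]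
    obtain e where e: "Poly_Mapping.keys e \<subseteq> R.colon I x \<times> carrier S" "e \<in> tensor_kernel R ?RR N"
      "tensor_combination as s - frag_map_fst (\<lambda>a. a \<otimes> x) e \<in> tensor_kernel R (ideal_module R I) N"
      using x(1) by (auto simp: R.adjoin_submodule_ideal)
    have "R.colon I x \<subseteq> I"
      using R.prime_mult_notin[OF I _ x(1) _ x(2)] by (auto simp: R.colon_def)
    then have "Poly_Mapping.keys e \<subseteq> I \<times> carrier S"
      using e(1) by blast
    from combination_exists[OF Ii asI as(2) this]
    obtain t where t: "\<And>i. t i \<in> carrier S" "\<And>i. i \<ge> length as \<Longrightarrow> t i = \<zero>\<^bsub>S\<^esub>"
      "e - tensor_combination as t \<in> tensor_kernel R (ideal_module R I) N"
      by blast
    have "tensor_combination as t \<in> tensor_kernel R ?RR N"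
      using tensor_kernel_diff[OF modR N e(2) IR[OF t(3)]] by simp
    then have tV: "t \<in> ?V"
      using t by (simp add: relations_def[OF R.oneideal as(1)])
    have "linear_map R (ideal_module R I) (ideal_module R I) (\<lambda>a. a \<otimes> x)"
      using x(1) R.idealD[OF Ii] by (auto simp: linear_map_def R.l_distr R.m_assoc)
    from tensor_kernel_functorial[OF modI modI N this t(3)]
    have 1: "frag_map_fst (\<lambda>a. a \<otimes> x) e - frag_map_fst (\<lambda>a. a \<otimes> x) (tensor_combination as t)
        \<in> tensor_kernel R (ideal_module R I) N"
      by (simp add: frag_extend_diff)
    have "frag_map_fst (\<lambda>a. a \<otimes> x) (tensor_combination as t) - tensor_combination as (\<lambda>i. h x \<otimes>\<^bsub>S\<^esub> t i)
        \<in> tensor_kernel R (ideal_module R I) N"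
      using t(1) x(1) by (rule combination_multiply[OF Ii asI])
    from T(3)[OF T(3)[OF e(3) 1] this]
    have 2: "tensor_combination as s - tensor_combination as (\<lambda>i. h x \<otimes>\<^bsub>S\<^esub> t i) \<in> tensor_kernel R (ideal_module R I) N"
      by (simp add: algebra_simps)
    let ?w = "\<lambda>i. s i \<ominus>\<^bsub>S\<^esub> h x \<otimes>\<^bsub>S\<^esub> t i"
    have "tensor_combination as ?w - (tensor_combination as s - tensor_combination as (\<lambda>i. h x \<otimes>\<^bsub>S\<^esub> t i))
        \<in> tensor_kernel R (ideal_module R I) N"
      using s'(1) t(1) x(1) by (intro combination_diff[OF Ii asI]) auto
    from T(3)[OF this 2] have "tensor_combination as ?w \<in> tensor_kernel R (ideal_module R I) N"
      by simp
    moreover have "?w i \<in> carrier S" for i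
      using s'(1) t(1) x(1) by simp
    moreover have "?w i = \<zero>\<^bsub>S\<^esub>" if "i \<ge> length as" for i
      using s'(2)[OF that] t(2)[OF that] x(1) by (simp add: S.minus_eq)
    ultimately have "?w \<in> ?W"
      by (simp add: relations_def[OF Ii asI])
    moreover have "s = (\<lambda>i. ?w i \<oplus>\<^bsub>S\<^esub> h x \<otimes>\<^bsub>S\<^esub> t i)"
    proof
      fix i
      have "h x \<in> carrier S" using x(1) by simp
      then show "s i = ?w i \<oplus>\<^bsub>S\<^esub> h x \<otimes>\<^bsub>S\<^esub> t i"
        using s'(1)[of i] t(1)[of i] by algebra
    qed
    ultimately show ?thesis
      using tV by (intro bexI[of _ ?w] bexI[of _ t])
  qed
  have VW: "?V \<subseteq> ?W"
  proof (rule S.nakayama_vectors[OF n x(3) relations_vector_module[OF R.oneideal as(1)]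
      relations_vector_module[OF Ii asI]])
    show "?W \<subseteq> ?V"
      using IR by (auto simp: relations_def[OF Ii asI] relations_def[OF R.oneideal as(1)])
    show "s i = \<zero>\<^bsub>S\<^esub>" if "s \<in> ?V" "length as \<le> i" for s i
      using that by (simp add: relations_def[OF R.oneideal as(1)])
    show "\<exists>w\<in>?W. \<exists>t\<in>?V. s = (\<lambda>i. w i \<oplus>\<^bsub>S\<^esub> h x \<otimes>\<^bsub>S\<^esub> t i)" if "s \<in> ?V" for s
      using that by (rule dec)
  qed
  fix c assume c: "Poly_Mapping.keys c \<subseteq> I \<times> carrier N" "c \<in> tensor_kernel R ?RR N"
  then have "Poly_Mapping.keys c \<subseteq> I \<times> carrier S" by simp
  from combination_exists[OF Ii asI as(2) this]
  obtain s where s: "\<And>i. s i \<in> carrier S" "\<And>i. i \<ge> length as \<Longrightarrow> s i = \<zero>\<^bsub>S\<^esub>"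
    "c - tensor_combination as s \<in> tensor_kernel R (ideal_module R I) N"
    by blast
  have "tensor_combination as s \<in> tensor_kernel R ?RR N"
    using tensor_kernel_diff[OF modR N c(2) IR[OF s(3)]] by simp
  then have "s \<in> ?V"
    using s by (simp add: relations_def[OF R.oneideal as(1)])
  then have "tensor_combination as s \<in> tensor_kernel R (ideal_module R I) N"
    using VW by (auto simp: relations_def[OF Ii asI])
  from T(3)[OF s(3) this] show "c \<in> tensor_kernel R (ideal_module R I) N"
    by simp
qed

end

section \<open>Regular local rings\<close>

lemma (in cring) genideal_insert_adjoin:
  assumes "Y \<subseteq> carrier R" "y \<in> carrier R"
  shows "Idl (insert y Y) = adjoin (Idl Y) y"
proof
  note I = genideal_ideal[OF assms(1)]
  note adj = adjoin_ideal[OF I assms(2)] adjoin_subset[OF I assms(2)]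
  show "Idl (insert y Y) \<subseteq> adjoin (Idl Y) y"
    using adj genideal_self[OF assms(1)] by (intro genideal_minimal) auto
  have 1: "ideal (Idl (insert y Y)) R" "insert y Y \<subseteq> Idl (insert y Y)"
    using assms by (intro genideal_ideal genideal_self; simp)+
  show "adjoin (Idl Y) y \<subseteq> Idl (insert y Y)"
    using 1 by (intro adjoin_least genideal_minimal) auto
qed

lemma (in cring) genideal_empty: "Idl {} = {\<zero>}"
  using genideal_minimal[OF zeroideal, of "{}"] idealD(2)[OF genideal_ideal[of "{}"]] by auto

lemma (in ring_hom_cring) genideal_image:
  assumes Y: "Y \<subseteq> carrier R"
  shows "Idl\<^bsub>S\<^esub> (h ` (Idl Y)) = Idl\<^bsub>S\<^esub> (h ` Y)"
proof
  note I = R.genideal_ideal[OF Y] and self = R.genideal_self[OF Y]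
  have hX: "h ` Y \<subseteq> carrier S" "h ` (Idl Y) \<subseteq> carrier S"
    using Y R.idealD(1)[OF I] by auto
  note J = S.genideal_ideal[OF hX(1)]
  have "ideal {a \<in> carrier R. h a \<in> Idl\<^bsub>S\<^esub> (h ` Y)} R"
    unfolding R.ideal_iff using S.idealD[OF J] by auto
  moreover have "Y \<subseteq> {a \<in> carrier R. h a \<in> Idl\<^bsub>S\<^esub> (h ` Y)}"
    using Y S.genideal_self[OF hX(1)] by auto
  ultimately have "Idl Y \<subseteq> {a \<in> carrier R. h a \<in> Idl\<^bsub>S\<^esub> (h ` Y)}"
    by (rule R.genideal_minimal)
  then show "Idl\<^bsub>S\<^esub> (h ` (Idl Y)) \<subseteq> Idl\<^bsub>S\<^esub> (h ` Y)"
    by (intro S.genideal_minimal[OF J]) auto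
  show "Idl\<^bsub>S\<^esub> (h ` Y) \<subseteq> Idl\<^bsub>S\<^esub> (h ` (Idl Y))"
    using self S.genideal_self[OF hX(2)] by (intro S.genideal_minimal S.genideal_ideal hX) auto
qed

lemma local_ring_prime_units:
  fixes R (structure)
  assumes "noetherian_ring R" "local_ring R m"
  shows "primeideal m R" "\<And>t. t \<in> carrier R \<Longrightarrow> t \<notin> m \<Longrightarrow> t \<in> Units R"
proof -
  interpret cring R
    using assms(2) by (simp add: local_ring_def)
  interpret noetherian_cring R
    by (intro noetherian_cring.intro assms(1) is_cring)
  show "primeideal m R"
    using assms(2) by (intro maximalideal_prime) (simp add: local_ring_def)
  fix t assume t: "t \<in> carrier R" "t \<notin> m"
  show "t \<in> Units R"
  proof (rule ccontr)
    assume nu: "t \<notin> Units R"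
    let ?\<I> = "{I. ideal I R \<and> t \<in> I \<and> \<one> \<notin> I}"
    have P: "ideal (adjoin {\<zero>} t) R" "t \<in> adjoin {\<zero>} t"
      using adjoin_ideal[OF zeroideal t(1)] adjoin_subset[OF zeroideal t(1)] by auto
    have "\<one> \<notin> adjoin {\<zero>} t"
    proof
      assume "\<one> \<in> adjoin {\<zero>} t"
      then obtain r where r: "r \<in> carrier R" "\<one> = r \<otimes> t"
        using t by (auto elim!: adjoinE)
      then have "t \<in> Units R"
        using t by (auto simp: Units_def m_comm intro!: bexI[of _ r])
      with nu show False ..
    qed
    with P have "?\<I> \<noteq> {}" by blast
    moreover have "?\<I> \<subseteq> {I. ideal I R}" by blast
    ultimately have "\<exists>M\<in>?\<I>. \<forall>J\<in>?\<I>. M \<subseteq> J \<longrightarrow> J = M"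
      by (rule ideal_maximal)
    then obtain M where M0: "M \<in> ?\<I>" "\<forall>J\<in>?\<I>. M \<subseteq> J \<longrightarrow> J = M"
      by (rule bexE)
    have "maximalideal M R"
    proof (rule maximalidealI)
      show "ideal M R" "carrier R \<noteq> M"
        using M0(1) by auto
      fix J assume J: "ideal J R" "M \<subseteq> J" "J \<subseteq> carrier R"
      show "J = M \<or> J = carrier R"
      proof (cases "\<one> \<in> J")
        case True
        then show ?thesis
          using ideal.one_imp_carrier[OF J(1)] by simp
      next
        case False
        then have "J \<in> ?\<I>"
          using J M0(1) by blast
        then show ?thesis
          using M0(2) J(2) by blast
      qed
    qed
    then have "M = m"
      using assms(2) by (simp add: local_ring_def)
    then show False
      using M0(1) t by blast
  qed
qed

lemma krull_dim_attained:
  assumes "krull_dim R = enat d" "primeideal m R"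
  obtains P where "\<And>i. i \<le> d \<Longrightarrow> primeideal (P i) R" "\<And>i. i < d \<Longrightarrow> P i \<subset> P (Suc i)"
proof -
  let ?C = "{enat n | n. \<exists>P. (\<forall>i\<le>n. primeideal (P i) R) \<and> (\<forall>i<n. P i \<subset> P (Suc i))}"
  have "enat 0 \<in> ?C"
    using assms(2) by (intro CollectI exI[of _ 0]) auto
  then have ne: "?C \<noteq> {}" by blast
  have sup: "Sup ?C = enat d"
    using assms(1) by (simp add: krull_dim_def)
  then have "finite ?C"
    using ne by (auto simp: Sup_enat_def split: if_splits)
  moreover from this have "Sup ?C = Max ?C"
    using ne by (simp only: Sup_enat_def if_False if_True)
  ultimately have "Sup ?C \<in> ?C"
    using ne Max_in[of ?C] by simp
  then show ?thesis
    using sup that by auto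
qed

text \<open>
  The generators attain the bound on the length of chains of primes, so this is the equality case of
  \<open>prime_chain_bound\<close> with \<open>I = 0\<close>.
\<close>

theorem regular_system_of_parameters:
  fixes R (structure)
  assumes reg: "regular_local_ring R m" and xs: "set xs \<subseteq> carrier R" "Idl\<^bsub>R\<^esub> (set xs) = m"
    and dim: "krull_dim R = enat (length xs)" and k: "k < length xs"
  shows "primeideal (Idl\<^bsub>R\<^esub> (set (take k xs))) R" "xs ! k \<notin> Idl\<^bsub>R\<^esub> (set (take k xs))"
proof -
  have noeth: "noetherian_ring R" and loc: "local_ring R m"
    using reg by (auto simp: regular_local_ring_def)
  interpret cring R
    using loc by (simp add: local_ring_def)
  interpret noetherian_cring R
    by (intro noetherian_cring.intro noeth is_cring)
  note m = local_ring_prime_units[OF noeth loc]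
  obtain P where P: "\<And>i. i \<le> length xs \<Longrightarrow> primeideal (P i) R" "\<And>i. i < length xs \<Longrightarrow> P i \<subset> P (Suc i)"
    using krull_dim_attained[OF dim m(1)] by blast
  have zero: "Idl ({\<zero>} \<union> Y) = Idl Y" if "Y \<subseteq> carrier R" for Y
  proof
    have "\<zero> \<in> Idl Y" "Y \<subseteq> Idl Y"
      using idealD(2)[OF genideal_ideal[OF that]] genideal_self[OF that] by auto
    then show "Idl ({\<zero>} \<union> Y) \<subseteq> Idl Y"
      using genideal_ideal[OF that] by (intro genideal_minimal) auto
    show "Idl Y \<subseteq> Idl ({\<zero>} \<union> Y)"
      using genideal_self[of "{\<zero>} \<union> Y"] that by (intro genideal_minimal genideal_ideal) auto
  qed
  have gen: "Idl ({\<zero>} \<union> set xs) = m"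
    using zero[OF xs(1)] xs(2) by simp
  have P0: "{\<zero>} \<subseteq> P 0"
    using idealD(2)[OF prime_proper(1)[OF P(1)[of 0]]] by simp
  have "length xs \<le> length xs \<and> (length xs = length xs \<longrightarrow> P 0 = {\<zero>} \<and>
      (\<forall>k<length xs. primeideal (Idl ({\<zero>} \<union> set (take k xs))) R \<and> xs ! k \<notin> Idl ({\<zero>} \<union> set (take k xs))))"
    using m zeroideal xs(1) gen P P0 by (rule prime_chain_bound[where n = "length xs" and P = P])
  then have "\<forall>k<length xs. primeideal (Idl ({\<zero>} \<union> set (take k xs))) R \<and>
      xs ! k \<notin> Idl ({\<zero>} \<union> set (take k xs))"
    by simp
  moreover have "set (take k xs) \<subseteq> carrier R"
    using xs(1) set_take_subset[of k xs] by blast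
  ultimately show "primeideal (Idl (set (take k xs))) R" "xs ! k \<notin> Idl (set (take k xs))"
    using k zero by auto
qed

text \<open>
  An ideal \<open>L\<close> that is maximal among those with nonvanishing \<open>Tor\<^sub>1(R/L, S)\<close> is not the maximal ideal, since the regular
  sequence \<open>h x\<^sub>1, \<dots>, h x\<^sub>d\<close> settles \<open>m = (x\<^sub>1, \<dots>, x\<^sub>d)\<close>. Whether or not \<open>L\<close> is prime, the vanishing for larger
  ideals carries over to \<open>L\<close>, so no such ideal exists.
\<close>

theorem (in ring_hom_cring) flat_of_regular_parameters:
  assumes R: "noetherian_ring R" "local_ring R m" and S: "regular_local_ring S n"
    and xs: "set xs \<subseteq> carrier R" "Idl (set xs) = m" "Idl\<^bsub>S\<^esub> (h ` set xs) = n"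
    and dim: "krull_dim S = enat (length xs)"
  shows "flat_module R N"
proof (rule flat_module_ideal_criterion[OF restrict_module])
  interpret noetherian_cring R
    by (intro noetherian_cring.intro R(1) R.is_cring)
  have S': "noetherian_ring S" "local_ring S n"
    using S by (auto simp: regular_local_ring_def)
  note m = local_ring_prime_units[OF R] and n = local_ring_prime_units[OF S']
  note N = restrict_module
  have "tor_vanishes R N (Idl (set (take k xs)))" if "k \<le> length xs" for k
    using that
  proof (induction k)
    case 0
    then show ?case
      using R.tor_vanishes_trivial(1)[OF N] by (simp add: R.genideal_empty)
  next
    case (Suc k)
    then have k: "k < length xs" by simp
    let ?Y = "set (take k xs)"
    have Y: "?Y \<subseteq> carrier R" "xs ! k \<in> carrier R"
      using xs(1) set_take_subset[of k xs] nth_mem[OF k] by auto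
    have "take k (map h xs) = map h (take k xs)" "map h xs ! k = h (xs ! k)"
      using k by (simp_all add: take_map)
    then have prime: "primeideal (Idl\<^bsub>S\<^esub> (h ` ?Y)) S" "h (xs ! k) \<notin> Idl\<^bsub>S\<^esub> (h ` ?Y)"
      using regular_system_of_parameters[OF S, of "map h xs" k] xs dim k by (auto simp: image_subset_iff)
    have "tor_vanishes R N (R.adjoin (Idl ?Y) (xs ! k))"
    proof (rule tor_vanishes_regular_step[OF R.genideal_ideal[OF Y(1)] Y(2)])
      show "tor_vanishes R N (Idl ?Y)"
        using Suc by simp
      show "b \<in> Idl\<^bsub>S\<^esub> (h ` (Idl ?Y))"
        if "b \<in> carrier S" "h (xs ! k) \<otimes>\<^bsub>S\<^esub> b \<in> Idl\<^bsub>S\<^esub> (h ` (Idl ?Y))" for b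
        using S.prime_mult_notin[OF prime(1), of "h (xs ! k)" b] that Y(2) prime(2)
        by (auto simp: genideal_image[OF Y(1)])
    qed
    moreover have "set (take (Suc k) xs) = insert (xs ! k) ?Y"
      using k by (simp add: take_Suc_conv_app_nth)
    ultimately show ?case
      using R.genideal_insert_adjoin[OF Y] by simp
  qed
  from this[of "length xs"] have tor_m: "tor_vanishes R N m"
    using xs by simp
  fix I assume I: "ideal I R"
  show "tor_vanishes R N I"
  proof (rule ccontr)
    assume bad: "\<not> tor_vanishes R N I"
    let ?\<I> = "{I. ideal I R \<and> \<not> tor_vanishes R N I}"
    have "?\<I> \<noteq> {}"
      using I bad by blast
    moreover have "?\<I> \<subseteq> {I. ideal I R}" by blast
    ultimately have "\<exists>M\<in>?\<I>. \<forall>J\<in>?\<I>. M \<subseteq> J \<longrightarrow> J = M"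
      by (rule ideal_maximal)
    then obtain L where L0: "L \<in> ?\<I>" "\<forall>J\<in>?\<I>. L \<subseteq> J \<longrightarrow> J = L"
      by (rule bexE)
    then have L: "ideal L R" "\<not> tor_vanishes R N L"
      by auto
    have larger: "tor_vanishes R N J" if "ideal J R" "L \<subseteq> J" "a \<in> J" "a \<notin> L" for J a
      using L0(2) that by blast
    have adj: "tor_vanishes R N (R.adjoin L a)" if "a \<in> carrier R" "a \<notin> L" for a
      using R.adjoin_ideal[OF L(1) that(1)] R.adjoin_subset[OF L(1) that(1)] that(2) by (intro larger)
    show False
    proof (cases "primeideal L R")
      case True
      have "L \<subseteq> m"
        using m(2) R.prime_proper[OF True] by (rule R.prime_below_local)
      moreover have "L \<noteq> m"
        using tor_m L(2) by blast
      ultimately obtain x where x: "x \<in> m" "x \<notin> L"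
        by blast
      then have xc: "x \<in> carrier R"
        using R.idealD(1)[OF R.prime_proper(1)[OF m(1)]] by blast
      have hc: "h ` set xs \<subseteq> carrier S" "h ` m \<subseteq> carrier S"
        using xs(1) R.idealD(1)[OF R.prime_proper(1)[OF m(1)]] by auto
      have "h x \<in> n"
        using genideal_image[OF xs(1)] x(1) xs(2,3) S.genideal_self[OF hc(2)] by auto
      obtain Y where Y: "Y \<subseteq> carrier R" "finite Y" "L = Idl Y"
        using finetely_gen[OF L(1)] by blast
      then obtain as where as: "set as = Y"
        using finite_list by blast
      have "tor_vanishes R N L"
        using tor_vanishes_prime_step[OF S'(1) n True, of as x] Y as xc x(2) \<open>h x \<in> n\<close> adj[OF xc x(2)] by simp
      with L(2) show False ..
    next
      case False
      have "L \<noteq> carrier R"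
        using R.tor_vanishes_trivial(2)[OF N] L(2) by blast
      then obtain a b where ab: "a \<in> carrier R" "b \<in> carrier R" "a \<otimes> b \<in> L" "a \<notin> L" "b \<notin> L"
        using False primeidealI[OF L(1) R.is_cring] by blast
      have "L \<subseteq> R.colon L a" "b \<in> R.colon L a"
        using R.idealD[OF L(1)] ab by (auto simp: R.colon_def R.m_comm)
      then have "tor_vanishes R N (R.colon L a)"
        using R.colon_ideal[OF L(1) ab(1)] ab(5) by (intro larger)
      then have "tor_vanishes R N L"
        using adj[OF ab(1,4)] by (rule R.tor_vanishes_extension[OF N L(1) ab(1)])
      with L(2) show False ..
    qed
  qed
qed

section \<open>Purity and the limit of the maximal ideals\<close>

text \<open>
  Purity for the module \<open>R/I\<close> says that \<open>R/I \<rightarrow> R/I \<otimes> S = S/I S\<close> is injective.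
\<close>

theorem pure_hom_contraction:
  assumes pure: "pure_hom R S f" and I: "ideal I R" and x: "x \<in> carrier R" "f x \<in> Idl\<^bsub>S\<^esub> (f ` I)"
  shows "x \<in> I"
proof -
  interpret ring_hom_cring R S f
    using pure by (intro ring_hom_cring.intro ring_hom_cring_axioms.intro) (auto simp: pure_hom_def)
  interpret I: ideal I R by fact
  let ?q = "\<lambda>a. I +>\<^bsub>R\<^esub> a"
  let ?M = "restrict_scalars ?q (R Quot I)"
  have q: "?q \<in> ring_hom R (R Quot I)"
    by (rule I.rcos_ring_hom)
  have Q: "cring (R Quot I)"
    by (rule I.quotient_is_cring[OF R.is_cring])
  interpret Q: cring "R Quot I" by (rule Q)
  note N = restrict_module
  have M: "module R ?M"
    by (rule restrict_scalars_module[OF R.is_cring Q q])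
  have qc: "?q a \<in> carrier ?M" if "a \<in> carrier R" for a
    using ring_hom_closed[OF q that] by simp
  have q1: "a \<odot>\<^bsub>?M\<^esub> ?q \<one>\<^bsub>R\<^esub> = ?q a" if "a \<in> carrier R" for a
    using ring_hom_mult[OF q that R.one_closed] that by simp
  have z: "\<zero>\<^bsub>?M\<^esub> = I"
    by (simp add: FactRing_def)
  note T = tensor_kernel_props[OF M N] and Td = tensor_kernel_diff[OF M N]
  \<comment> \<open>The annihilator of \<open>1 \<otimes> 1\<close> in \<open>R/I \<otimes> S\<close>.\<close>
  define D where "D = {s \<in> carrier S. frag_of (?q \<one>\<^bsub>R\<^esub>, s) \<in> tensor_kernel R ?M N}"
  have swap: "frag_of (?q a, \<one>\<^bsub>S\<^esub>) - frag_of (?q \<one>\<^bsub>R\<^esub>, f a) \<in> tensor_kernel R ?M N" if a: "a \<in> carrier R" for a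
    using tensor_kernel_smult[OF a qc[OF R.one_closed], of "\<one>\<^bsub>S\<^esub>" N] a by (simp only: q1) simp
  have "ideal D S"
    unfolding S.ideal_iff
  proof (intro conjI ballI)
    show "D \<subseteq> carrier S"
      by (auto simp: D_def)
    show "\<zero>\<^bsub>S\<^esub> \<in> D"
      using tensor_kernel_zero_right[OF M N qc[OF R.one_closed]] by (simp add: D_def)
    show "s \<oplus>\<^bsub>S\<^esub> t \<in> D" if "s \<in> D" "t \<in> D" for s t
    proof -
      have st: "s \<in> carrier S" "t \<in> carrier S" "frag_of (?q \<one>\<^bsub>R\<^esub>, s) \<in> tensor_kernel R ?M N"
        "frag_of (?q \<one>\<^bsub>R\<^esub>, t) \<in> tensor_kernel R ?M N"
        using that by (auto simp: D_def)
      have "frag_of (?q \<one>\<^bsub>R\<^esub>, s \<oplus>\<^bsub>S\<^esub> t) - frag_of (?q \<one>\<^bsub>R\<^esub>, s) - frag_of (?q \<one>\<^bsub>R\<^esub>, t) \<in> tensor_kernel R ?M N"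
        using tensor_kernel_add_right[OF qc[OF R.one_closed], of s N t] st by simp
      from T(3)[OF T(3)[OF this st(3)] st(4)] show ?thesis
        using st by (simp add: D_def)
    qed
    show "b \<otimes>\<^bsub>S\<^esub> s \<in> D" if "s \<in> D" "b \<in> carrier S" for s b
      using tensor_kernel_functorial_right[OF M N N scale_linear[OF that(2)], of "frag_of (?q \<one>\<^bsub>R\<^esub>, s)"] that
      by (simp add: D_def)
  qed
  moreover have "f ` I \<subseteq> D"
  proof
    fix s assume "s \<in> f ` I"
    then obtain i where i: "i \<in> I" "s = f i" by blast
    have ic: "i \<in> carrier R" using I.Icarr[OF i(1)] .
    have "?q i = \<zero>\<^bsub>?M\<^esub>"
      unfolding z using R.a_rcos_zero[OF I i(1)] .
    then have "frag_of (?q i, \<one>\<^bsub>S\<^esub>) \<in> tensor_kernel R ?M N"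
      using tensor_kernel_zero_left[OF M N, of "\<one>\<^bsub>S\<^esub>"] by simp
    from Td[OF this swap[OF ic]] show "s \<in> D"
      using i ic by (simp add: D_def)
  qed
  ultimately have "Idl\<^bsub>S\<^esub> (f ` I) \<subseteq> D"
    by (rule S.genideal_minimal)
  then have "frag_of (?q \<one>\<^bsub>R\<^esub>, f x) \<in> tensor_kernel R ?M N"
    using x(2) by (auto simp: D_def)
  from T(3)[OF swap[OF x(1)] this] have "frag_of (?q x, \<one>\<^bsub>S\<^esub>) \<in> tensor_kernel R ?M N"
    by simp
  from Td[OF this tensor_kernel_zero_left[OF M N, of "\<one>\<^bsub>S\<^esub>"]]
  have "frag_of (?q x, \<one>\<^bsub>S\<^esub>) - frag_of (\<zero>\<^bsub>?M\<^esub>, \<one>\<^bsub>S\<^esub>) \<in> tensor_kernel R ?M N"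
    by simp
  then have "tensor R ?M N (?q x) \<one>\<^bsub>S\<^esub> = tensor R ?M N \<zero>\<^bsub>?M\<^esub> \<one>\<^bsub>S\<^esub>"
    by (simp only: tensor_def tensor_coset_eq_iff[OF M N])
  moreover have "\<zero>\<^bsub>?M\<^esub> \<in> carrier ?M"
    by simp
  ultimately have "?q x = \<zero>\<^bsub>?M\<^esub>"
    using pure_hom_inj[OF pure M] qc[OF x(1)] by (meson inj_onD)
  then show "x \<in> I"
    unfolding z using I.rcos_const_imp_mem[OF x(1)] by blast
qed

context ring_direct_system
begin

lemma hom_cring: "(i, j) \<in> r \<Longrightarrow> ring_hom_cring (A i) (A j) (f i j)"
  using index_mem[of i j] rings homs
  by (intro ring_hom_cring.intro ring_hom_cring_axioms.intro) auto

lemma genideal_trans: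
  assumes "(i, j) \<in> r" "(j, k) \<in> r" "Y \<subseteq> carrier (A i)"
  shows "Idl\<^bsub>A k\<^esub> (f j k ` (Idl\<^bsub>A j\<^esub> (f i j ` Y))) = Idl\<^bsub>A k\<^esub> (f i k ` Y)"
proof -
  interpret ring_hom_cring "A j" "A k" "f j k"
    by (rule hom_cring[OF assms(2)])
  have "f j k ` f i j ` Y = f i k ` Y"
    using trans_comp[OF assms(1,2)] assms(3) by (force simp: image_image)
  moreover have "f i j ` Y \<subseteq> carrier (A j)"
    using trans_closed[OF assms(1)] assms(3) by blast
  ultimately show ?thesis
    using genideal_image by simp
qed

text \<open>
  The index set \<open>K\<close> is closed upwards. It is all of \<open>\<Gamma>\<close> for the limit of the maximal ideals, and the set of indices above a
  given one for the extension of an ideal to the limit.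
\<close>

lemma limit_ideal:
  assumes ideals: "\<And>k. k \<in> K \<Longrightarrow> ideal (J k) (A k)"
    and trans: "\<And>k n. (k, n) \<in> r \<Longrightarrow> k \<in> K \<Longrightarrow> n \<in> K \<and> f k n ` J k \<subseteq> J n" and K: "K \<subseteq> \<Gamma>" "K \<noteq> {}"
  shows "ideal {cls k y | k y. k \<in> K \<and> y \<in> J k} (direct_limit \<Gamma> r A f)" (is "ideal ?E ?L")
proof -
  interpret L: cring ?L by (rule direct_limit_cring)
  have E: "cls k y \<in> ?E" if "k \<in> K" "y \<in> J k" for k y
    using that by blast
  have car: "y \<in> carrier (A k)" if "k \<in> K" "y \<in> J k" for k y
    using cring.idealD(1)[OF rings ideals[OF that(1)] that(2)] that(1) K by blast
  show ?thesis
    unfolding L.ideal_iff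
  proof (intro conjI ballI)
    show "?E \<subseteq> carrier ?L"
      using car K unfolding direct_limit_carrier by blast
    obtain k where k: "k \<in> K" using K by blast
    then have kG: "k \<in> \<Gamma>" using K by blast
    show "\<zero>\<^bsub>?L\<^esub> \<in> ?E"
      unfolding direct_limit_one_zero(2)[OF kG] by (rule E[OF k cring.idealD(2)[OF rings[OF kG] ideals[OF k]]])
  next
    fix U V assume "U \<in> ?E" "V \<in> ?E"
    then obtain i x j y where *: "i \<in> K" "x \<in> J i" "U = cls i x" "j \<in> K" "y \<in> J j" "V = cls j y"
      by blast
    then have G: "i \<in> \<Gamma>" "j \<in> \<Gamma>" using K by auto
    obtain k where k: "k \<in> \<Gamma>" "(i, k) \<in> r" "(j, k) \<in> r"
      using directed[OF G] by blast
    have kK: "k \<in> K" and mem: "f i k x \<in> J k" "f j k y \<in> J k"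
      using trans[OF k(2) *(1)] trans[OF k(3) *(4)] * by auto
    have "U = cls k (f i k x)" "V = cls k (f j k y)"
      using limit_class_trans[OF k(2) car[OF *(1,2)]] limit_class_trans[OF k(3) car[OF *(4,5)]] * by auto
    then have "U \<oplus>\<^bsub>?L\<^esub> V = cls k (f i k x \<oplus>\<^bsub>A k\<^esub> f j k y)"
      using direct_limit_ops(2)[OF k(1) car[OF kK mem(1)] car[OF kK mem(2)]] by simp
    then show "U \<oplus>\<^bsub>?L\<^esub> V \<in> ?E"
      using E[OF kK cring.idealD(3)[OF rings[OF k(1)] ideals[OF kK] mem]] by simp
  next
    fix U V assume "U \<in> ?E" "V \<in> carrier ?L"
    then obtain i x j y where *: "i \<in> K" "x \<in> J i" "U = cls i x" "j \<in> \<Gamma>" "y \<in> carrier (A j)" "V = cls j y"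
      unfolding direct_limit_carrier by blast
    then have G: "i \<in> \<Gamma>" "j \<in> \<Gamma>" using K by auto
    obtain k where k: "k \<in> \<Gamma>" "(i, k) \<in> r" "(j, k) \<in> r"
      using directed[OF G] by blast
    have kK: "k \<in> K" and mem: "f i k x \<in> J k" "f j k y \<in> carrier (A k)"
      using trans[OF k(2) *(1)] trans_closed[OF k(3) *(5)] * by auto
    have "U = cls k (f i k x)" "V = cls k (f j k y)"
      using limit_class_trans[OF k(2) car[OF *(1,2)]] limit_class_trans[OF k(3) *(5)] * by auto
    then have "V \<otimes>\<^bsub>?L\<^esub> U = cls k (f j k y \<otimes>\<^bsub>A k\<^esub> f i k x)"
      using direct_limit_ops(1)[OF k(1) mem(2) car[OF kK mem(1)]] by simp
    then show "V \<otimes>\<^bsub>?L\<^esub> U \<in> ?E"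
      using E[OF kK cring.idealD(4)[OF rings[OF k(1)] ideals[OF kK] mem]] by simp
  qed
qed

lemma common_index:
  assumes "finite U" "\<And>u. u \<in> U \<Longrightarrow> \<exists>i\<in>\<Gamma>. \<exists>x\<in>m i. u = cls i x"
    and m: "\<And>i. i \<in> \<Gamma> \<Longrightarrow> m i \<subseteq> carrier (A i)" "\<And>i j. (i, j) \<in> r \<Longrightarrow> f i j ` m i \<subseteq> m j"
  shows "\<exists>l\<in>\<Gamma>. \<forall>u\<in>U. \<exists>x\<in>m l. u = cls l x"
  using assms(1,2)
proof (induction U)
  case empty
  then show ?case using nonempty by auto
next
  case (insert u U)
  obtain l where l: "l \<in> \<Gamma>" "\<forall>u\<in>U. \<exists>x\<in>m l. u = cls l x"
    using insert by auto
  obtain i x where i: "i \<in> \<Gamma>" "x \<in> m i" "u = cls i x"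
    using insert.prems by blast
  obtain k where k: "k \<in> \<Gamma>" "(l, k) \<in> r" "(i, k) \<in> r"
    using directed[OF l(1) i(1)] by blast
  have move: "\<exists>y\<in>m k. cls j z = cls k y" if "(j, k) \<in> r" "j \<in> \<Gamma>" "z \<in> m j" for j z
    using limit_class_trans[OF that(1), of z] m(1)[OF that(2)] m(2)[OF that(1)] that(3) by blast
  have "\<exists>x\<in>m k. v = cls k x" if "v \<in> insert u U" for v
    using that l(2) i(2,3) move[OF k(2) l(1)] move[OF k(3) i(1,2)] by (elim insertE) auto
  then show ?case
    using k(1) by blast
qed

text \<open>
  Let the generators of the limit of the \<open>m\<^sub>i\<close> come from \<open>m\<^sub>l\<close>. An element of \<open>m\<^sub>j\<close> then lies in the extension
  of \<open>m\<^sub>l\<close> to the limit, hence in its extension to \<open>A\<^sub>n\<close> for some \<open>n \<ge> j\<close>, and by purity of \<open>A\<^sub>j \<rightarrow> A\<^sub>n\<close> in its extension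
  to \<open>A\<^sub>j\<close>.
\<close>

theorem maximal_ideals_eventually_extended:
  assumes pure: "\<And>i j. (i, j) \<in> r \<Longrightarrow> pure_hom (A i) (A j) (f i j)"
    and m: "\<And>i. i \<in> \<Gamma> \<Longrightarrow> ideal (m i) (A i)" "\<And>i j. (i, j) \<in> r \<Longrightarrow> f i j ` m i \<subseteq> m j"
    and noeth: "noetherian_ring (direct_limit \<Gamma> r A f)"
  shows "\<exists>l\<in>\<Gamma>. \<forall>j. (l, j) \<in> r \<longrightarrow> m j = Idl\<^bsub>A j\<^esub> (f l j ` m l)"
proof -
  let ?L = "direct_limit \<Gamma> r A f"
  interpret L: noetherian_ring ?L by (rule noeth)
  have mc: "m i \<subseteq> carrier (A i)" if "i \<in> \<Gamma>" for i
    using cring.idealD(1)[OF rings[OF that] m(1)[OF that]] by blast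
  let ?M = "{cls i x | i x. i \<in> \<Gamma> \<and> x \<in> m i}"
  have "ideal ?M ?L"
    using m index_mem nonempty by (intro limit_ideal) auto
  then obtain U where U: "U \<subseteq> carrier ?L" "finite U" "?M = Idl\<^bsub>?L\<^esub> U"
    using L.finetely_gen by blast
  have "U \<subseteq> ?M"
    unfolding U(3) by (rule L.genideal_self[OF U(1)])
  then have "\<exists>i\<in>\<Gamma>. \<exists>x\<in>m i. u = cls i x" if "u \<in> U" for u
    using that by blast
  from common_index[OF U(2) this mc m(2)] have "\<exists>l\<in>\<Gamma>. \<forall>u\<in>U. \<exists>x\<in>m l. u = cls l x"
    by blast
  then obtain l where l: "l \<in> \<Gamma>" "\<And>u. u \<in> U \<Longrightarrow> \<exists>x\<in>m l. u = cls l x"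
    by blast
  have "m j = Idl\<^bsub>A j\<^esub> (f l j ` m l)" if lj: "(l, j) \<in> r" for j
  proof
    have j: "j \<in> \<Gamma>" using index_mem[OF lj] by blast
    interpret Aj: cring "A j" by (rule rings[OF j])
    have gc: "f l k ` m l \<subseteq> carrier (A k)" if "(l, k) \<in> r" for k
      using trans_closed[OF that] mc[OF l(1)] by blast
    define J where "J k = Idl\<^bsub>A k\<^esub> (f l k ` m l)" for k
    have Jid: "ideal (J k) (A k)" if "(l, k) \<in> r" for k
      unfolding J_def using rings index_mem[OF that] gc[OF that]
      by (intro ring.genideal_ideal cring.axioms(1)) auto
    have Jtrans: "Idl\<^bsub>A n\<^esub> (f k n ` J k) = J n" if "(l, k) \<in> r" "(k, n) \<in> r" for k n
      unfolding J_def using genideal_trans[OF that mc[OF l(1)]] .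
    have Jsub: "f k n ` J k \<subseteq> J n" if "(l, k) \<in> r" "(k, n) \<in> r" for k n
    proof -
      have "f k n ` J k \<subseteq> carrier (A n)"
        using trans_closed[OF that(2)] cring.idealD(1)[OF rings Jid[OF that(1)]] index_mem[OF that(2)] by blast
      moreover have "cring (A n)"
        using rings index_mem[OF that(2)] by blast
      ultimately show ?thesis
        using ring.genideal_self[OF cring.axioms(1), of "A n" "f k n ` J k"] Jtrans[OF that] by simp
    qed
    let ?K = "{k. (j, k) \<in> r}"
    let ?E = "{cls k y | k y. k \<in> ?K \<and> y \<in> J k}"
    have lK: "(l, k) \<in> r" if "k \<in> ?K" for k
      using index_trans[OF lj] that by blast
    have "ideal ?E ?L"
    proof (rule limit_ideal)
      show "ideal (J k) (A k)" if "k \<in> ?K" for k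
        using Jid[OF lK[OF that]] .
      show "n \<in> ?K \<and> f k n ` J k \<subseteq> J n" if "(k, n) \<in> r" "k \<in> ?K" for k n
        using Jsub[OF lK[OF that(2)] that(1)] index_trans that by blast
      show "?K \<subseteq> \<Gamma>" "?K \<noteq> {}"
        using index_mem index_refl[OF j] by blast+
    qed
    moreover have "U \<subseteq> ?E"
    proof
      fix u assume "u \<in> U"
      then obtain x where x: "x \<in> m l" "u = cls l x"
        using l(2) by blast
      then have "u = cls j (f l j x)"
        using limit_class_trans[OF lj] mc[OF l(1)] by auto
      moreover have "f l j x \<in> J j"
        unfolding J_def using Aj.genideal_self[OF gc[OF lj]] x(1) by blast
      ultimately show "u \<in> ?E"
        using index_refl[OF j] by blast
    qed
    ultimately have ME: "?M \<subseteq> ?E"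
      unfolding U(3) by (rule L.genideal_minimal)
    show "m j \<subseteq> Idl\<^bsub>A j\<^esub> (f l j ` m l)"
    proof
      fix x assume x: "x \<in> m j"
      then have "cls j x \<in> ?M"
        using j by blast
      with ME have "cls j x \<in> ?E" ..
      then obtain k y where k: "(j, k) \<in> r" "y \<in> J k" "cls j x = cls k y"
        by blast
      have lk: "(l, k) \<in> r"
        using index_trans[OF lj k(1)] .
      have kG: "k \<in> \<Gamma>" using index_mem[OF k(1)] by blast
      have yc: "y \<in> carrier (A k)"
        using cring.idealD(1)[OF rings[OF kG] Jid[OF lk] k(2)] .
      have xc: "x \<in> carrier (A j)"
        using mc[OF j] x by blast
      obtain n where n: "(j, n) \<in> r" "(k, n) \<in> r" "f j n x = f k n y"
        using k(3) limit_class_eq_iff[OF j kG xc yc] by blast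
      have "f j n x \<in> Idl\<^bsub>A n\<^esub> (f j n ` J j)"
        using Jsub[OF lk n(2)] k(2) n(3) Jtrans[OF lj n(1)] by auto
      then have "x \<in> J j"
        by (rule pure_hom_contraction[OF pure[OF n(1)] Jid[OF lj] xc])
      then show "x \<in> Idl\<^bsub>A j\<^esub> (f l j ` m l)"
        by (simp add: J_def)
    qed
    show "Idl\<^bsub>A j\<^esub> (f l j ` m l) \<subseteq> m j"
      using m(2)[OF lj] by (rule Aj.genideal_minimal[OF m(1)[OF j]])
  qed
  with l(1) show ?thesis by blast
qed

lemma cofinal_subsystem:
  assumes l: "l \<in> \<Gamma>"
  shows "ring_direct_system {i \<in> \<Gamma>. (l, i) \<in> r} (Restr r {i \<in> \<Gamma>. (l, i) \<in> r}) A f"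
proof (rule ring_direct_system.intro)
  let ?G = "{i \<in> \<Gamma>. (l, i) \<in> r}"
  show "preorder_on ?G (Restr r ?G)"
    using index_refl index_trans by (auto simp: preorder_on_def refl_on_def trans_def)
  show "?G \<noteq> {}"
    using l index_refl by blast
  show "\<exists>k\<in>?G. (i, k) \<in> Restr r ?G \<and> (j, k) \<in> Restr r ?G" if ij: "i \<in> ?G" "j \<in> ?G" for i j
  proof -
    obtain k where "k \<in> \<Gamma>" "(i, k) \<in> r" "(j, k) \<in> r"
      using directed[of i j] ij by blast
    moreover from this have "(l, k) \<in> r"
      using ij index_trans by blast
    ultimately show ?thesis
      using ij by blast
  qed
  show "cring (A i)" if "i \<in> ?G" for i
    using that rings by blast
  show "f i j \<in> ring_hom (A i) (A j)" if "(i, j) \<in> Restr r ?G" for i j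
    using that homs by blast
  show "f i i x = x" if "i \<in> ?G" "x \<in> carrier (A i)" for i x
    using that trans_id by blast
  show "f j k (f i j x) = f i k x"
    if "(i, j) \<in> Restr r ?G" "(j, k) \<in> Restr r ?G" "x \<in> carrier (A i)" for i j k x
    using that trans_comp[of i j k x] by blast
qed

end

section \<open>The flat subsystem\<close>

lemma min_generators_le:
  assumes "finite U" "U \<subseteq> carrier R" "Idl\<^bsub>R\<^esub> U = I"
  shows "min_generators R I \<le> enat (card U)"
  unfolding min_generators_def using assms by (intro Inf_lower) blast

lemma regular_local_ring_generators:
  assumes "regular_local_ring R m"
  obtains U where "finite U" "U \<subseteq> carrier R" "Idl\<^bsub>R\<^esub> U = m" "krull_dim R = enat (card U)"
proof -
  let ?C = "{enat (card U) | U. finite U \<and> U \<subseteq> carrier R \<and> Idl\<^bsub>R\<^esub> U = m}"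
  have R: "noetherian_ring R" "local_ring R m" "krull_dim R = min_generators R m"
    using assms by (auto simp: regular_local_ring_def)
  have "ideal m R"
    using R(2) by (simp add: local_ring_def maximalideal_def)
  then have "\<exists>U\<subseteq>carrier R. finite U \<and> m = Idl\<^bsub>R\<^esub> U"
    by (rule noetherian_ring.finetely_gen[OF R(1)])
  then have "?C \<noteq> {}" by blast
  then have "Inf ?C \<in> ?C"
    by (metis (mono_tags, lifting) Inf_enat_def LeastI_ex ex_in_conv)
  then show ?thesis
    using that R(3) unfolding min_generators_def by auto
qed

theorem corollary3p13:
  fixes \<Gamma> :: "'i set" and r :: "('i \<times> 'i) set"
    and A :: "'i \<Rightarrow> 'a ring" and m :: "'i \<Rightarrow> 'a set" and f :: "'i \<Rightarrow> 'i \<Rightarrow> 'a \<Rightarrow> 'a"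
  assumes "pure_direct_system \<Gamma> r A f"
    and "\<And>i. i \<in> \<Gamma> \<Longrightarrow> regular_local_ring (A i) (m i)"
    and "\<And>i j. (i, j) \<in> r \<Longrightarrow> local_hom (A i) (m i) (A j) (m j) (f i j)"
    and "noetherian_ring (direct_limit \<Gamma> r A f)"
  shows "\<exists>l\<in>\<Gamma>. flat_direct_system {i \<in> \<Gamma>. (l, i) \<in> r} (Restr r {i \<in> \<Gamma>. (l, i) \<in> r}) A f"
proof -
  interpret ring_direct_system \<Gamma> r A f
    using assms(1) by (simp add: pure_direct_system_def)
  have pure: "pure_hom (A i) (A j) (f i j)" if "(i, j) \<in> r" for i j
    using assms(1) that by (auto simp: pure_direct_system_def)
  have reg: "noetherian_ring (A i)" "local_ring (A i) (m i)" "krull_dim (A i) = min_generators (A i) (m i)"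
    if "i \<in> \<Gamma>" for i
    using assms(2)[OF that] by (auto simp: regular_local_ring_def)
  have mid: "ideal (m i) (A i)" if "i \<in> \<Gamma>" for i
    using reg(2)[OF that] by (simp add: local_ring_def maximalideal_def)
  have mtrans: "f i j ` m i \<subseteq> m j" if "(i, j) \<in> r" for i j
    using assms(3)[OF that] by (simp add: local_hom_def)
  obtain l0 where l0: "l0 \<in> \<Gamma>" "\<And>j. (l0, j) \<in> r \<Longrightarrow> m j = Idl\<^bsub>A j\<^esub> (f l0 j ` m l0)"
    using maximal_ideals_eventually_extended[OF pure mid mtrans assms(4)] by blast
  have gen: "Idl\<^bsub>A j\<^esub> (f i j ` U) = m j"
    if "(l0, i) \<in> r" "(i, j) \<in> r" "U \<subseteq> carrier (A i)" "Idl\<^bsub>A i\<^esub> U = m i" for i j U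
  proof -
    interpret ring_hom_cring "A i" "A j" "f i j"
      by (rule hom_cring[OF that(2)])
    have "m l0 \<subseteq> carrier (A l0)"
      using cring.idealD(1)[OF rings[OF l0(1)] mid[OF l0(1)]] by blast
    then have "Idl\<^bsub>A j\<^esub> (f i j ` m i) = m j"
      using genideal_trans[OF that(1,2)] l0(2)[OF that(1)] l0(2)[OF index_trans[OF that(1,2)]] by simp
    then show ?thesis
      using genideal_image[OF that(3)] that(4) by simp
  qed
  define d where "d i = the_enat (krull_dim (A i))" for i
  have d: "krull_dim (A i) = enat (d i)" if "i \<in> \<Gamma>" for i
    using regular_local_ring_generators[OF assms(2)[OF that]] unfolding d_def by (metis the_enat.simps)
  have params: "\<exists>xs. set xs \<subseteq> carrier (A i) \<and> Idl\<^bsub>A i\<^esub> (set xs) = m i \<and> length xs = d i" if i: "i \<in> \<Gamma>" for i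
  proof -
    obtain U where U: "finite U" "U \<subseteq> carrier (A i)" "Idl\<^bsub>A i\<^esub> U = m i" "krull_dim (A i) = enat (card U)"
      using regular_local_ring_generators[OF assms(2)[OF i]] by blast
    obtain xs where "set xs = U" "distinct xs"
      using finite_distinct_list[OF U(1)] by blast
    then show ?thesis
      using U d[OF i] distinct_card[of xs] by (intro exI[of _ xs]) auto
  qed
  \<comment> \<open>\<open>dim A\<^sub>j\<close> is the least number of generators of \<open>m\<^sub>j\<close>, and the images of generators of \<open>m\<^sub>i\<close> generate \<open>m\<^sub>j\<close>.\<close>
  have mono: "d j \<le> d i" if ij: "(l0, i) \<in> r" "(i, j) \<in> r" for i j
  proof -
    have i: "i \<in> \<Gamma>" and j: "j \<in> \<Gamma>"
      using index_mem[OF ij(2)] by auto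
    obtain xs where xs: "set xs \<subseteq> carrier (A i)" "Idl\<^bsub>A i\<^esub> (set xs) = m i" "length xs = d i"
      using params[OF i] by blast
    have "f i j ` set xs \<subseteq> carrier (A j)"
      using trans_closed[OF ij(2)] xs(1) by blast
    then have "min_generators (A j) (m j) \<le> enat (card (f i j ` set xs))"
      using gen[OF ij xs(1,2)] by (intro min_generators_le) auto
    also have "card (f i j ` set xs) \<le> d i"
      using card_image_le[of "set xs" "f i j"] card_length[of xs] xs(3) by simp
    finally show ?thesis
      using reg(3)[OF j] d[OF j] by (metis enat_ord_simps(1))
  qed
  \<comment> \<open>A nonincreasing dimension is constant above an index where it is least.\<close>
  obtain l where l: "(l0, l) \<in> r" "\<And>i. (l0, i) \<in> r \<Longrightarrow> d l \<le> d i"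
    using ex_has_least_nat[of "\<lambda>i. (l0, i) \<in> r" l0 d] index_refl[OF l0(1)] by blast
  have lG: "l \<in> \<Gamma>"
    using index_mem[OF l(1)] by blast
  have flat: "flat_hom (A i) (A j) (f i j)" if ij: "(l, i) \<in> r" "(i, j) \<in> r" for i j
  proof -
    have i: "i \<in> \<Gamma>" and j: "j \<in> \<Gamma>" and li: "(l0, i) \<in> r" and lj: "(l0, j) \<in> r"
      using index_mem[OF ij(2)] index_trans[OF l(1) ij(1)] index_trans ij(2) by blast+
    have "d i = d j"
      using mono[OF l(1) ij(1)] mono[OF li ij(2)] l(2)[OF lj] by simp
    moreover obtain xs where xs: "set xs \<subseteq> carrier (A i)" "Idl\<^bsub>A i\<^esub> (set xs) = m i" "length xs = d i"
      using params[OF i] by blast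
    ultimately have "krull_dim (A j) = enat (length xs)"
      using d[OF j] by simp
    then have "flat_module (A i) (restrict_scalars (f i j) (A j))"
      using ring_hom_cring.flat_of_regular_parameters[OF hom_cring[OF ij(2)] reg(1,2)[OF i] assms(2)[OF j]
        xs(1,2) gen[OF li ij(2) xs(1,2)]] by simp
    then show ?thesis
      using rings[OF i] rings[OF j] homs[OF ij(2)] by (simp add: flat_hom_def)
  qed
  have "flat_direct_system {i \<in> \<Gamma>. (l, i) \<in> r} (Restr r {i \<in> \<Gamma>. (l, i) \<in> r}) A f"
    using cofinal_subsystem[OF lG] flat by (auto simp: flat_direct_system_def)
  with lG show ?thesis by blast
qed

end
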